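(* We have $\mathcal{B}\left(22,4;\left(-\frac1{44},\frac7{22}\right)\right)=\mathcal{B}\left(22,4;\left(-\frac4{11},-\frac1{44}\right)\right)=2025$. Consequently, the code $C_{2025}$ is a tight $\left(-\frac1{44},\frac7{22}\right)$-avoiding spherical $4$-design and a tight $\left(-\frac4{11},-\frac1{44}\right)$-avoiding spherical $4$-design.
   Context: A spherical code is a finite set $C\subset\mathbb{S}^{n-1}$; $I(C)=\{x\cdot y: x,y\in C,\ x\ne y\}$. For $T\subset[-1,1)$, $C$ is $T$-avoiding if $I(C)\cap T=\varnothing$. A spherical $\tau$-design is a spherical code $C$ such that the average over $C$ of every polynomial in $n$ variables of total degree at most $\tau$ equals its average over $\mathbb{S}^{n-1}$ with respect to normalized surface measure. $\mathcal{B}(n,\tau;T)$ is the minimum of $|C|$ over all $T$-avoiding spherical $\tau$-designs $C\subset\mathbb{S}^{n-1}$. Let $P_i^{(n)}$ be the Gegenbauer polynomials: orthogonal on $[-1,1]$ with weight $(1-t^2)^{(n-3)/2}$, $\deg P_i^{(n)}=i$, $P_i^{(n)}(1)=1$; write a real polynomial as $f=\sum_i f_iP_i^{(n)}$. Linear programming gives $\mathcal{B}(n,\tau;T)\ge f(1)/f_0$ for every real polynomial $f$ with $f\ge0$ on $[-1,1]\setminus T$, $f_0>0$, and $f_i\le0$ for all $i\ge\tau+1$. A $T$-avoiding spherical $\tau$-design $C\subset\mathbb{S}^{n-1}$ is called tight if $|C|=f(1)/f_0$ for some such $f$. The code $C_{2025}$: let $L\subset\mathbb{S}^{23}$ be the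 set of the $196560$ minimal vectors of the Leech lattice rescaled to unit length. Fix $x\in L$; let $C_{1/2}\subset\mathbb{S}^{22}$ be the set of vectors $(y-\frac12x)/\sqrt{1-\frac14}$ with $y\in L$, $x\cdot y=\frac12$ (in the unit sphere of $x^\perp\cong\mathbb{R}^{23}$); this is the tight spherical $7$-design with $4600$ points. Let $\widetilde w\in\mathbb{S}^{22}$ be a global minimum of the potential $u\mapsto\sum_{y\in C_{1/2}}h(u\cdot y)$ of $C_{1/2}$ ($h$ an absolutely monotone potential, i.e. $h^{(j)}\ge0$ for $j\ge1$); the inner products of $\widetilde w$ with points of $C_{1/2}$ are $-\frac{\sqrt5}5,-\frac{\sqrt5}{15},\frac{\sqrt5}{15},\frac{\sqrt5}5$, occurring $275,2025,2025,275$ times. With $\alpha=\frac{\sqrt5}{15}$, $C_{2025}$ is the set of vectors $(y-\alpha\widetilde w)/\sqrt{1-\alpha^2}$ with $y\in C_{1/2}$, $y\cdot\widetilde w=\alpha$, regarded as a subset of the unit sphere $\mathbb{S}^{21}$ of the orthogonal complement of $\widetilde w$ in $\mathbb{R}^{23}$. It is a spherical $4$-design with $2025$ points and inner products $-\frac4{11},-\frac1{44},\frac7{22}$.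
   Formalization: The potential h defining w̃ is assumed not to be a polynomial of degree at most 7 on (-1,1); for such h the potential of the 7-design C_{1/2} is constant, so every point is a global minimum and C_2025 is not determined. *)

theory Defs
  imports "HOL-Analysis.Analysis" "HOL-Computational_Algebra.Polynomial"
begin

section \<open>Spherical codes and designs\<close>

text \<open>The dimension n of the ambient space is the cardinality of the index type of
  the vectors, so that the unit sphere of \<open>real ^ 'n\<close> is the (n-1)-dimensional one.\<close>

definition spherical_code :: "(real ^ 'n) set \<Rightarrow> bool" where
  "spherical_code C \<longleftrightarrow> finite C \<and> C \<subseteq> sphere 0 1"

definition inner_products :: "(real ^ 'n) set \<Rightarrow> real set" where
  "inner_products C = {x \<bullet> y | x y. x \<in> C \<and> y \<in> C \<and> x \<noteq> y}"

definition avoiding :: "real set \<Rightarrow> (real ^ 'n) set \<Rightarrow> bool" where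
  "avoiding T C \<longleftrightarrow> inner_products C \<inter> T = {}"

text \<open>Normalized surface measure as cone measure: the measure of a Borel set A of the
  sphere is the proportion of the unit ball filled by the cone over A. Here
  \<open>sgn x = x / norm x\<close>; the centre of the ball is a null set. As a measure on the
  whole space it is concentrated on \<open>sphere 0 1\<close>.\<close>

definition sphere_measure :: "(real ^ 'n) measure" where
  "sphere_measure = distr (uniform_measure lborel (ball 0 1)) borel sgn"

definition polynomials_upto :: "nat \<Rightarrow> (real ^ 'n \<Rightarrow> real) set" where
  "polynomials_upto d =
     {(\<lambda>x. \<Sum>a | (\<Sum>i\<in>UNIV. a i) \<le> d. c a * (\<Prod>i\<in>UNIV. (x $ i) ^ a i)) | c.
       c \<in> (UNIV :: (('n \<Rightarrow> nat) \<Rightarrow> real) set)}"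

definition spherical_design :: "nat \<Rightarrow> (real ^ 'n) set \<Rightarrow> bool" where
  "spherical_design \<tau> C \<longleftrightarrow> spherical_code C \<and> C \<noteq> {} \<and>
     (\<forall>p \<in> polynomials_upto \<tau>.
        (\<Sum>x\<in>C. p x) / real (card C) = integral\<^sup>L sphere_measure p)"

text \<open>The infimum in the natural numbers is attained if some such design exists; if none
  exists, its value is 0, which is not the cardinality of any design.\<close>

definition min_avoiding_design :: "'n::finite itself \<Rightarrow> nat \<Rightarrow> real set \<Rightarrow> nat" where
  "min_avoiding_design (_ :: 'n itself) \<tau> T =
     Inf {card C | C :: (real ^ 'n) set. spherical_design \<tau> C \<and> avoiding T C}"


section \<open>Gegenbauer polynomials and tightness\<close>

definition gegenbauer :: "nat \<Rightarrow> nat \<Rightarrow> real poly" where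
  "gegenbauer n = (THE P.
     (\<forall>i. degree (P i) = i \<and> poly (P i) 1 = 1) \<and>
     (\<forall>i j. i \<noteq> j \<longrightarrow>
        integral {-1..1} (\<lambda>t. poly (P i) t * poly (P j) t *
          (1 - t\<^sup>2) powr ((real n - 3) / 2)) = 0))"

definition gegenbauer_expansion :: "nat \<Rightarrow> real poly \<Rightarrow> (nat \<Rightarrow> real) \<Rightarrow> bool" where
  "gegenbauer_expansion n f c \<longleftrightarrow>
     f = (\<Sum>i\<le>degree f. smult (c i) (gegenbauer n i)) \<and> (\<forall>i>degree f. c i = 0)"

definition tight_avoiding_design :: "nat \<Rightarrow> real set \<Rightarrow> (real ^ 'n) set \<Rightarrow> bool" where
  "tight_avoiding_design \<tau> T C \<longleftrightarrow> spherical_design \<tau> C \<and> avoiding T C \<and>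
     (\<exists>f c. gegenbauer_expansion CARD('n) f c \<and>
        (\<forall>t \<in> {-1..1} - T. poly f t \<ge> 0) \<and> c 0 > 0 \<and> (\<forall>i\<ge>\<tau> + 1. c i \<le> 0) \<and>
        real (card C) = poly f 1 / c 0)"


section \<open>Absolutely monotone potentials\<close>

text \<open>The value at 1 may be infinite, as for the Riesz and Coulomb potentials;
  continuity on the closed interval makes it the limit of the values from the left.\<close>

definition absolutely_monotone_potential :: "(real \<Rightarrow> ereal) \<Rightarrow> bool" where
  "absolutely_monotone_potential h \<longleftrightarrow>
     continuous_on {-1..1} h \<and> (\<forall>t\<in>{-1..<1}. \<bar>h t\<bar> \<noteq> \<infinity>) \<and>
     (\<forall>j. \<forall>t\<in>{-1<..<1}.
        (deriv ^^ j) (\<lambda>s. real_of_ereal (h s)) field_differentiable at t) \<and>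
     (\<forall>j\<ge>1. \<forall>t\<in>{-1<..<1}. (deriv ^^ j) (\<lambda>s. real_of_ereal (h s)) t \<ge> 0)"


section \<open>The Leech lattice and the code with 2025 points\<close>

text \<open>The 24 coordinates are the points of the projective line over the field with 23
  elements: \<open>23\<close> is the type of integers modulo 23 and \<open>None\<close> is the point at infinity.
  The extended binary Golay code, with words given as sets of coordinates, is the
  extended quadratic residue code. It is spanned by the translates of the set consisting
  of infinity and the non-squares (0 is a square).\<close>

type_synonym vec24 = "real ^ (23 option)"

definition golay_generator :: "23 \<Rightarrow> 23 option set" where
  "golay_generator i = insert None {Some (n - i) | n. \<not> (\<exists>b. n = b\<^sup>2)}"

inductive_set golay_code :: "23 option set set" where
  empty: "{} \<in> golay_code"
| add: "A \<in> golay_code \<Longrightarrow>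
    (A - golay_generator i) \<union> (golay_generator i - A) \<in> golay_code"

text \<open>The standard coordinates, scaled by \<open>1 / sqrt 8\<close> so that the lattice is unimodular
  and its minimal vectors have norm 2.\<close>

definition leech_lattice :: "vec24 set" where
  "leech_lattice = {(1 / sqrt 8) *\<^sub>R (\<chi> i. real_of_int (z $ i)) | z m.
     m \<in> {0, 1 :: int} \<and> (\<forall>i. z $ i mod 2 = m) \<and> (\<Sum>i\<in>UNIV. z $ i) mod 8 = 4 * m \<and>
     (\<forall>k. {i. z $ i mod 4 = k} \<in> golay_code)}"

definition minimal_vectors :: "vec24 set \<Rightarrow> vec24 set" where
  "minimal_vectors \<Lambda> = {v \<in> \<Lambda> - {0}. \<forall>u \<in> \<Lambda> - {0}. norm v \<le> norm u}"

definition leech_code :: "vec24 set" where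
  "leech_code = sgn ` minimal_vectors leech_lattice"

definition C_half :: "vec24 \<Rightarrow> vec24 set" where
  "C_half x = {(1 / sqrt (1 - 1/4)) *\<^sub>R (y - (1/2) *\<^sub>R x) | y. y \<in> leech_code \<and> x \<bullet> y = 1/2}"

definition is_minimum_of_potential :: "(real \<Rightarrow> ereal) \<Rightarrow> vec24 \<Rightarrow> vec24 \<Rightarrow> bool" where
  "is_minimum_of_potential h x w \<longleftrightarrow>
     is_arg_min (\<lambda>u. \<Sum>y\<in>C_half x. h (u \<bullet> y)) (\<lambda>u. norm u = 1 \<and> u \<bullet> x = 0) w"

definition C2025 :: "vec24 \<Rightarrow> vec24 \<Rightarrow> vec24 set" where
  "C2025 x w = (let \<alpha> = sqrt 5 / 15 in
     {(1 / sqrt (1 - \<alpha>\<^sup>2)) *\<^sub>R (y - \<alpha> *\<^sub>R w) | y. y \<in> C_half x \<and> y \<bullet> w = \<alpha>})"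

text \<open>Identification of the orthogonal complement of x and w with 22-dimensional space;
  for independent x and w, the map is onto by dimension. Its values off that complement
  are irrelevant.\<close>

definition isometry_on_complement :: "vec24 \<Rightarrow> vec24 \<Rightarrow> (vec24 \<Rightarrow> real ^ 22) \<Rightarrow> bool" where
  "isometry_on_complement x w \<phi> \<longleftrightarrow>
     linear \<phi> \<and> (\<forall>v. v \<bullet> x = 0 \<and> v \<bullet> w = 0 \<longrightarrow> norm (\<phi> v) = norm v)"

end

(*
  The Leech lattice code L (196560 points) is built from the Golay code. Its inner products are zeros
  of an even polynomial whose expansion in zonal polynomials of R^24 has positive coefficients, so the
  linear programming inequality is an equality at L and L is a spherical 11-design. Weighting
  L by a polynomial in <x,y> that isolates one layer turns moments of L into moments of the layer: this
  makes C_half a 7-design and C2025 a 4-design.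

  The point w = (4z - x)/sqrt 15 with <x,z> = 1/4 sees C_half only at the four nodes +-sqrt 5/5,
  +-sqrt 5/15. The polynomial of degree 7 which agrees with h to first order at the nodes lies below h
  (strictly off the nodes unless h is itself such a polynomial) and has constant potential on the
  7-design C_half, so every minimum sees C_half only at the nodes.

  For the bounds, a polynomial f that is nonnegative off T and of degree 4 gives
  f(1) <= |C| f_0 for a T-avoiding 4-design C; the test polynomials vanish at the inner products of C2025.
*)
theory Submission
  imports Defs "HOL-Probability.Probability_Measure" "HOL-Number_Theory.Cong"
begin

section \<open>Moments of powers of linear forms\<close>

text \<open>Averages are handled through powers of linear forms: by polarization these determine all
  polynomial averages, and surface measure and the counting measure of a finite code become
  instances of one locale. Passing to a layer costs the degree of the polynomial isolating it: 4
  from the 11-design \<open>leech_code\<close> to the 7-design \<open>C_half\<close>, 3 from there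
  to the 4-design \<open>C2025\<close>. Golay words, octads and minimal vectors are counted from
  below only; linear programming then turns at least 196560 minimal vectors into exactly 196560. If
  h were a polynomial of degree at most 7, the 7-design \<open>C_half\<close> would have constant
  potential on the unit sphere of the complement of x and every point there would be a minimum; this
  is why the theorem excludes such h. For all other h the eighth derivative must be shown positive
  everywhere: by an argument of Bernstein a single zero would make it vanish identically. A further
  obstacle is that h may be infinite at 1 and is merely continuous at both ends.\<close>

fun sphere_moment :: "nat \<Rightarrow> nat \<Rightarrow> real" where
  "sphere_moment n 0 = 1"
| "sphere_moment n (Suc 0) = 0"
| "sphere_moment n (Suc (Suc k)) = (real k + 1) / (real n + real k) * sphere_moment n k"

lemma sphere_moment_odd: "odd k \<Longrightarrow> sphere_moment n k = 0"
  by (induction n k rule: sphere_moment.induct) auto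

lemma has_derivative_polyfun_0:
  fixes c :: "nat \<Rightarrow> real"
  assumes "k > 0"
  shows "((\<lambda>s. \<Sum>j\<le>k. c j * s^j) has_real_derivative c 1) (at 0)"
proof -
  have "((\<lambda>s. \<Sum>j\<le>k. c j * s^j) has_real_derivative (\<Sum>j\<le>k. c j * (real j * 0^(j - 1)))) (at 0)"
    by (rule DERIV_sum) (auto intro!: derivative_eq_intros)
  also have "(\<Sum>j\<le>k. c j * (real j * 0^(j - 1))) = (\<Sum>j\<in>{1}. c j * (real j * 0^(j - 1)))"
    using assms by (intro sum.mono_neutral_right) (auto simp: power_0_left)
  finally show ?thesis by simp
qed

text \<open>Surface measure and finite counting measures are treated together. Three linear forms
  are allowed because \<open>recursion\<close> multiplies a further form into a mixed moment of two
  others.\<close>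

locale finite_moments =
  fixes M :: "'a::euclidean_space measure"
  assumes integrable: "\<And>x y z i j l. integrable M (\<lambda>u. (x \<bullet> u)^i * (y \<bullet> u)^j * (z \<bullet> u)^l)"
begin

lemma integrable2: "integrable M (\<lambda>u. (x \<bullet> u)^i * (y \<bullet> u)^j)"
  using integrable[of x i y j 0 0] by simp

lemma integrable3: "integrable M (\<lambda>u. (y \<bullet> u) * (x \<bullet> u)^i * (z \<bullet> u)^j)"
  using integrable[of y 1 x i z j] by simp

lemma expand:
  "(\<integral>u. ((x + s *\<^sub>R z) \<bullet> u)^k \<partial>M) =
     (\<Sum>j\<le>k. real (k choose j) * (\<integral>u. (x \<bullet> u)^(k - j) * (z \<bullet> u)^j \<partial>M) * s^j)"
proof -
  have "((x + s *\<^sub>R z) \<bullet> u)^k =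
      (\<Sum>j\<le>k. (real (k choose j) * s^j) * ((x \<bullet> u)^(k - j) * (z \<bullet> u)^j))" for u
  proof -
    have "((x + s *\<^sub>R z) \<bullet> u)^k = (s * (z \<bullet> u) + (x \<bullet> u))^k"
      by (simp add: inner_add_left add.commute)
    then show ?thesis
      unfolding binomial_ring by (auto intro!: sum.cong simp: power_mult_distrib)
  qed
  then have "(\<integral>u. ((x + s *\<^sub>R z) \<bullet> u)^k \<partial>M) =
      (\<Sum>j\<le>k. \<integral>u. (real (k choose j) * s^j) * ((x \<bullet> u)^(k - j) * (z \<bullet> u)^j) \<partial>M)"
    by (simp add: Bochner_Integration.integral_sum integrable2)
  then show ?thesis by (simp add: algebra_simps)
qed

lemma expand':
  "(\<integral>u. (y \<bullet> u) * ((x + s *\<^sub>R z) \<bullet> u)^k \<partial>M) =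
     (\<Sum>j\<le>k. real (k choose j) * (\<integral>u. (y \<bullet> u) * (x \<bullet> u)^(k - j) * (z \<bullet> u)^j \<partial>M) * s^j)"
proof -
  have "(y \<bullet> u) * ((x + s *\<^sub>R z) \<bullet> u)^k =
      (\<Sum>j\<le>k. (real (k choose j) * s^j) * ((y \<bullet> u) * (x \<bullet> u)^(k - j) * (z \<bullet> u)^j))" for u
  proof -
    have "((x + s *\<^sub>R z) \<bullet> u)^k = (s * (z \<bullet> u) + (x \<bullet> u))^k"
      by (simp add: inner_add_left add.commute)
    then show ?thesis
      by (simp only: binomial_ring sum_distrib_left) (auto intro!: sum.cong simp: power_mult_distrib)
  qed
  then have "(\<integral>u. (y \<bullet> u) * ((x + s *\<^sub>R z) \<bullet> u)^k \<partial>M) =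
      (\<Sum>j\<le>k. \<integral>u. (real (k choose j) * s^j) * ((y \<bullet> u) * (x \<bullet> u)^(k - j) * (z \<bullet> u)^j) \<partial>M)"
    by (simp add: Bochner_Integration.integral_sum integrable3)
  then show ?thesis
    by (simp only: Bochner_Integration.integral_mult_right_zero) (simp add: mult_ac)
qed

lemma deriv:
  "((\<lambda>s. \<integral>u. ((x + s *\<^sub>R z) \<bullet> u)^Suc k \<partial>M) has_real_derivative
     (real k + 1) * (\<integral>u. (z \<bullet> u) * (x \<bullet> u)^k \<partial>M)) (at 0)"
  unfolding expand by (rule has_derivative_polyfun_0[THEN DERIV_cong]) (auto simp: mult_ac)

lemma deriv':
  "((\<lambda>s. \<integral>u. (y \<bullet> u) * ((x + s *\<^sub>R z) \<bullet> u)^Suc k \<partial>M) has_real_derivative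
     (real k + 1) * (\<integral>u. (y \<bullet> u) * (z \<bullet> u) * (x \<bullet> u)^k \<partial>M)) (at 0)"
  unfolding expand' by (rule has_derivative_polyfun_0[THEN DERIV_cong]) (auto simp: mult_ac)

end

text \<open>For even k the left side is a power of the quadratic polynomial |x + s z|^2 in s, so the
  formula also holds at x = 0, where the norm itself is not differentiable.\<close>

lemma deriv_norm_power:
  fixes x z :: "'a::real_inner"
  assumes "even k"
  shows "((\<lambda>s. norm (x + s *\<^sub>R z) ^ Suc (Suc k)) has_real_derivative
    (real k + 2) * norm x ^ k * (x \<bullet> z)) (at 0)"
proof -
  obtain e where e: "k = 2 * e" using assms by blast
  have nrm: "norm (x + s *\<^sub>R z) ^ Suc (Suc k) = (x \<bullet> x + 2 * s * (x \<bullet> z) + s^2 * (z \<bullet> z)) ^ Suc e" for s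
  proof -
    have "norm (x + s *\<^sub>R z) ^ Suc (Suc k) = ((norm (x + s *\<^sub>R z))^2) ^ Suc e"
      unfolding e power_mult[symmetric] by simp
    also have "(norm (x + s *\<^sub>R z))^2 = x \<bullet> x + 2 * s * (x \<bullet> z) + s^2 * (z \<bullet> z)"
      by (simp only: power2_norm_eq_inner)
         (simp add: inner_add inner_commute power2_eq_square algebra_simps)
    finally show ?thesis .
  qed
  have nk: "norm x ^ k = (x \<bullet> x) ^ e"
    by (simp add: e power_mult power2_norm_eq_inner)
  have "((\<lambda>s. x \<bullet> x + 2 * s * (x \<bullet> z) + s^2 * (z \<bullet> z)) has_real_derivative 2 * (x \<bullet> z)) (at 0)"
    by (auto intro!: derivative_eq_intros)
  from DERIV_power[OF this, of "Suc e"] show ?thesis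
    unfolding nrm nk by (rule DERIV_cong) (simp add: e algebra_simps)
qed

text \<open>The measure looks like surface measure up to degree d, but only against directions in V.
  In this way a code lying in a hyperplane can stay in its ambient space, with n the dimension of
  the hyperplane.\<close>

locale moments = finite_moments M
  for M :: "'a::euclidean_space measure" +
  fixes V :: "'a set" and n d :: nat
  assumes subspace: "subspace V"
    and dim_pos: "n > 0"
    and moment: "\<And>x k. x \<in> V \<Longrightarrow> k \<le> d \<Longrightarrow>
      (\<integral>u. (x \<bullet> u)^k \<partial>M) = measure M (space M) * sphere_moment n k * norm x ^ k"
begin

text \<open>Differentiate the moment identity at \<open>x\<close> in the direction \<open>y\<close>.\<close>

lemma first_step:
  assumes x: "x \<in> V" and y: "y \<in> V" and k: "Suc k < d"
  shows "(real n + k) * (\<integral>u. (y \<bullet> u) * (x \<bullet> u)^Suc k \<partial>M) =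
     (real k + 1) * (x \<bullet> y) * (\<integral>u. (x \<bullet> u)^k \<partial>M)"
proof -
  let ?m = "measure M (space M)"
  let ?I = "\<integral>u. (y \<bullet> u) * (x \<bullet> u)^Suc k \<partial>M"
  have V: "x + s *\<^sub>R y \<in> V" for s
    using subspace x y by (simp add: subspace_add subspace_scale)
  have D1: "((\<lambda>s. ?m * sphere_moment n (Suc (Suc k)) * norm (x + s *\<^sub>R y) ^ Suc (Suc k))
      has_real_derivative (real k + 2) * ?I) (at 0)"
    using deriv[of x y "Suc k"] moment[OF V, of "Suc (Suc k)"] k by (simp add: add_ac)
  show ?thesis
  proof (cases "even k")
    case False
    then have "sphere_moment n (Suc (Suc k)) = 0" "sphere_moment n k = 0"
      by (auto intro: sphere_moment_odd simp del: sphere_moment.simps)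
    then show ?thesis using D1 moment[OF x, of k] k
      by (auto dest!: DERIV_unique[OF _ DERIV_const] simp del: sphere_moment.simps)
  next
    case True
    have "(real k + 2) * ?I = ?m * sphere_moment n (Suc (Suc k)) * ((real k + 2) * norm x ^ k * (x \<bullet> y))"
      using DERIV_unique[OF D1 DERIV_cmult[OF deriv_norm_power[OF True]]] .
    also have "\<dots> = (real k + 2) * (?m * sphere_moment n (Suc (Suc k)) * (norm x ^ k * (x \<bullet> y)))"
      by (simp only: mult_ac)
    finally have "?I = ?m * sphere_moment n (Suc (Suc k)) * (norm x ^ k * (x \<bullet> y))"
      by (simp del: sphere_moment.simps)
    then show ?thesis
      using dim_pos moment[OF x, of k] k by (simp add: field_simps)
  qed
qed

text \<open>The spherical analogue of Gaussian integration by parts: apply \<open>first_step\<close>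
  at x + s z, where both sides are polynomials in s, and compare the coefficients of s^j.\<close>

lemma recursion:
  assumes x: "x \<in> V" and y: "y \<in> V" and z: "z \<in> V" and k: "Suc (i + j) \<le> d"
  shows "(real n + i + j - 1) * (\<integral>u. (y \<bullet> u) * (x \<bullet> u)^i * (z \<bullet> u)^j \<partial>M) =
     i * (x \<bullet> y) * (\<integral>u. (x \<bullet> u)^(i - 1) * (z \<bullet> u)^j \<partial>M) +
     j * (z \<bullet> y) * (\<integral>u. (x \<bullet> u)^i * (z \<bullet> u)^(j - 1) \<partial>M)"
proof (cases "i + j = 0")
  case True
  then show ?thesis using moment[OF y, of 1] k by simp
next
  case False
  then obtain k where k': "i + j = Suc k" by (metis not0_implies_Suc)
  let ?I = "\<lambda>a b. (\<integral>u. (x \<bullet> u)^a * (z \<bullet> u)^b \<partial>M)"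
  let ?J = "\<lambda>a b. (\<integral>u. (y \<bullet> u) * (x \<bullet> u)^a * (z \<bullet> u)^b \<partial>M)"
  let ?l = "\<lambda>j. (real n + k) * (real (Suc k choose j) * ?J (Suc k - j) j)"
  let ?r = "\<lambda>j. (real k + 1) * ((x \<bullet> y) * (real (k choose j) * ?I (k - j) j) +
      (z \<bullet> y) * (if j = 0 then 0 else real (k choose (j - 1)) * ?I (k - (j - 1)) (j - 1)))"
  have "(\<Sum>j\<le>Suc k. ?l j * s^j) = (\<Sum>j\<le>Suc k. ?r j * s^j)" for s
  proof -
    have V: "x + s *\<^sub>R z \<in> V"
      using subspace x z by (simp add: subspace_add subspace_scale)
    have "(\<Sum>j\<le>Suc k. ?l j * s^j) = (real n + k) * (\<integral>u. (y \<bullet> u) * ((x + s *\<^sub>R z) \<bullet> u)^Suc k \<partial>M)"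
      unfolding expand' sum_distrib_left by (simp only: mult.assoc)
    also have "\<dots> = (real k + 1) * ((x + s *\<^sub>R z) \<bullet> y) * (\<integral>u. ((x + s *\<^sub>R z) \<bullet> u)^k \<partial>M)"
      using first_step[OF V y, of k] k k' by simp
    also have "\<dots> = (real k + 1) * ((x \<bullet> y) * (\<Sum>j\<le>k. real (k choose j) * ?I (k - j) j * s^j) +
        (z \<bullet> y) * (s * (\<Sum>j\<le>k. real (k choose j) * ?I (k - j) j * s^j)))"
      unfolding expand by (simp add: inner_add_left algebra_simps)
    also have "(\<Sum>j\<le>k. real (k choose j) * ?I (k - j) j * s^j) = (\<Sum>j\<le>Suc k. real (k choose j) * ?I (k - j) j * s^j)"
      by (simp add: binomial_eq_0)
    \<comment> \<open>Multiplication by s shifts the coefficients by one; the guard at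
      \<open>j = 0\<close> is required because \<open>0 - 1\<close> is 0 on naturals.\<close>
    also have "s * \<dots> = (\<Sum>j\<le>Suc k. (if j = 0 then 0 else real (k choose (j - 1)) * ?I (k - (j - 1)) (j - 1)) * s^j)"
    proof -
      have "s * (\<Sum>j\<le>Suc k. real (k choose j) * ?I (k - j) j * s^j) = (\<Sum>j\<le>k. real (k choose j) * ?I (k - j) j * s^Suc j)"
        by (simp add: binomial_eq_0 sum_distrib_left algebra_simps)
      also have "\<dots> = (\<Sum>j\<le>Suc k. (if j = 0 then 0 else real (k choose (j - 1)) * ?I (k - (j - 1)) (j - 1)) * s^j)"
        by (subst sum.atMost_Suc_shift) simp
      finally show ?thesis .
    qed
    finally show ?thesis
      by (simp only: sum_distrib_left sum.distrib[symmetric] distrib_right distrib_left mult.assoc)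
  qed
  then have "\<forall>s. (\<Sum>j\<le>Suc k. ?l j * s^j) = (\<Sum>j\<le>Suc k. ?r j * s^j)"
    by blast
  then have eqs: "?l j = ?r j"
    unfolding polyfun_eq_coeffs using k' by auto
  have i: "i = Suc k - j" using k' by simp
  \<comment> \<open>The absorption identities turn the binomial coefficients of k into those of
    \<open>Suc k\<close>, so that a common positive factor cancels.\<close>
  have b1: "real (Suc k) * real (k choose j) = real (Suc k choose j) * i"
    using binomial_absorb_comp[of "Suc k" j] by (metis i diff_Suc_1 of_nat_mult mult.commute)
  show ?thesis
  proof (cases j)
    case 0
    then show ?thesis using eqs i k' by (simp add: algebra_simps)
  next
    case (Suc j')
    have b2: "real (Suc k) * real (k choose (j - 1)) = real (Suc k choose j) * j"
      using Suc_times_binomial_eq[of k j'] Suc by (metis diff_Suc_1 of_nat_mult)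
    have pos: "real (Suc k choose j) > 0" using k' by simp
    have kj: "k - j = i - 1" "k - (j - 1) = i" using k' Suc by auto
    have "real (Suc k choose j) * ((real n + k) * ?J i j) =
      (real (Suc k) * real (k choose j)) * ((x \<bullet> y) * ?I (i - 1) j) +
      (real (Suc k) * real (k choose (j - 1))) * ((z \<bullet> y) * ?I i (j - 1))"
      using eqs Suc unfolding kj i[symmetric] by (simp add: algebra_simps)
    then have "real (Suc k choose j) * ((real n + k) * ?J i j) =
      real (Suc k choose j) * (i * ((x \<bullet> y) * ?I (i - 1) j) + j * ((z \<bullet> y) * ?I i (j - 1)))"
      unfolding b1 b2 by (simp add: algebra_simps)
    then have "(real n + k) * ?J i j = i * ((x \<bullet> y) * ?I (i - 1) j) + j * ((z \<bullet> y) * ?I i (j - 1))"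
      using pos by simp
    moreover have "real n + real i + real j - 1 = real n + real k" using k' by linarith
    ultimately show ?thesis by (simp only: mult.assoc)
  qed
qed

end

section \<open>The uniform measure on the sphere\<close>

lemma distr_lborel_orthogonal:
  fixes f :: "real^'n::{finite,wellorder} \<Rightarrow> real^'n::_"
  assumes f: "orthogonal_transformation f"
  shows "distr lborel borel f = lborel"
proof (rule lborel_eqI[symmetric])
  have cont: "continuous_on UNIV g" if "orthogonal_transformation g" for g :: "real^'n::_ \<Rightarrow> real^'n::_"
    using that orthogonal_transformation_linear linear_continuous_on linear_conv_bounded_linear by blast
  have meas: "f \<in> borel_measurable borel"
    using cont[OF f] by (rule borel_measurable_continuous_onI)
  fix l u :: "real^'n::_"
  assume lu: "\<And>b. b \<in> Basis \<Longrightarrow> l \<bullet> b \<le> u \<bullet> b"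
  let ?g = "inv f"
  have bij: "bij f" using f by (rule orthogonal_transformation_bij)
  have g: "orthogonal_transformation ?g" using f by (rule orthogonal_transformation_inv)
  have vim: "f -` box l u = ?g ` box l u"
    using bij by (simp add: bij_vimage_eq_inv_image)
  have lm: "box l u \<in> lmeasurable" by simp
  have b: "f -` box l u \<in> sets borel"
    using measurable_sets[OF meas, of "box l u"] by simp
  have lm2: "?g ` box l u \<in> lmeasurable" using g lm by (rule measurable_orthogonal_image)
  have "emeasure (distr lborel borel f) (box l u) = emeasure lborel (?g ` box l u)"
    using meas vim by (subst emeasure_distr) auto
  also have "\<dots> = emeasure lebesgue (?g ` box l u)"
    using b vim by simp
  also have "\<dots> = emeasure lebesgue (box l u)"
    using lm lm2 measure_orthogonal_image[OF g lm] by (simp add: emeasure_eq_measure2)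
  also have "\<dots> = (\<Prod>b\<in>Basis. (u - l) \<bullet> b)"
    using lu by (simp add: emeasure_lborel_box)
  finally show "emeasure (distr lborel borel f) (box l u) = (\<Prod>b\<in>Basis. (u - l) \<bullet> b)" .
qed simp

lemma emeasure_ball_01:
  "emeasure lborel (ball (0::real^'n) 1) \<noteq> 0" "emeasure lborel (ball (0::real^'n) 1) \<noteq> \<infinity>"
proof -
  show "emeasure lborel (ball (0::real^'n) 1) \<noteq> \<infinity>"
    using emeasure_lborel_ball_finite[of "0::real^'n" 1] by auto
  show "emeasure lborel (ball (0::real^'n) 1) \<noteq> 0"
    using emeasure_lborel_ball_finite[of "0::real^'n" 1] content_ball_pos[of 1 "0::real^'n"]
    by (auto simp: measure_def)
qed

lemma sgn_measurable: "(sgn :: real^'n \<Rightarrow> real^'n) \<in> borel_measurable borel"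
  unfolding sgn_div_norm by simp

lemma sets_sphere_measure [simp]: "sets (sphere_measure :: (real^'n) measure) = sets borel"
  and space_sphere_measure [simp]: "space (sphere_measure :: (real^'n) measure) = UNIV"
  unfolding sphere_measure_def by simp_all

lemma prob_space_uniform_ball: "prob_space (uniform_measure lborel (ball (0::real^'n) 1))"
  by (rule prob_space_uniform_measure) (use emeasure_ball_01 in auto)

lemma prob_space_sphere: "prob_space (sphere_measure :: (real^'n) measure)"
  unfolding sphere_measure_def
  by (rule prob_space.prob_space_distr[OF prob_space_uniform_ball]) (use sgn_measurable in simp)

lemma AE_sphere: "AE u in (sphere_measure :: (real^'n) measure). norm u = 1"
proof -
  have "AE u in (lborel :: (real^'n) measure). norm (sgn u) = 1"
    using AE_lborel_singleton[of "0::real^'n"] by (rule eventually_mono) (simp add: norm_sgn)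
  then have "AE u in uniform_measure lborel (ball (0::real^'n) 1). norm (sgn u) = 1"
    by (intro AE_uniform_measureI) auto
  then show ?thesis
    unfolding sphere_measure_def
    by (subst AE_distr_iff) (use sgn_measurable in auto)
qed

lemma integrable_sphere:
  fixes f :: "real^'n \<Rightarrow> real"
  assumes "continuous_on UNIV f"
  shows "integrable sphere_measure f"
proof -
  interpret prob_space "sphere_measure :: (real^'n) measure" by (rule prob_space_sphere)
  have "compact (f ` sphere 0 1)"
    using assms by (intro compact_continuous_image) (auto intro: continuous_on_subset)
  then obtain B where "\<And>x. x \<in> f ` sphere 0 1 \<Longrightarrow> norm x \<le> B"
    using compact_imp_bounded bounded_iff by metis
  then have "AE u in sphere_measure. norm (f u) \<le> B"
    using AE_sphere by (rule_tac eventually_mono) auto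
  moreover have "f \<in> borel_measurable sphere_measure"
    using borel_measurable_continuous_onI[OF assms] by (simp cong: measurable_cong_sets)
  ultimately show ?thesis
    by (rule integrable_const_bound)
qed

text \<open>An orthogonal map preserves Lebesgue measure and the unit ball and commutes with
  \<open>sgn\<close>, hence preserves the cone measure.\<close>

lemma integral_sphere_orthogonal:
  fixes f :: "real^'n::{finite,wellorder} \<Rightarrow> real" and R :: "real^'n::_ \<Rightarrow> real^'n::_"
  assumes f: "continuous_on UNIV f" and R: "orthogonal_transformation R"
  shows "(\<integral>u. f (R u) \<partial>sphere_measure) = (\<integral>u. f u \<partial>sphere_measure)"
proof -
  let ?B = "ball (0::real^'n::_) 1"
  have fm: "f \<in> borel_measurable borel" using f by (rule borel_measurable_continuous_onI)
  have Rm: "R \<in> borel_measurable borel"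
    using R orthogonal_transformation_linear linear_continuous_on linear_conv_bounded_linear
      borel_measurable_continuous_onI by blast
  have sgnR: "sgn (R u) = R (sgn u)" for u
    using R by (simp add: sgn_div_norm orthogonal_transformation_norm orthogonal_transformation_scaleR)
  have ball: "R u \<in> ?B \<longleftrightarrow> u \<in> ?B" for u
    using R by (simp add: orthogonal_transformation_norm)
  have um: "uniform_measure lborel ?B = density lborel (\<lambda>u. ennreal (indicator ?B u / measure lborel ?B))"
    unfolding uniform_measure_def
  proof (intro arg_cong2[where f = density] refl ext)
    fix u :: "real^'n::_"
    have "measure lborel ?B > 0"
      using content_ball_pos[of 1 "0::real^'n::_"] by simp
    then have "ennreal (indicator ?B u) / ennreal (measure lborel ?B) = ennreal (indicator ?B u / measure lborel ?B)"
      by (intro divide_ennreal) auto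
    then show "indicator ?B u / emeasure lborel ?B = ennreal (indicator ?B u / measure lborel ?B)"
      using emeasure_ball_01(2) by (subst emeasure_eq_ennreal_measure) (simp_all add: ennreal_indicator)
  qed
  have eq: "(\<integral>u. g u \<partial>sphere_measure) =
      (\<integral>u. (indicator ?B u / measure lborel ?B) * g (sgn u) \<partial>lborel)" if "g \<in> borel_measurable borel"
    for g :: "real^'n::_ \<Rightarrow> real"
  proof -
    have m: "(\<lambda>u. g (sgn u)) \<in> borel_measurable borel"
      using measurable_compose[OF sgn_measurable that] .
    have "(\<integral>u. g u \<partial>sphere_measure) = (\<integral>u. g (sgn u) \<partial>uniform_measure lborel ?B)"
      unfolding sphere_measure_def using that sgn_measurable by (intro integral_distr) auto
    also have "\<dots> = (\<integral>u. (indicator ?B u / measure lborel ?B) * g (sgn u) \<partial>lborel)"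
      unfolding um using m by (subst integral_real_density) (auto intro!: borel_measurable_divide borel_measurable_indicator)
    finally show ?thesis .
  qed
  have "(\<integral>u. (indicator ?B u / measure lborel ?B) * f (R (sgn u)) \<partial>lborel) =
      (\<integral>u. (indicator ?B (R u) / measure lborel ?B) * f (sgn (R u)) \<partial>lborel)"
    by (intro Bochner_Integration.integral_cong) (auto simp: sgnR ball indicator_def orthogonal_transformation_norm[OF R])
  also have "\<dots> = (\<integral>u. (indicator ?B u / measure lborel ?B) * f (sgn u) \<partial>distr lborel borel R)"
    using Rm measurable_compose[OF sgn_measurable fm]
    by (intro integral_distr[symmetric] borel_measurable_times borel_measurable_divide borel_measurable_indicator) auto
  finally show ?thesis
    using fm Rm by (simp add: eq distr_lborel_orthogonal[OF R])
qed

lemma finite_moments_sphere: "finite_moments (sphere_measure :: (real^'n) measure)"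
  by standard (intro integrable_sphere continuous_intros)

text \<open>Rotation invariance gives m k * |x|^k for the k-th moment of the form x. Differentiating
  twice in a direction b and summing over an orthonormal basis, a Laplacian in disguise, yields (n +
  k) m (k+2) = (k + 1) m k, because |u| = 1 almost everywhere.\<close>

lemma moments_sphere:
  "moments (sphere_measure :: (real^'n::{finite,wellorder}) measure) UNIV CARD('n) d"
proof -
  let ?S = "sphere_measure :: (real^'n::_) measure"
  interpret finite_moments ?S by (rule finite_moments_sphere)
  interpret prob_space ?S by (rule prob_space_sphere)
  obtain e :: "real^'n::_" where e: "norm e = 1" using vector_choose_size[of 1] by auto
  define m where "m k = (\<integral>u. (e \<bullet> u)^k \<partial>?S)" for k
  have inv: "(\<integral>u. (x \<bullet> u)^k \<partial>?S) = m k * norm x ^ k" for x k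
  proof -
    obtain f where f: "orthogonal_transformation f" "f (norm x *\<^sub>R e) = x"
      using orthogonal_transformation_exists[of "norm x *\<^sub>R e" x] e by auto
    have "(\<integral>u. (x \<bullet> u)^k \<partial>?S) = (\<integral>u. (x \<bullet> f u)^k \<partial>?S)"
      by (rule integral_sphere_orthogonal[OF _ f(1), symmetric]) (intro continuous_intros)
    also have "(\<lambda>u. (x \<bullet> f u)^k) = (\<lambda>u. norm x ^ k * (e \<bullet> u)^k)"
    proof
      fix u
      have "x \<bullet> f u = f (norm x *\<^sub>R e) \<bullet> f u" using f by simp
      also have "\<dots> = norm x * (e \<bullet> u)"
        using f(1) unfolding orthogonal_transformation_def by (metis inner_scaleR_left)
      finally show "(x \<bullet> f u)^k = norm x ^ k * (e \<bullet> u)^k" by (simp add: power_mult_distrib)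
    qed
    finally show ?thesis by (simp add: m_def)
  qed
  have P: "measure ?S UNIV = 1" using prob_space by simp
  have m0: "m 0 = 1" unfolding m_def using P by simp
  have modd: "m k = 0" if "odd k" for k
  proof -
    have "(\<integral>u. (-e \<bullet> u)^k \<partial>?S) = - m k"
      using that unfolding m_def by simp
    with inv[of "-e" k] e show ?thesis by simp
  qed
  have meven: "(real CARD('n) + k) * m (Suc (Suc k)) = (real k + 1) * m k" if k: "even k" for k
  proof -
    have step1: "(\<integral>u. (b \<bullet> u) * (x \<bullet> u)^Suc k \<partial>?S) = m (Suc (Suc k)) * (norm x ^ k * (x \<bullet> b))" for x b
    proof -
      have "(real (Suc k) + 1) * (\<integral>u. (b \<bullet> u) * (x \<bullet> u)^Suc k \<partial>?S)
          = m (Suc (Suc k)) * ((real k + 2) * norm x ^ k * (x \<bullet> b))"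
        using DERIV_unique[OF deriv[of x b "Suc k"]] DERIV_cmult[OF deriv_norm_power[OF k], of "m (Suc (Suc k))" x b]
        unfolding inv by blast
      then have "(real k + 2) * (\<integral>u. (b \<bullet> u) * (x \<bullet> u)^Suc k \<partial>?S)
          = (real k + 2) * (m (Suc (Suc k)) * (norm x ^ k * (x \<bullet> b)))"
        by (simp add: algebra_simps)
      then show ?thesis by simp
    qed
    have step2: "(real k + 1) * (\<integral>u. (b \<bullet> u) * (b \<bullet> u) * (e \<bullet> u)^k \<partial>?S)
        = m (Suc (Suc k)) * (real k * (e \<bullet> b)^2 + 1)" if b: "b \<in> Basis" for b
    proof -
      have "((\<lambda>s. norm (e + s *\<^sub>R b) ^ k) has_real_derivative real k * (e \<bullet> b)) (at 0)"
      proof (cases "k = 0")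
        case False
        \<comment> \<open>\<open>deriv_norm_power\<close> speaks about exponents of the form l + 2,
          so exponent 0 is treated apart.\<close>
        define l where "l = k - 2"
        have l: "k = Suc (Suc l)" "even l"
          using k False unfolding l_def by (cases k; cases "k - 1"; simp)+
        show ?thesis unfolding l(1)
          using deriv_norm_power[OF l(2), of e b] by (rule DERIV_cong) (simp add: e)
      qed simp
      moreover have "((\<lambda>s. (e + s *\<^sub>R b) \<bullet> b) has_real_derivative 1) (at 0)"
      proof -
        have "(\<lambda>s. (e + s *\<^sub>R b) \<bullet> b) = (\<lambda>s. e \<bullet> b + s)"
          using b by (simp add: inner_add_left)
        then show ?thesis by (auto intro!: derivative_eq_intros)
      qed
      ultimately have "((\<lambda>s. norm (e + s *\<^sub>R b) ^ k * ((e + s *\<^sub>R b) \<bullet> b)) has_real_derivative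
          real k * (e \<bullet> b)^2 + 1) (at 0)"
        by (rule DERIV_mult[THEN DERIV_cong]) (simp add: e power2_eq_square)
      from DERIV_cmult[OF this, of "m (Suc (Suc k))"] show ?thesis
        using DERIV_unique[OF deriv'[of b e b k]] unfolding step1 by blast
    qed
    have unit: "(\<Sum>b\<in>Basis. (u \<bullet> b)^2) = norm u ^ 2" for u :: "real^'n::_"
      unfolding power2_norm_eq_inner euclidean_inner[of u u] by (simp only: power2_eq_square)
    have "(real k + 1) * m k = (real k + 1) * (\<integral>u. (\<Sum>b\<in>Basis. (b \<bullet> u) * (b \<bullet> u) * (e \<bullet> u)^k) \<partial>?S)"
    proof -
      have "(\<Sum>b\<in>Basis. (b \<bullet> u) * (b \<bullet> u) * (e \<bullet> u)^k) = norm u ^ 2 * (e \<bullet> u)^k" for u :: "real^'n::_"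
        unfolding unit[symmetric] by (simp add: sum_distrib_right power2_eq_square inner_commute)
      then have "(\<integral>u. (\<Sum>b\<in>Basis. (b \<bullet> u) * (b \<bullet> u) * (e \<bullet> u)^k) \<partial>?S) = (\<integral>u. norm u ^ 2 * (e \<bullet> u)^k \<partial>?S)"
        by simp
      also have "\<dots> = m k" unfolding m_def
        by (intro integral_cong_AE borel_measurable_integrable integrable_sphere continuous_intros)
           (rule eventually_mono[OF AE_sphere], simp)
      finally show ?thesis by simp
    qed
    also have "\<dots> = (\<Sum>b\<in>Basis. (real k + 1) * (\<integral>u. (b \<bullet> u) * (b \<bullet> u) * (e \<bullet> u)^k \<partial>?S))"
      by (subst Bochner_Integration.integral_sum)
         (auto intro!: integrable_sphere continuous_intros simp: sum_distrib_left)
    also have "\<dots> = m (Suc (Suc k)) * (real k * (\<Sum>b\<in>Basis. (e \<bullet> b)^2) + CARD('n))"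
      using step2 by (simp add: sum_distrib_left[symmetric] sum.distrib)
    finally show ?thesis using e by (simp add: unit algebra_simps)
  qed
  have m: "m k = sphere_moment CARD('n) k" for k
  proof (induction "CARD('n)" k rule: sphere_moment.induct)
    case (3 k)
    show ?case
    proof (cases "even k")
      case True
      then have "m (Suc (Suc k)) = (real k + 1) * m k / (real CARD('n) + real k)"
        using meven[OF True] add_pos_nonneg[of "real CARD('n)" "real k"] by (simp add: field_simps)
      then show ?thesis using 3 by simp
    qed (auto simp: modd sphere_moment_odd)
  qed (auto simp: m0 modd)
  show ?thesis
    by standard (auto simp: inv m P)
qed

text \<open>The mean of (x . u)^i (z . u)^j over the sphere for unit vectors with x . z = t. The
  clause is \<open>recursion\<close> with y = x; where a predecessor is truncated at 0, its term
  carries the factor 0.\<close>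

fun mixed_moment :: "nat \<Rightarrow> real \<Rightarrow> nat \<Rightarrow> nat \<Rightarrow> real" where
  "mixed_moment n t 0 j = sphere_moment n j"
| "mixed_moment n t (Suc i) j =
    (i * mixed_moment n t (i - 1) j + j * t * mixed_moment n t i (j - 1)) / (real n - 1 + (i + j))"

lemma (in moments) mixed_moment:
  assumes "x \<in> V" "z \<in> V" "norm x = 1" "norm z = 1" "i + j \<le> d"
  shows "(\<integral>u. (x \<bullet> u)^i * (z \<bullet> u)^j \<partial>M) = measure M (space M) * mixed_moment n (x \<bullet> z) i j"
  using assms(5)
proof (induction i arbitrary: j rule: less_induct)
  case (less i)
  show ?case
  proof (cases i)
    case 0
    then show ?thesis using moment[OF assms(2), of j] assms(4) less.prems by simp
  next
    case (Suc k)
    let ?m = "measure M (space M)"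
    have 1: "real k * (\<integral>u. (x \<bullet> u)^(k - 1) * (z \<bullet> u)^j \<partial>M) =
        real k * (?m * mixed_moment n (x \<bullet> z) (k - 1) j)"
      using less.IH[of "k - 1" j] less.prems Suc by (cases "k = 0") auto
    have 2: "(\<integral>u. (x \<bullet> u)^k * (z \<bullet> u)^(j - 1) \<partial>M) =
        ?m * mixed_moment n (x \<bullet> z) k (j - 1)"
      using less.IH[of k "j - 1"] less.prems Suc by auto
    show ?thesis
    \<comment> \<open>Here the denominator in the recursive clause is 0; the resulting value 0 is
      correct because first moments vanish.\<close>
    proof (cases "k + j = 0 \<and> n = 1")
      case True
      then show ?thesis using Suc moment[OF assms(1), of 1] less.prems by simp
    next
      case False
      then have pos: "real n - 1 + real (k + j) > 0" using dim_pos by auto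
      have "x \<bullet> x = 1" using assms(3) by (simp add: norm_eq_1)
      then have "(real n - 1 + real (k + j)) * (\<integral>u. (x \<bullet> u)^i * (z \<bullet> u)^j \<partial>M) =
         k * (?m * mixed_moment n (x \<bullet> z) (k - 1) j) + j * (x \<bullet> z) * (?m * mixed_moment n (x \<bullet> z) k (j - 1))"
        using recursion[OF assms(1,1,2), of k j] less.prems Suc 1 2
        by (simp add: inner_commute algebra_simps)
      then show ?thesis using pos unfolding Suc by (simp add: field_simps)
    qed
  qed
qed

section \<open>Tables of mixed moments in dimension 24\<close>

lemma mixed_moment_numeral:
  "mixed_moment n t (numeral w) j =
    (real (pred_numeral w) * mixed_moment n t (pred_numeral w - 1) j +
      j * t * mixed_moment n t (pred_numeral w) (j - 1)) / (real n - 1 + (real (pred_numeral w) + j))"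
  by (simp add: numeral_eq_Suc)

lemma sphere_moment_24:
  "sphere_moment 24 2 = 1/24"
  "sphere_moment 24 4 = 1/208"
  "sphere_moment 24 6 = 5/5824"
  "sphere_moment 24 8 = 1/4992"
  "sphere_moment 24 10 = 3/53248"
  by (simp_all add: eval_nat_numeral)

text \<open>Each table follows from the two before it. The exponents reach 10 and 10 since
  \<open>zonal_kernel_nonneg\<close> integrates products of two polynomials of degree up to
  10.\<close>

lemma mixed_moment_24_1:
  "mixed_moment 24 t (Suc 0) (Suc 0) = 1/24 * t"
  "mixed_moment 24 t (Suc 0) 3 = 1/208 * t"
  "mixed_moment 24 t (Suc 0) 5 = 5/5824 * t"
  "mixed_moment 24 t (Suc 0) 7 = 1/4992 * t"
  "mixed_moment 24 t (Suc 0) 9 = 3/53248 * t"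
  by (simp_all add: sphere_moment_24)
     (simp_all add: field_simps power_numeral_even power_numeral_odd)?

lemma mixed_moment_24_2:
  "mixed_moment 24 t 2 0 = 1/24"
  "mixed_moment 24 t 2 2 = 1/624 * (1 + 2 * t^2)"
  "mixed_moment 24 t 2 4 = 1/5824 * (1 + 4 * t^2)"
  "mixed_moment 24 t 2 6 = 1/34944 * (1 + 6 * t^2)"
  "mixed_moment 24 t 2 8 = 1/159744 * (1 + 8 * t^2)"
  "mixed_moment 24 t 2 10 = 3/1810432 * (1 + 10 * t^2)"
  by (simp_all add: mixed_moment_numeral mixed_moment_24_1 sphere_moment_24)
     (simp_all add: field_simps power_numeral_even power_numeral_odd)?

lemma mixed_moment_24_3:
  "mixed_moment 24 t 3 (Suc 0) = 1/208 * t"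
  "mixed_moment 24 t 3 3 = 1/5824 * (3 * t + 2 * t^3)"
  "mixed_moment 24 t 3 5 = 1/34944 * (3 * t + 4 * t^3)"
  "mixed_moment 24 t 3 7 = 1/53248 * (t + 2 * t^3)"
  "mixed_moment 24 t 3 9 = 3/1810432 * (3 * t + 8 * t^3)"
  by (simp_all add: mixed_moment_numeral mixed_moment_24_2 mixed_moment_24_1 sphere_moment_24)
     (simp_all add: field_simps power_numeral_even power_numeral_odd)?

lemma mixed_moment_24_4:
  "mixed_moment 24 t 4 0 = 1/208"
  "mixed_moment 24 t 4 2 = 1/5824 * (1 + 4 * t^2)"
  "mixed_moment 24 t 4 4 = 1/174720 * (3 + 24 * t^2 + 8 * t^4)"
  "mixed_moment 24 t 4 6 = 1/372736 * (1 + 12 * t^2 + 8 * t^4)"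
  "mixed_moment 24 t 4 8 = 1/1810432 * (1 + 16 * t^2 + 16 * t^4)"
  "mixed_moment 24 t 4 10 = 1/21725184 * (3 + 60 * t^2 + 80 * t^4)"
  by (simp_all add: mixed_moment_numeral mixed_moment_24_3 mixed_moment_24_2 sphere_moment_24)
     (simp_all add: field_simps power_numeral_even power_numeral_odd)?

lemma mixed_moment_24_5:
  "mixed_moment 24 t 5 (Suc 0) = 5/5824 * t"
  "mixed_moment 24 t 5 3 = 1/34944 * (3 * t + 4 * t^3)"
  "mixed_moment 24 t 5 5 = 1/1118208 * (15 * t + 40 * t^3 + 8 * t^5)"
  "mixed_moment 24 t 5 7 = 1/1810432 * (5 * t + 20 * t^3 + 8 * t^5)"
  "mixed_moment 24 t 5 9 = 1/21725184 * (15 * t + 80 * t^3 + 48 * t^5)"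
  by (simp_all add: mixed_moment_numeral mixed_moment_24_4 mixed_moment_24_3 sphere_moment_24)
     (simp_all add: field_simps power_numeral_even power_numeral_odd)?

lemma mixed_moment_24_6:
  "mixed_moment 24 t 6 0 = 5/5824"
  "mixed_moment 24 t 6 2 = 1/34944 * (1 + 6 * t^2)"
  "mixed_moment 24 t 6 4 = 1/372736 * (1 + 12 * t^2 + 8 * t^4)"
  "mixed_moment 24 t 6 6 = 1/12673024 * (5 + 90 * t^2 + 120 * t^4 + 16 * t^6)"
  "mixed_moment 24 t 6 8 = 1/65175552 * (5 + 120 * t^2 + 240 * t^4 + 64 * t^6)"
  "mixed_moment 24 t 6 10 = 5/275185664 * (1 + 30 * t^2 + 80 * t^4 + 32 * t^6)"
  by (simp_all add: mixed_moment_numeral mixed_moment_24_5 mixed_moment_24_4 sphere_moment_24)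
     (simp_all add: field_simps power_numeral_even power_numeral_odd)?

lemma mixed_moment_24_7:
  "mixed_moment 24 t 7 (Suc 0) = 1/4992 * t"
  "mixed_moment 24 t 7 3 = 1/53248 * (t + 2 * t^3)"
  "mixed_moment 24 t 7 5 = 1/1810432 * (5 * t + 20 * t^3 + 8 * t^5)"
  "mixed_moment 24 t 7 7 = 1/65175552 * (35 * t + 210 * t^3 + 168 * t^5 + 16 * t^7)"
  "mixed_moment 24 t 7 9 = 1/275185664 * (35 * t + 280 * t^3 + 336 * t^5 + 64 * t^7)"
  by (simp_all add: mixed_moment_numeral mixed_moment_24_6 mixed_moment_24_5 sphere_moment_24)
     (simp_all add: field_simps power_numeral_even power_numeral_odd)?

lemma mixed_moment_24_8:
  "mixed_moment 24 t 8 0 = 1/4992"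
  "mixed_moment 24 t 8 2 = 1/159744 * (1 + 8 * t^2)"
  "mixed_moment 24 t 8 4 = 1/1810432 * (1 + 16 * t^2 + 16 * t^4)"
  "mixed_moment 24 t 8 6 = 1/65175552 * (5 + 120 * t^2 + 240 * t^4 + 64 * t^6)"
  "mixed_moment 24 t 8 8 = 1/2476670976 * (35 + 1120 * t^2 + 3360 * t^4 + 1792 * t^6 + 128 * t^8)"
  "mixed_moment 24 t 8 10 = 1/2201485312 * (7 + 280 * t^2 + 1120 * t^4 + 896 * t^6 + 128 * t^8)"
  by (simp_all add: mixed_moment_numeral mixed_moment_24_7 mixed_moment_24_6 sphere_moment_24)
     (simp_all add: field_simps power_numeral_even power_numeral_odd)?

lemma mixed_moment_24_9:
  "mixed_moment 24 t 9 (Suc 0) = 3/53248 * t"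
  "mixed_moment 24 t 9 3 = 3/1810432 * (3 * t + 8 * t^3)"
  "mixed_moment 24 t 9 5 = 1/21725184 * (15 * t + 80 * t^3 + 48 * t^5)"
  "mixed_moment 24 t 9 7 = 1/275185664 * (35 * t + 280 * t^3 + 336 * t^5 + 64 * t^7)"
  "mixed_moment 24 t 9 9 = 1/11007426560 * (315 * t + 3360 * t^3 + 6048 * t^5 + 2304 * t^7 + 128 * t^9)"
  by (simp_all add: mixed_moment_numeral mixed_moment_24_8 mixed_moment_24_7 sphere_moment_24)
     (simp_all add: field_simps power_numeral_even power_numeral_odd)?

lemma mixed_moment_24_10:
  "mixed_moment 24 t 10 0 = 3/53248"
  "mixed_moment 24 t 10 2 = 3/1810432 * (1 + 10 * t^2)"
  "mixed_moment 24 t 10 4 = 1/21725184 * (3 + 60 * t^2 + 80 * t^4)"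
  "mixed_moment 24 t 10 6 = 5/275185664 * (1 + 30 * t^2 + 80 * t^4 + 32 * t^6)"
  "mixed_moment 24 t 10 8 = 1/2201485312 * (7 + 280 * t^2 + 1120 * t^4 + 896 * t^6 + 128 * t^8)"
  "mixed_moment 24 t 10 10 = 1/92462383104 * (63 + 3150 * t^2 + 16800 * t^4 + 20160 * t^6 + 5760 * t^8 + 256 * t^10)"
  by (simp_all add: mixed_moment_numeral mixed_moment_24_9 mixed_moment_24_8 sphere_moment_24)
     (simp_all add: field_simps power_numeral_even power_numeral_odd)?

section \<open>Zonal polynomials in dimension 24 and the design property of kissing codes\<close>

text \<open>The monic Gegenbauer polynomials of degree \<open>2k + 2\<close>, \<open>k < 5\<close>, for dimension 24; only even powers occur.\<close>

definition zonal_coeffs :: "real list list" where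
  "zonal_coeffs = [[-1/24, 1], [3/728, -3/14, 1], [-1/1792, 3/64, -15/32, 1], [7/78336, -35/3264, 35/204, -7/9, 1], [-21/1323008, 105/41344, -35/608, 63/152, -9/8, 1]]"

definition zonal :: "nat \<Rightarrow> real \<Rightarrow> real" where
  "zonal k t = (\<Sum>i\<le>Suc k. zonal_coeffs ! k ! i * t^(2 * i))"

lemma zonal_explicit:
  "zonal 0 t = -1/24 + t^2"
  "zonal (Suc 0) t = 3/728 + (-3/14) * t^2 + t^4"
  "zonal 2 t = -1/1792 + (3/64) * t^2 + (-15/32) * t^4 + t^6"
  "zonal 3 t = 7/78336 + (-35/3264) * t^2 + (35/204) * t^4 + (-7/9) * t^6 + t^8"
  "zonal 4 t = -21/1323008 + (105/41344) * t^2 + (-35/608) * t^4 + (63/152) * t^6 + (-9/8) * t^8 + t^10"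
  by (simp_all add: zonal_def zonal_coeffs_def eval_nat_numeral)

text \<open>A Funk-Hecke identity: the zonal function is orthogonal to lower even powers of any
  linear form, and its pairing with the leading power is again zonal. The factor in the list is the
  squared L2 norm of the monic polynomial divided by its value at 1.\<close>

lemma zonal_reproducing:
  assumes "k \<in> {..<5}" "j \<in> {..Suc k}"
  shows "(\<Sum>i\<le>Suc k. zonal_coeffs ! k ! i * mixed_moment 24 t (2 * i) (2 * j)) =
    (if j = Suc k then [1/312, 1/21840, 1/792064, 1/19348992, 1/361181184] ! k * zonal k t else 0)"
proof -
  have five: "{..<5} = {0, Suc 0, 2, 3, 4 :: nat}" by (auto simp: eval_nat_numeral)
  have sets: "{..Suc 0} = {0, 1 :: nat}" "{..Suc (Suc 0)} = {0, 1, 2 :: nat}"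
    by auto
  have *: "\<forall>k\<in>{..<5}. \<forall>j\<in>{..Suc k}.
     (\<Sum>i\<in>{..Suc k}. zonal_coeffs ! k ! i * mixed_moment 24 t (2 * i) (2 * j)) =
    (if j = Suc k then [1/312, 1/21840, 1/792064, 1/19348992, 1/361181184] ! k * zonal k t else 0)"
    unfolding five
    apply (simp add: zonal_explicit zonal_coeffs_def atMost_nat_numeral atMost_Suc del: mixed_moment.simps(2))
    apply (intro conjI)
    apply (simp_all add: sphere_moment_24 mixed_moment_24_2 mixed_moment_24_4
        mixed_moment_24_6 mixed_moment_24_8 mixed_moment_24_10 del: mixed_moment.simps(2))
    apply (simp_all add: field_simps)
    apply (simp add: power2_eq_square)
    done
  show ?thesis using bspec[OF bspec[OF * assms(1)] assms(2)] by simp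
qed

text \<open>Up to a positive factor the double sum is the integral of the square of u \<mapsto> sum
  of a x * \<open>zonal k (p x \<bullet> u)\<close>, since the zonal kernel reproduces
  itself.\<close>

lemma zonal_kernel_nonneg:
  fixes p :: "'b \<Rightarrow> real^24" and a :: "'b \<Rightarrow> real"
  assumes S: "\<And>x. x \<in> S \<Longrightarrow> norm (p x) = 1" and k: "k < 5"
  shows "0 \<le> (\<Sum>x\<in>S. \<Sum>y\<in>S. a x * a y * zonal k (p x \<bullet> p y))"
proof -
  let ?M = "sphere_measure :: (real^24) measure"
  interpret moments ?M UNIV 24 "4 * Suc k"
    using moments_sphere[where 'n = 24] by simp
  have P: "measure ?M UNIV = 1" using prob_space.prob_space[OF prob_space_sphere[where 'n = 24]] by simp
  define \<kappa> where "\<kappa> = [1/312, 1/21840, 1/792064, 1/19348992, 1/361181184 :: real] ! k"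
  have \<kappa>: "\<kappa> > 0"
    using k unfolding \<kappa>_def by (auto simp: less_Suc_eq numeral_eq_Suc)
  let ?c = "\<lambda>i. zonal_coeffs ! k ! i"
  have lead: "?c (Suc k) = 1"
    using k by (auto simp: less_Suc_eq numeral_eq_Suc zonal_coeffs_def)
  have int: "integrable ?M (\<lambda>u. zonal k (x \<bullet> u) * zonal k (y \<bullet> u))" for x y
    unfolding zonal_def by (intro integrable_sphere continuous_intros)
  have rep: "(\<integral>u. zonal k (x \<bullet> u) * zonal k (y \<bullet> u) \<partial>?M) = \<kappa> * zonal k (x \<bullet> y)"
    if "norm x = 1" "norm y = 1" for x y
  proof -
    have "(\<integral>u. zonal k (x \<bullet> u) * zonal k (y \<bullet> u) \<partial>?M) =
        (\<integral>u. (\<Sum>j\<le>Suc k. \<Sum>i\<le>Suc k. (?c j * ?c i) * ((x \<bullet> u)^(2 * i) * (y \<bullet> u)^(2 * j))) \<partial>?M)"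
      unfolding zonal_def sum_product
      by (subst sum.swap) (simp only: mult_ac)
    also have "\<dots> = (\<Sum>j\<le>Suc k. \<Sum>i\<le>Suc k. (?c j * ?c i) * (\<integral>u. (x \<bullet> u)^(2 * i) * (y \<bullet> u)^(2 * j) \<partial>?M))"
      by (subst Bochner_Integration.integral_sum, intro integrable_sphere continuous_intros)
         (intro sum.cong refl, subst Bochner_Integration.integral_sum, intro integrable_sphere continuous_intros, simp)
    also have "\<dots> = (\<Sum>j\<le>Suc k. \<Sum>i\<le>Suc k. (?c j * ?c i) * mixed_moment 24 (x \<bullet> y) (2 * i) (2 * j))"
      by (intro sum.cong refl arg_cong2[where f = "(*)"]) (use that in \<open>simp add: mixed_moment P del: mixed_moment.simps\<close>)
    also have "\<dots> = (\<Sum>j\<le>Suc k. ?c j * (\<Sum>i\<le>Suc k. ?c i * mixed_moment 24 (x \<bullet> y) (2 * i) (2 * j)))"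
      unfolding sum_distrib_left by (simp only: mult.assoc)
    also have "\<dots> = (\<Sum>j\<le>Suc k. ?c j * (if j = Suc k then \<kappa> * zonal k (x \<bullet> y) else 0))"
      using zonal_reproducing[of k] k unfolding \<kappa>_def
      by (intro sum.cong refl arg_cong2[where f = "(*)"]) (simp del: sum.atMost_Suc mixed_moment.simps)
    also have "\<dots> = \<kappa> * zonal k (x \<bullet> y)"
      using lead by simp
    finally show ?thesis .
  qed
  have "0 \<le> (\<integral>u. (\<Sum>x\<in>S. a x * zonal k (p x \<bullet> u))^2 \<partial>?M)"
    by (intro Bochner_Integration.integral_nonneg) auto
  also have "\<dots> = (\<integral>u. (\<Sum>x\<in>S. \<Sum>y\<in>S. (a x * a y) * (zonal k (p x \<bullet> u) * zonal k (p y \<bullet> u))) \<partial>?M)"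
    unfolding power2_eq_square sum_product by (simp only: mult_ac)
  also have "\<dots> = (\<Sum>x\<in>S. \<Sum>y\<in>S. (a x * a y) * (\<integral>u. zonal k (p x \<bullet> u) * zonal k (p y \<bullet> u) \<partial>?M))"
    using int by (simp add: Bochner_Integration.integral_sum)
  also have "\<dots> = (\<Sum>x\<in>S. \<Sum>y\<in>S. \<kappa> * (a x * a y * zonal k (p x \<bullet> p y)))"
    using S by (intro sum.cong refl) (simp add: rep)
  also have "\<dots> = \<kappa> * (\<Sum>x\<in>S. \<Sum>y\<in>S. a x * a y * zonal k (p x \<bullet> p y))"
    by (simp only: sum_distrib_left)
  finally show ?thesis using \<kappa> by (simp add: zero_le_mult_iff)
qed

text \<open>An even variant of the Levenshtein / Odlyzko--Sloane polynomial for the kissing number in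
  dimension 24. Evenness costs nothing for antipodal codes, and all coefficients are positive.\<close>

lemma zonal_expansion:
  "(t^2 + 1/2) * t^2 * (t^2 - 1/16)^2 * (t^2 - 1/4) = 15/1490944 + 495/243712 * zonal 0 t +
    6927/139264 * zonal (Suc 0) t + 17747/43776 * zonal 2 t + 5/4 * zonal 3 t + zonal 4 t" for t :: real
  unfolding zonal_explicit by (simp add: power2_eq_square field_simps) (simp add: eval_nat_numeral algebra_simps)?

text \<open>The last assumption is the reverse of the linear programming bound for these inner
  products, so that every inequality in that bound becomes an equality.\<close>

locale kissing_code =
  fixes S :: "(real^24) set"
  assumes finite: "finite S"
    and unit: "\<And>x. x \<in> S \<Longrightarrow> norm x = 1"
    and antipodal: "\<And>x. x \<in> S \<Longrightarrow> -x \<in> S"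
    and inner: "\<And>x y. x \<in> S \<Longrightarrow> y \<in> S \<Longrightarrow> x \<bullet> y \<in> {-1, -1/2, -1/4, 0, 1/4, 1/2, 1}"
    and card_ge: "card S \<ge> 196560"
begin

text \<open>Summing the test polynomial over all pairs gives N * 2025/1024 on one side and
  15/1490944 * N^2 plus nonnegative zonal sums on the other. The ratio of the two constants is
  196560, so N \<ge> 196560 leaves room for nothing but equality.\<close>

lemma zonal_sums:
  shows "card S = 196560" and "k < 5 \<Longrightarrow> (\<Sum>x\<in>S. \<Sum>y\<in>S. zonal k (x \<bullet> y)) = 0"
proof -
  define A where "A k = (\<Sum>x\<in>S. \<Sum>y\<in>S. zonal k (x \<bullet> y))" for k
  define N where "N = real (card S)"
  have A: "A k \<ge> 0" if "k < 5" for k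
    using zonal_kernel_nonneg[of S "\<lambda>x. x" k "\<lambda>_. 1"] unit that by (simp add: A_def)
  let ?F = "\<lambda>t::real. (t^2 + 1/2) * t^2 * (t^2 - 1/16)^2 * (t^2 - 1/4)"
  \<comment> \<open>The polynomial vanishes at 0, 1/4, 1/2 and their negatives, so only y = x and y
    = -x contribute; 2025/1024 is twice its value at 1.\<close>
  have "(\<Sum>x\<in>S. \<Sum>y\<in>S. ?F (x \<bullet> y)) = (\<Sum>x\<in>S. 2025/1024)"
  proof (intro sum.cong refl)
    fix x assume x: "x \<in> S"
    have xx: "x \<bullet> x = 1" using unit[OF x] by (simp add: norm_eq_1)
    have ne: "x \<noteq> -x" using unit[OF x] by (metis norm_zero zero_neq_one eq_neg_iff_add_eq_0 scaleR_2 scaleR_eq_0_iff zero_neq_numeral)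
    have "(\<Sum>y\<in>S. ?F (x \<bullet> y)) = (\<Sum>y\<in>{x, -x}. ?F (x \<bullet> y))"
    proof (rule sum.mono_neutral_right[OF finite])
      show "{x, -x} \<subseteq> S" using x antipodal by auto
      show "\<forall>y\<in>S - {x, -x}. ?F (x \<bullet> y) = 0"
      proof
        fix y assume y: "y \<in> S - {x, -x}"
        have yy: "y \<bullet> y = 1" using unit y by (auto simp: norm_eq_1)
        have "x \<bullet> y \<noteq> 1"
        proof
          assume "x \<bullet> y = 1"
          then have "(x - y) \<bullet> (x - y) = 0" using xx yy by (simp add: inner_diff inner_commute)
          then show False using y by simp
        qed
        moreover have "x \<bullet> y \<noteq> -1"
        proof
          assume "x \<bullet> y = -1"
          then have "(x + y) \<bullet> (x + y) = 0" using xx yy by (simp add: inner_add inner_commute)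
          then show False using y by (simp add: add_eq_0_iff)
        qed
        ultimately have "x \<bullet> y \<in> {-1/2, -1/4, 0, 1/4, 1/2}" using inner[OF x, of y] y by auto
        moreover have "?F t = 0" if "t \<in> {-1/2, -1/4, 0, 1/4, 1/2}" for t
          using that by (elim insertE emptyE; hypsubst; simp add: power2_eq_square)
        ultimately show "?F (x \<bullet> y) = 0" by blast
      qed
    qed
    also have "\<dots> = 2025/1024" using ne xx by (simp add: power2_eq_square)
    finally show "(\<Sum>y\<in>S. ?F (x \<bullet> y)) = 2025/1024" .
  qed
  then have main: "2025/1024 * N = 15/1490944 * N^2 + 495/243712 * A 0 +
    6927/139264 * A (Suc 0) + 17747/43776 * A 2 + 5/4 * A 3 + A 4"
    unfolding zonal_expansion A_def N_def
    by (simp only: sum.distrib sum_distrib_left[symmetric] sum_constant)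
       (simp add: power2_eq_square)
  have sq: "N^2 \<ge> 196560 * N"
    using card_ge unfolding N_def power2_eq_square by (intro mult_right_mono) auto
  note pos = A[of 0, simplified] A[of "Suc 0", simplified] A[of 2, simplified] A[of 3, simplified] A[of 4, simplified]
  have "N^2 = 196560 * N" "A 0 = 0" "A (Suc 0) = 0" "A 2 = 0" "A 3 = 0" "A 4 = 0"
    using main sq pos by linarith+
  moreover have "k \<in> {0, Suc 0, 2, 3, 4}" if "k < 5" using that by auto
  ultimately show "card S = 196560" and "k < 5 \<Longrightarrow> (\<Sum>x\<in>S. \<Sum>y\<in>S. zonal k (x \<bullet> y)) = 0"
    using card_ge unfolding A_def[symmetric] N_def
    by (auto simp: power2_eq_square)
qed

text \<open>The Gram-type positivity for \<open>S\<close> together with one further point \<open>u\<close> of weight \<open>s\<close> is a quadratic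
  in \<open>s\<close> without constant term, which forces the linear coefficient to vanish.\<close>

lemma zonal_sum:
  assumes u: "norm u = 1" and k: "k < 5"
  shows "(\<Sum>x\<in>S. zonal k (x \<bullet> u)) = 0"
proof -
  define G where "G = (\<Sum>x\<in>S. zonal k (x \<bullet> u))"
  define q where "q = zonal k 1"
  have q: "q > 0"
  proof -
    have "k \<in> {0, Suc 0, 2, 3, 4}" using k by auto
    then show ?thesis by (auto simp: q_def zonal_explicit)
  qed
  \<comment> \<open>Indexing by an option type keeps the extra point separate even if u already
    belongs to S.\<close>
  define p where "p x = (case x of None \<Rightarrow> u | Some y \<Rightarrow> y)" for x
  define a where "a s x = (case x of None \<Rightarrow> s | Some (y::real^24) \<Rightarrow> 1)" for s :: real and x
  define T where "T = insert None (Some ` S)"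
  have T: "(\<Sum>x\<in>T. f x) = f None + (\<Sum>x\<in>S. f (Some x))" for f :: "(real^24) option \<Rightarrow> real"
    unfolding T_def using finite by (subst sum.insert) (auto simp: sum.reindex)
  have "0 \<le> s * s * q + 2 * s * G" for s
  proof -
    have "0 \<le> (\<Sum>x\<in>T. \<Sum>y\<in>T. a s x * a s y * zonal k (p x \<bullet> p y))"
      using k u unit by (intro zonal_kernel_nonneg) (auto simp: T_def p_def)
    also have "\<dots> = s * s * q + s * G + (s * G + (\<Sum>x\<in>S. \<Sum>y\<in>S. zonal k (x \<bullet> y)))"
      unfolding T using u
      by (simp add: a_def p_def sum.distrib sum_distrib_left G_def q_def norm_eq_1 inner_commute)
    finally show ?thesis using zonal_sums(2)[OF k] by (simp add: algebra_simps)
  qed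
  \<comment> \<open>The quadratic attains its minimum - G^2 / q at this s.\<close>
  from this[of "- G / q"] have "G * G \<le> 0"
    using q by (simp add: field_simps)
  then show ?thesis unfolding G_def[symmetric]
    by (metis linorder_not_le mult_le_0_iff mult_neg_neg not_less_iff_gr_or_eq mult_pos_pos)
qed

text \<open>The five vanishing zonal sums are a triangular system that determines the even moments
  up to 10 one after another; antipodality kills the odd ones, which adds degree 11.\<close>

lemma moments: "moments (count_space S) UNIV 24 11"
proof
  show "integrable (count_space S) (\<lambda>u. (x \<bullet> u) ^ i * (y \<bullet> u) ^ j * (z \<bullet> u) ^ l)" for x y z :: "real^24" and i j l
    using finite by (rule integrable_count_space)
  have unit_case: "(\<Sum>y\<in>S. (u \<bullet> y)^k) = card S * sphere_moment 24 k" if u: "norm u = 1" and k: "even k" "k \<le> 11"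
    for u :: "real^24" and k
  proof -
    define m where "m k = (\<Sum>y\<in>S. (y \<bullet> u)^k)" for k
    have *: "m 2 = card S / 24" "m 4 = card S * (1/208)" "m 6 = card S * (5/5824)" "m 8 = card S * (1/4992)" "m 10 = card S * (3/53248)"
    proof -
      show m2: "m 2 = card S / 24"
        using zonal_sum[OF u, of 0] by (simp add: zonal_explicit sum.distrib sum_subtractf m_def)
      show m4: "m 4 = card S * (1/208)"
        using zonal_sum[OF u, of "Suc 0"] m2 by (simp add: zonal_explicit sum.distrib sum_subtractf sum_distrib_left[symmetric] sum_divide_distrib[symmetric] m_def)
      show m6: "m 6 = card S * (5/5824)"
        using zonal_sum[OF u, of 2] m2 m4 by (simp add: zonal_explicit sum.distrib sum_subtractf sum_distrib_left[symmetric] sum_divide_distrib[symmetric] m_def)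
      show m8: "m 8 = card S * (1/4992)"
        using zonal_sum[OF u, of 3] m2 m4 m6 by (simp add: zonal_explicit sum.distrib sum_subtractf sum_distrib_left[symmetric] sum_divide_distrib[symmetric] m_def)
      show "m 10 = card S * (3/53248)"
        using zonal_sum[OF u, of 4] m2 m4 m6 m8 by (simp add: zonal_explicit sum.distrib sum_subtractf sum_distrib_left[symmetric] sum_divide_distrib[symmetric] m_def)
    qed
    have "k \<in> {0, 2, 4, 6, 8, 10}" using k by (auto elim!: evenE)
    then show ?thesis using *
      by (auto simp: sphere_moment_24 m_def inner_commute simp del: sphere_moment.simps(2,3))
  qed
  fix x :: "real^24" and k :: nat assume "k \<le> 11"
  show "(\<integral>u. (x \<bullet> u)^k \<partial>count_space S) = measure (count_space S) (space (count_space S)) * sphere_moment 24 k * norm x ^ k"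
  proof (cases "even k")
    case True
    show ?thesis
    proof (cases "x = 0")
      case True
      then show ?thesis using finite by (cases k) (auto simp: lebesgue_integral_count_space_finite measure_count_space)
    next
      case False
      define u where "u = sgn x"
      have x: "x = norm x *\<^sub>R u" "norm u = 1" using False by (auto simp: u_def sgn_div_norm)
      have "(\<Sum>y\<in>S. (x \<bullet> y)^k) = norm x ^ k * (\<Sum>y\<in>S. (u \<bullet> y)^k)"
        by (subst x(1)) (simp add: power_mult_distrib sum_distrib_left)
      then show ?thesis using unit_case[OF x(2) True \<open>k \<le> 11\<close>] finite
        by (simp add: lebesgue_integral_count_space_finite measure_count_space)
    qed
  next
    case False
    have "(\<Sum>y\<in>S. (x \<bullet> y)^k) = (\<Sum>y\<in>S. (x \<bullet> (-y))^k)"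
      by (rule sum.reindex_bij_witness[of _ uminus uminus]) (auto simp: antipodal)
    also have "\<dots> = - (\<Sum>y\<in>S. (x \<bullet> y)^k)" using False by (simp add: sum_negf)
    finally show ?thesis using False finite
      by (simp add: sphere_moment_odd lebesgue_integral_count_space_finite)
  qed
qed auto

end

section \<open>The binary Golay code\<close>

text \<open>Position 23 is the point at infinity. The enumeration turns sets of coordinates into
  Boolean lists on which finite checks can be evaluated.\<close>

definition golay_point :: "nat \<Rightarrow> 23 option" where
  "golay_point k = (if k < 23 then Some (of_nat k) else None)"

lemma of_nat_23_eq_iff: "(of_nat a :: 23) = of_nat b \<longleftrightarrow> a mod 23 = b mod 23"
proof -
  have "CHAR(23) = 23" by simp
  then show ?thesis using of_nat_eq_iff_cong_CHAR[of a b, where 'a = 23] unfolding cong_def by (simp only:)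
qed

lemma obtain_nat_23:
  fixes x :: 23
  obtains k where "k < 23" "x = of_nat k"
proof (cases x)
  case (of_int z)
  have "int CARD(23) = 23" by simp
  with of_int have "nat z < 23" by linarith
  moreover have "x = of_nat (nat z)" using of_int(1,2) by (simp only: of_nat_nat)
  ultimately show ?thesis using that by blast
qed

lemma bij_golay_point: "bij_betw golay_point {..<24} UNIV"
proof -
  have "inj_on golay_point {..<24}"
  proof (rule inj_onI)
    fix j k assume "j \<in> {..<24}" "k \<in> {..<24}" "golay_point j = golay_point k"
    then show "j = k" by (cases "j = 23"; cases "k = 23") (simp_all add: golay_point_def of_nat_23_eq_iff)
  qed
  moreover have "x \<in> golay_point ` {..<24}" for x
  proof (cases x)
    case None
    then show ?thesis by (intro image_eqI[of _ _ 23]) (auto simp: golay_point_def)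
  next
    case (Some y)
    obtain k where "k < 23" "y = of_nat k" by (rule obtain_nat_23)
    then show ?thesis using Some by (intro image_eqI[of _ _ k]) (auto simp: golay_point_def)
  qed
  ultimately show ?thesis unfolding bij_betw_def by blast
qed

definition word_set :: "bool list \<Rightarrow> 23 option set" where
  "word_set w = golay_point ` {k. k < 24 \<and> w ! k}"

definition weight :: "bool list \<Rightarrow> nat" where
  "weight w = length (filter (\<lambda>b. b) w)"

text \<open>The listed residues are the quadratic non-residues modulo 23; the appended entry belongs
  to infinity.\<close>

definition generator_word :: "nat \<Rightarrow> bool list" where
  "generator_word i =
    map (\<lambda>k. (k + i) mod 23 \<in> {5, 7, 10, 11, 14, 15, 17, 19, 20, 21, 22}) [0..<23] @ [True]"

definition word_sum :: "nat list \<Rightarrow> bool list" where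
  "word_sum is = foldr (\<lambda>i w. map2 (\<noteq>) w (generator_word i)) is (replicate 24 False)"

lemma golay_point_in_word_set [simp]: "k < 24 \<Longrightarrow> golay_point k \<in> word_set w \<longleftrightarrow> w ! k"
  unfolding word_set_def
  by (subst inj_on_image_mem_iff[OF bij_betw_imp_inj_on[OF bij_golay_point]]) auto

lemma golay_set_eqI:
  assumes "\<And>k. k < 24 \<Longrightarrow> golay_point k \<in> A \<longleftrightarrow> golay_point k \<in> B"
  shows "A = B"
proof -
  show ?thesis
  proof (rule set_eqI)
    fix x
    have "x \<in> golay_point ` {..<24}"
      using bij_betw_imp_surj_on[OF bij_golay_point] by simp
    then obtain k where "k < 24" "x = golay_point k" by (elim imageE) simp
    then show "x \<in> A \<longleftrightarrow> x \<in> B" using assms by simp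
  qed
qed

lemma card_word_set:
  assumes "length w = 24"
  shows "card (word_set w) = weight w"
proof -
  have "card (word_set w) = card {k. k < 24 \<and> w ! k}"
    unfolding word_set_def
    by (intro card_image inj_on_subset[OF bij_betw_imp_inj_on[OF bij_golay_point]]) auto
  then show ?thesis using assms unfolding weight_def length_filter_conv_card by simp
qed

lemma length_generator_word [simp]: "length (generator_word i) = 24"
  by (simp add: generator_word_def)

lemma length_word_sum [simp]: "length (word_sum is) = 24"
  unfolding word_sum_def by (induction "is") auto

lemma word_set_xor:
  assumes "length v = 24" "length w = 24"
  shows "word_set (map2 (\<noteq>) v w) = sym_diff (word_set v) (word_set w)"
  using assms by (intro golay_set_eqI) auto

lemma word_set_and:
  assumes "length v = 24" "length w = 24"
  shows "word_set (map2 (\<and>) v w) = word_set v \<inter> word_set w"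
  using assms by (intro golay_set_eqI) auto

lemma nonsquares_23:
  "\<not> (\<exists>b::23. of_nat m = b\<^sup>2) \<longleftrightarrow> m mod 23 \<in> {5, 7, 10, 11, 14, 15, 17, 19, 20, 21, 22}"
proof -
  have *: "\<forall>m\<in>set [0..<23]. list_ex (\<lambda>c. c\<^sup>2 mod 23 = m) [0..<23] \<longleftrightarrow>
      m \<notin> {5, 7, 10, 11, 14, 15, 17, 19, 20, 21, 22::nat}"
    by code_simp
  have "(\<exists>b::23. of_nat m = b\<^sup>2) \<longleftrightarrow> (\<exists>c<23. (of_nat m :: 23) = of_nat (c\<^sup>2))"
  proof
    assume "\<exists>b::23. of_nat m = b\<^sup>2"
    then obtain b :: 23 where b: "of_nat m = b\<^sup>2" by blast
    obtain c where "c < 23" "b = of_nat c" by (rule obtain_nat_23)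
    then show "\<exists>c<23. (of_nat m :: 23) = of_nat (c\<^sup>2)" using b by auto
  next
    assume "\<exists>c<23. (of_nat m :: 23) = of_nat (c\<^sup>2)"
    then obtain c where "(of_nat m :: 23) = (of_nat c)\<^sup>2" by auto
    then show "\<exists>b::23. of_nat m = b\<^sup>2" by blast
  qed
  also have "\<dots> \<longleftrightarrow> (\<exists>c\<in>set [0..<23]. c\<^sup>2 mod 23 = m mod 23)"
    unfolding of_nat_23_eq_iff set_upt Bex_def atLeastLessThan_iff by (simp add: eq_commute[of "m mod 23"])
  also have "\<dots> \<longleftrightarrow> list_ex (\<lambda>c. c\<^sup>2 mod 23 = m mod 23) [0..<23]"
    unfolding list_ex_iff ..
  also have "\<dots> \<longleftrightarrow> m mod 23 \<notin> {5, 7, 10, 11, 14, 15, 17, 19, 20, 21, 22}"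
    using bspec[OF *, of "m mod 23"] by simp
  finally show ?thesis by blast
qed

lemma golay_generator_word: "golay_generator (of_nat i) = word_set (generator_word i)"
proof (rule golay_set_eqI)
  fix k :: nat assume k: "k < 24"
  show "golay_point k \<in> golay_generator (of_nat i) \<longleftrightarrow> golay_point k \<in> word_set (generator_word i)"
  proof (cases "k = 23")
    case True
    then show ?thesis by (simp add: golay_generator_def golay_point_def[of 23] del: golay_point_in_word_set)
        (simp add: golay_point_in_word_set[of 23, unfolded golay_point_def, simplified] generator_word_def nth_append)
  next
    case False
    then have k: "k < 23" using k by simp
    have "golay_point k \<in> golay_generator (of_nat i) \<longleftrightarrow> (\<exists>n. (of_nat k :: 23) = n - of_nat i \<and> \<not> (\<exists>b. n = b\<^sup>2))"
      using k by (auto simp: golay_point_def golay_generator_def)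
    also have "\<dots> \<longleftrightarrow> \<not> (\<exists>b::23. of_nat (k + i) = b\<^sup>2)"
      by (auto simp: eq_diff_eq)
    also have "\<dots> \<longleftrightarrow> generator_word i ! k"
      using k unfolding nonsquares_23 by (simp add: generator_word_def nth_append)
    finally show ?thesis using k by simp
  qed
qed

lemma golay_generatorE:
  obtains k where "k < 23" "golay_generator i = word_set (generator_word k)"
proof -
  obtain k where "k < 23" "i = of_nat k" by (rule obtain_nat_23)
  then show ?thesis using that golay_generator_word by blast
qed

lemma golay_code_xor:
  assumes "A \<in> golay_code" "B \<in> golay_code"
  shows "sym_diff A B \<in> golay_code"
  using assms(2,1)
proof (induction arbitrary: A)
  case empty
  then show ?case by simp
next
  case (add B i)
  have "sym_diff A ((B - golay_generator i) \<union> (golay_generator i - B)) =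
      sym_diff (sym_diff A B) (golay_generator i)"
    by auto
  then show ?case using golay_code.add[OF add.IH[OF add.prems], of i] by simp
qed

lemma word_sum_in_golay: "word_set (word_sum is) \<in> golay_code"
proof (induction "is")
  case Nil
  have "word_set (replicate 24 False) = {}" by (auto simp: word_set_def)
  then show ?case by (simp add: word_sum_def golay_code.empty)
next
  case (Cons i "is")
  have "word_sum (i # is) = map2 (\<noteq>) (word_sum is) (generator_word i)"
    by (simp add: word_sum_def)
  then have "word_set (word_sum (i # is)) = sym_diff (word_set (word_sum is)) (word_set (generator_word i))"
    by (simp only: word_set_xor length_word_sum length_generator_word)
  then show ?case using golay_code.add[OF Cons.IH, of "of_nat i"]
    by (simp add: golay_generator_word)
qed

text \<open>Every finite coordinate lies in 11 of the 23 generators and infinity lies in all of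
  them; both numbers are odd, so the sum of all generators is the full set.\<close>

lemma UNIV_in_golay: "UNIV \<in> golay_code"
proof -
  have "word_sum [0..<23] = replicate 24 True" by code_simp
  then have "word_set (word_sum [0..<23]) = UNIV"
    by (intro golay_set_eqI) simp
  then show ?thesis using word_sum_in_golay by metis
qed

lemma card_sym_diff:
  assumes "finite A" "finite B"
  shows "card (sym_diff A B) + 2 * card (A \<inter> B) = card A + card B"
proof -
  have "card A = card (A - B) + card (A \<inter> B)" "card B = card (B - A) + card (A \<inter> B)"
    using assms by (metis card_Int_Diff add.commute Int_commute)+
  moreover have "card (sym_diff A B) = card (A - B) + card (B - A)"
    using assms by (intro card_Un_disjoint) auto
  ultimately show ?thesis by simp
qed

lemma even_card_sym_diff_Int:
  fixes A B G :: "23 option set"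
  assumes "even (card (A \<inter> G))" "even (card (B \<inter> G))"
  shows "even (card (sym_diff A B \<inter> G))"
proof -
  have "sym_diff A B \<inter> G = sym_diff (A \<inter> G) (B \<inter> G)" by auto
  then show ?thesis using card_sym_diff[of "A \<inter> G" "B \<inter> G"] assms by (simp add: even_add) presburger
qed

text \<open>Translation of the finite coordinates permutes the generators, so only the intersections
  with the generator at 0 have to be evaluated.\<close>

lemma generator_self_orthogonal:
  "even (card (golay_generator i \<inter> golay_generator j))" "card (golay_generator i) = 12"
proof -
  have *: "list_all (\<lambda>j. even (weight (map2 (\<and>) (generator_word 0) (generator_word j)))) [0..<23]"
    "weight (generator_word 0) = 12"
    by code_simp+
  define \<tau> where "\<tau> = map_option (\<lambda>x. x + i)"
  have inj: "inj \<tau>" unfolding \<tau>_def by (intro option.inj_map) (simp add: inj_def)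
  have \<tau>: "\<tau> ` golay_generator j = golay_generator (j - i)" for j
    by (simp add: golay_generator_def \<tau>_def setcompr_eq_image image_image algebra_simps)
  obtain k where k: "k < 23" "golay_generator (j - i) = word_set (generator_word k)"
    by (rule golay_generatorE)
  have 0: "golay_generator 0 = word_set (generator_word 0)"
    using golay_generator_word[of 0] by simp
  have "card (golay_generator i \<inter> golay_generator j) = card (golay_generator 0 \<inter> golay_generator (j - i))"
    using card_image[OF inj_on_subset[OF inj subset_UNIV], of "golay_generator i \<inter> golay_generator j"] \<tau>[of i] \<tau>[of j]
    by (simp add: image_Int[OF inj])
  then show "even (card (golay_generator i \<inter> golay_generator j))"
    using * k unfolding 0 by (simp add: list_all_iff card_word_set flip: word_set_and)
  have "card (golay_generator i) = card (golay_generator 0)"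
    using card_image[OF inj_on_subset[OF inj subset_UNIV], of "golay_generator i"] \<tau>[of i] by simp
  then show "card (golay_generator i) = 12"
    using * unfolding 0 by (simp add: card_word_set)
qed

lemma golay_self_orthogonal:
  assumes "A \<in> golay_code" "B \<in> golay_code"
  shows "even (card (A \<inter> B))"
proof -
  have gen: "even (card (A \<inter> golay_generator j))" if "A \<in> golay_code" for A j
    using that
    by induction (auto intro!: even_card_sym_diff_Int generator_self_orthogonal(1))
  show ?thesis using assms(2)
  proof induction
    case (add B i)
    then show ?case using gen[OF assms(1), of i] even_card_sym_diff_Int[of B A "golay_generator i"]
      by (simp add: Int_commute)
  qed simp
qed

text \<open>Adding a generator G changes |A| by 12 - 2 |A \<inter> G|, and the intersection is
  even.\<close>

lemma golay_doubly_even: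
  assumes "A \<in> golay_code"
  shows "4 dvd card A"
  using assms
proof induction
  case (add A i)
  have "even (card (A \<inter> golay_generator i))"
    using golay_self_orthogonal[OF add.hyps golay_code.add[OF golay_code.empty, of i]] by simp
  then show ?case
    using card_sym_diff[of A "golay_generator i"] add.IH generator_self_orthogonal(2)[of i]
    by simp presburger
qed simp

text \<open>Row reduction of the generator words: each list says which generators to add in order to obtain the
  corresponding row of \<open>golay_matrix\<close>, systematic on the left half (rows 0 to 11) or the right half.\<close>

definition golay_rows :: "nat list list" where
  "golay_rows = [
    [0,1,5,6,7,9,11],  [0,2,3,4,6,7,8,10],  [1,6,9],  [1,6,7,8,9,11],  [1,8,9,10,11],
    [0,7,8,9,10],  [0,1,2,3,7,8,11],  [0,1,3,5,6,10],  [1,3,4,5,6,11],  [0,2,3,4,5,10],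
    [1,4,5,7,9],  [0,3,4,6,8],  [0,2,5,6,8,9,10,11],  [0,2,3,4,5,6,7,8,10,11],
    [2,4,6,7,8,9],  [1,3,5,6,7,8],  [4,7,8,9,10,11],  [0,2,3,5,7,11],  [2,3,4,5,6,8],
    [1,2,3,4,5,7],  [0,1,2,3,4,6],  [5,6,9,11],  [0,2,4,6,9,11],  [1,2,6,9,11]]"

definition golay_matrix :: "bool list list" where
  "golay_matrix = map (map ((=) 1)) [
    [1::nat,0,0,0,0,0,0,0,0,0,0,0,1,0,1,0,1,1,1,0,0,0,1,1],
    [0,1,0,0,0,0,0,0,0,0,0,0,1,1,1,1,1,0,0,1,0,0,1,0],
    [0,0,1,0,0,0,0,0,0,0,0,0,1,1,0,1,0,0,1,0,1,0,1,1],
    [0,0,0,1,0,0,0,0,0,0,0,0,1,1,0,0,0,1,1,1,0,1,1,0],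
    [0,0,0,0,1,0,0,0,0,0,0,0,1,1,0,0,1,1,0,1,1,0,0,1],
    [0,0,0,0,0,1,0,0,0,0,0,0,0,1,1,0,0,1,1,0,1,1,0,1],
    [0,0,0,0,0,0,1,0,0,0,0,0,0,0,1,1,0,0,1,1,0,1,1,1],
    [0,0,0,0,0,0,0,1,0,0,0,0,1,0,1,1,0,1,1,1,1,0,0,0],
    [0,0,0,0,0,0,0,0,1,0,0,0,0,1,0,1,1,0,1,1,1,1,0,0],
    [0,0,0,0,0,0,0,0,0,1,0,0,0,0,1,0,1,1,0,1,1,1,1,0],
    [0,0,0,0,0,0,0,0,0,0,1,0,1,0,1,1,1,0,0,0,1,1,0,1],
    [0,0,0,0,0,0,0,0,0,0,0,1,0,1,0,1,1,1,0,0,0,1,1,1],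
    [1,1,1,1,1,0,0,1,0,0,1,0,1,0,0,0,0,0,0,0,0,0,0,0],
    [0,1,1,1,1,1,0,0,1,0,0,1,0,1,0,0,0,0,0,0,0,0,0,0],
    [1,1,0,0,0,1,1,1,0,1,1,0,0,0,1,0,0,0,0,0,0,0,0,0],
    [0,1,1,0,0,0,1,1,1,0,1,1,0,0,0,1,0,0,0,0,0,0,0,0],
    [1,1,0,0,1,0,0,0,1,1,1,1,0,0,0,0,1,0,0,0,0,0,0,0],
    [1,0,0,1,1,1,0,1,0,1,0,1,0,0,0,0,0,1,0,0,0,0,0,0],
    [1,0,1,1,0,1,1,1,1,0,0,0,0,0,0,0,0,0,1,0,0,0,0,0],
    [0,1,0,1,1,0,1,1,1,1,0,0,0,0,0,0,0,0,0,1,0,0,0,0],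
    [0,0,1,0,1,1,0,1,1,1,1,0,0,0,0,0,0,0,0,0,1,0,0,0],
    [0,0,0,1,0,1,1,0,1,1,1,1,0,0,0,0,0,0,0,0,0,1,0,0],
    [1,1,1,1,0,0,1,0,0,1,0,1,0,0,0,0,0,0,0,0,0,0,1,0],
    [1,0,1,0,1,1,1,0,0,0,1,1,0,0,0,0,0,0,0,0,0,0,0,1]]"

lemma golay_matrix: "map word_sum golay_rows = golay_matrix"
  by code_simp

definition golay_row :: "nat \<Rightarrow> 23 option set" where
  "golay_row k = word_set (golay_matrix ! k)"

lemma golay_matrix_nth:
  "k < 24 \<Longrightarrow> golay_matrix ! k = word_sum (golay_rows ! k)"
  "k < 24 \<Longrightarrow> length (golay_matrix ! k) = 24"
proof -
  have "length golay_rows = 24" by (simp add: golay_rows_def)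
  then show "k < 24 \<Longrightarrow> golay_matrix ! k = word_sum (golay_rows ! k)"
    "k < 24 \<Longrightarrow> length (golay_matrix ! k) = 24"
    unfolding golay_matrix[symmetric] by simp_all
qed

text \<open>The two halves are complementary information sets: rows 0 to 11 of
  \<open>golay_matrix\<close> restrict to unit vectors on the left half, rows 12 to 23 on the right
  half.\<close>

definition left_half :: "23 option set" where "left_half = golay_point ` {..<12}"
definition right_half :: "23 option set" where "right_half = golay_point ` {12..<24}"

lemma halves: "left_half \<union> right_half = UNIV" "left_half \<inter> right_half = {}"
  "card left_half = 12" "card right_half = 12"
proof -
  have inj: "inj_on golay_point {..<24}" and img: "golay_point ` {..<24} = UNIV"
    using bij_golay_point by (auto simp: bij_betw_def)
  have "{..<12} \<union> {12..<24} = {..<24::nat}" by auto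
  then show "left_half \<union> right_half = UNIV"
    unfolding left_half_def right_half_def image_Un[symmetric] img by (simp add: img)
  show "left_half \<inter> right_half = {}"
    using inj unfolding left_half_def right_half_def inj_on_def by fastforce
  have "inj_on golay_point {..<12}" "inj_on golay_point {12..<24}"
    using inj by (auto intro: inj_on_subset)
  then show "card left_half = 12" "card right_half = 12"
    by (simp_all add: left_half_def right_half_def card_image)
qed

lemma golay_point_in_halves [simp]:
  "k < 24 \<Longrightarrow> golay_point k \<in> left_half \<longleftrightarrow> k < 12"
  "k < 24 \<Longrightarrow> golay_point k \<in> right_half \<longleftrightarrow> 12 \<le> k"
  unfolding left_half_def right_half_def
  by (subst inj_on_image_mem_iff[OF bij_betw_imp_inj_on[OF bij_golay_point]]; auto)+

lemma golay_point_eq_iff: "j < 24 \<Longrightarrow> k < 24 \<Longrightarrow> golay_point j = golay_point k \<longleftrightarrow> j = k"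
  using bij_betw_imp_inj_on[OF bij_golay_point] by (simp add: inj_on_eq_iff)

lemma golay_row: "k < 24 \<Longrightarrow> golay_row k \<in> golay_code"
  unfolding golay_row_def by (simp add: golay_matrix_nth word_sum_in_golay)

lemma golay_row_half:
  shows "k < 12 \<Longrightarrow> golay_row k \<inter> left_half = {golay_point k}"
    and "12 \<le> k \<Longrightarrow> k < 24 \<Longrightarrow> golay_row k \<inter> right_half = {golay_point k}"
proof -
  have *: "list_all (\<lambda>k. filter ((!) (golay_matrix ! k)) [0..<12] = [k]) [0..<12]"
    "list_all (\<lambda>k. filter ((!) (golay_matrix ! k)) [12..<24] = [k]) [12..<24]"
    by code_simp+
  {
    fix k :: nat assume k: "k < 12"
    then have "k \<in> set [0..<12]" unfolding set_upt by simp
    from bspec[OF *(1)[unfolded list_all_iff] this]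
    have "{l \<in> set [0..<12]. golay_matrix ! k ! l} = {k}"
      unfolding set_filter[symmetric] by simp
    then have row: "\<And>l. l < 12 \<Longrightarrow> golay_matrix ! k ! l \<longleftrightarrow> l = k"
      unfolding set_upt by (auto simp: set_eq_iff)
    show "golay_row k \<inter> left_half = {golay_point k}"
    proof (rule golay_set_eqI)
      fix l :: nat assume l: "l < 24"
      have "golay_point l \<in> golay_row k \<longleftrightarrow> golay_matrix ! k ! l"
        using l by (simp add: golay_row_def)
      moreover have "golay_point l \<in> {golay_point k} \<longleftrightarrow> l = k"
        using l k by (simp add: golay_point_eq_iff)
      ultimately show "golay_point l \<in> golay_row k \<inter> left_half \<longleftrightarrow> golay_point l \<in> {golay_point k}"
        using l k row[of l] by (simp only: Int_iff golay_point_in_halves) auto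
    qed
  }
  {
    fix k :: nat assume k: "12 \<le> k" "k < 24"
    then have "k \<in> set [12..<24]" unfolding set_upt by simp
    from bspec[OF *(2)[unfolded list_all_iff] this]
    have "{l \<in> set [12..<24]. golay_matrix ! k ! l} = {k}"
      unfolding set_filter[symmetric] by simp
    then have row: "\<And>l. 12 \<le> l \<Longrightarrow> l < 24 \<Longrightarrow> golay_matrix ! k ! l \<longleftrightarrow> l = k"
      unfolding set_upt by (auto simp: set_eq_iff)
    show "golay_row k \<inter> right_half = {golay_point k}"
    proof (rule golay_set_eqI)
      fix l :: nat assume l: "l < 24"
      have "golay_point l \<in> golay_row k \<longleftrightarrow> golay_matrix ! k ! l"
        using l by (simp add: golay_row_def)
      moreover have "golay_point l \<in> {golay_point k} \<longleftrightarrow> l = k"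
        using l k by (simp add: golay_point_eq_iff)
      ultimately show "golay_point l \<in> golay_row k \<inter> right_half \<longleftrightarrow> golay_point l \<in> {golay_point k}"
        using l k row[of l] by (simp only: Int_iff golay_point_in_halves) auto
    qed
  }
qed

lemma golay_row_weights:
  assumes "j < 12 \<and> k < 12 \<or> 12 \<le> j \<and> j < 24 \<and> 12 \<le> k \<and> k < 24"
  shows "card (golay_row k) \<noteq> 4" "card (sym_diff (golay_row j) (golay_row k)) \<noteq> 4"
proof -
  have *: "let ws = golay_matrix in list_all (\<lambda>w. weight w \<noteq> 4) ws \<and>
     list_all (\<lambda>v. list_all (\<lambda>w. weight (map2 (\<noteq>) v w) \<noteq> 4) (take 12 ws)) (take 12 ws) \<and>
     list_all (\<lambda>v. list_all (\<lambda>w. weight (map2 (\<noteq>) v w) \<noteq> 4) (drop 12 ws)) (drop 12 ws)"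
    by code_simp
  have len: "length golay_matrix = 24" by (simp add: golay_matrix_def)
  have t: "golay_matrix ! k \<in> set (take 12 (golay_matrix))" if "k < 12" for k
    using that len by (auto simp: in_set_conv_nth intro!: exI[of _ k])
  have d: "golay_matrix ! k \<in> set (drop 12 (golay_matrix))" if "12 \<le> k" "k < 24" for k
    using that len by (auto simp: in_set_conv_nth intro!: exI[of _ "k - 12"])
  have "weight (golay_matrix ! k) \<noteq> 4"
    using * assms len by (auto simp: Let_def list_all_iff)
  then show "card (golay_row k) \<noteq> 4" using assms by (auto simp: golay_row_def card_word_set golay_matrix_nth)
  have "weight (map2 (\<noteq>) (golay_matrix ! j) (golay_matrix ! k)) \<noteq> 4"
    using * assms t d unfolding Let_def list_all_iff by blast
  then show "card (sym_diff (golay_row j) (golay_row k)) \<noteq> 4"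
    using assms by (auto simp: golay_row_def card_word_set golay_matrix_nth simp flip: word_set_xor)
qed

text \<open>If A misses H and contains the point k, then the row that is a unit vector outside H
  meets A in that point alone, contradicting evenness of intersections.\<close>

lemma golay_halves_orthogonal:
  assumes A: "A \<in> golay_code" and disj: "A \<inter> H = {}"
    and rows: "\<And>k. golay_point k \<in> A \<Longrightarrow> k < 24 \<Longrightarrow> golay_row k \<inter> (- H) = {golay_point k}"
  shows "A = {}"
proof (rule golay_set_eqI)
  fix k :: nat assume k: "k < 24"
  have False if "golay_point k \<in> A"
  proof -
    have "A \<inter> golay_row k = {golay_point k}"
      using rows[OF that k] disj that by blast
    then show False using golay_self_orthogonal[OF A golay_row[OF k]] by simp
  qed
  then show "golay_point k \<in> A \<longleftrightarrow> golay_point k \<in> {}" by blast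
qed

lemma right_half_eq: "right_half = - left_half"
  using halves(1,2) by blast

lemma golay_inj_left:
  assumes "A \<in> golay_code" "A \<inter> left_half = {}"
  shows "A = {}"
proof (rule golay_halves_orthogonal[OF assms])
  fix k assume k: "golay_point k \<in> A" "k < 24"
  then have "12 \<le> k" using assms(2) golay_point_in_halves(1)[OF k(2)] by (metis disjoint_iff not_le)
  then show "golay_row k \<inter> - left_half = {golay_point k}"
    using golay_row_half(2) k unfolding right_half_eq by blast
qed

lemma golay_inj_right:
  assumes "A \<in> golay_code" "A \<inter> right_half = {}"
  shows "A = {}"
proof (rule golay_halves_orthogonal[OF assms])
  fix k assume k: "golay_point k \<in> A" "k < 24"
  then have "k < 12" using assms(2) golay_point_in_halves(2)[OF k(2)] by (metis disjoint_iff not_le)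
  then show "golay_row k \<inter> - right_half = {golay_point k}"
    using golay_row_half(1) unfolding right_half_eq by simp
qed

lemma sym_diff_eq_empty: "sym_diff A B = {} \<longleftrightarrow> A = B"
  by blast

text \<open>A word is determined by its trace on H. With at most two points there it is the empty
  word, a row, or a sum of two rows, and none of these has weight 4.\<close>

lemma golay_small_half:
  assumes A: "A \<in> golay_code"
    and inj: "\<And>B. B \<in> golay_code \<Longrightarrow> B \<inter> H = {} \<Longrightarrow> B = {}"
    and K: "\<And>k. k \<in> K \<Longrightarrow> k < 24 \<and> golay_row k \<inter> H = {golay_point k}" "H = golay_point ` K"
    and weights: "\<And>j k. j \<in> K \<Longrightarrow> k \<in> K \<Longrightarrow> card (golay_row k) \<noteq> 4 \<and> card (sym_diff (golay_row j) (golay_row k)) \<noteq> 4"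
    and small: "card (A \<inter> H) \<le> 2"
  shows "card A \<noteq> 4"
proof -
  consider "card (A \<inter> H) = 0" | "card (A \<inter> H) = 1" | "card (A \<inter> H) = 2"
    using small by linarith
  then show ?thesis
  proof cases
    case 1
    then show ?thesis using inj[OF A] by simp
  next
    case 2
    then obtain x where x: "A \<inter> H = {x}" by (auto simp: card_1_singleton_iff)
    then obtain k where k: "k \<in> K" "x = golay_point k" using K(2) by blast
    have "golay_row k \<inter> H = A \<inter> H" using K(1)[OF k(1)] x k(2) by simp
    then have "sym_diff A (golay_row k) \<inter> H = {}" by blast
    then have "A = golay_row k"
      using inj[OF golay_code_xor[OF A golay_row]] K(1)[OF k(1)] sym_diff_eq_empty by blast
    then show ?thesis using weights[OF k(1) k(1)] by simp
  next
    case 3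
    then obtain x y where xy: "A \<inter> H = {x, y}" "x \<noteq> y" by (meson card_2_iff)
    then obtain j k where jk: "j \<in> K" "k \<in> K" "x = golay_point j" "y = golay_point k" using K(2) by blast
    let ?R = "sym_diff (golay_row j) (golay_row k)"
    have R: "?R \<in> golay_code"
      using K(1) jk by (intro golay_code_xor golay_row) auto
    have "?R \<inter> H = sym_diff (golay_row j \<inter> H) (golay_row k \<inter> H)" by blast
    also have "\<dots> = sym_diff {x} {y}" using K(1)[OF jk(1)] K(1)[OF jk(2)] jk(3,4) by simp
    also have "\<dots> = A \<inter> H" using xy by auto
    finally have "sym_diff A ?R \<inter> H = {}" by blast
    then have "A = ?R"
      using inj[OF golay_code_xor[OF A R]] sym_diff_eq_empty by blast
    then show ?thesis using weights[OF jk(1) jk(2)] by simp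
  qed
qed

text \<open>Four points are split between two disjoint halves, so one half contains at most two of
  them.\<close>

lemma golay_weight_not_4:
  assumes "A \<in> golay_code"
  shows "card A \<noteq> 4"
proof
  assume 4: "card A = 4"
  have "A = (A \<inter> left_half) \<union> (A \<inter> right_half)" "(A \<inter> left_half) \<inter> (A \<inter> right_half) = {}"
    using halves by blast+
  then have "card A = card (A \<inter> left_half) + card (A \<inter> right_half)"
    by (metis card_Un_disjoint finite)
  then consider "card (A \<inter> left_half) \<le> 2" | "card (A \<inter> right_half) \<le> 2" using 4 by linarith
  then show False
  proof cases
    case 1
    have "card A \<noteq> 4"
    proof (rule golay_small_half[OF assms golay_inj_left, where H = left_half and K = "{..<12}"])
      fix j k :: nat assume "j \<in> {..<12}" "k \<in> {..<12}"
      then show "card (golay_row k) \<noteq> 4 \<and> card (sym_diff (golay_row j) (golay_row k)) \<noteq> 4"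
        using golay_row_weights[of j k] by simp
    qed (use 1 golay_row_half in \<open>simp_all add: left_half_def\<close>)
    then show False using 4 by blast
  next
    case 2
    have "card A \<noteq> 4"
    proof (rule golay_small_half[OF assms golay_inj_right, where H = right_half and K = "{12..<24}"])
      fix j k :: nat assume "j \<in> {12..<24}" "k \<in> {12..<24}"
      then show "card (golay_row k) \<noteq> 4 \<and> card (sym_diff (golay_row j) (golay_row k)) \<noteq> 4"
        using golay_row_weights[of j k] by simp
    qed (use 2 golay_row_half in \<open>simp_all add: right_half_def\<close>)
    then show False using 4 by blast
  qed
qed

lemma card_coordinates: "CARD(23 option) = 24"
  by (simp add: card_UNIV_option)

lemma golay_complement:
  assumes "A \<in> golay_code"
  shows "- A \<in> golay_code"
proof -
  have "sym_diff UNIV A = - A" by blast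
  then show ?thesis using golay_code_xor[OF UNIV_in_golay assms] by simp
qed

lemma card_complement_24: "card (- (A :: 23 option set)) = 24 - card A"
  unfolding Compl_eq_Diff_UNIV by (simp add: card_Diff_subset card_coordinates)

lemma golay_weights:
  assumes A: "A \<in> golay_code"
  shows "card A \<in> {0, 8, 12, 16, 24}"
proof -
  have "card A \<le> 24" using card_mono[of UNIV A] by (simp add: card_coordinates)
  moreover have "4 dvd card A" by (rule golay_doubly_even[OF A])
  moreover have "card A \<noteq> 4" "card A \<noteq> 20"
    using golay_weight_not_4[OF A] golay_weight_not_4[OF golay_complement[OF A]]
    by (auto simp: card_complement_24)
  ultimately obtain k where k: "card A = 4 * k" "k \<le> 6" "k \<noteq> 1" "k \<noteq> 5" by (auto elim!: dvdE)
  then have "k \<in> {0, 2, 3, 4, 6}" by auto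
  then show ?thesis unfolding k(1) by auto
qed

lemma golay_min_weight:
  assumes "A \<in> golay_code" "A \<noteq> {}"
  shows "card A \<ge> 8"
  using golay_weights[OF assms(1)] assms(2) by auto

text \<open>The rows 0 to 11 realize all 2^12 subsets of the left half as traces of words.\<close>

lemma golay_card_ge: "card golay_code \<ge> 4096"
proof -
  have ex: "\<exists>A\<in>golay_code. A \<inter> left_half = T" if "T \<subseteq> left_half" for T
    using finite[of T] that
  proof (induction T rule: finite_induct)
    case empty
    then show ?case using golay_code.empty by blast
  next
    case (insert x T)
    then obtain A where A: "A \<in> golay_code" "A \<inter> left_half = T" by auto
    obtain k where k: "k < 12" "x = golay_point k" using insert.prems unfolding left_half_def by blast
    have "sym_diff A (golay_row k) \<in> golay_code"
      using A k by (intro golay_code_xor golay_row) auto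
    moreover have "sym_diff A (golay_row k) \<inter> left_half = insert x T"
    proof -
      have "sym_diff A (golay_row k) \<inter> left_half = sym_diff (A \<inter> left_half) (golay_row k \<inter> left_half)"
        by blast
      also have "\<dots> = sym_diff T {x}" using A(2) golay_row_half(1)[OF k(1)] k(2) by simp
      finally show ?thesis using insert.hyps by auto
    qed
    ultimately show ?case by blast
  qed
  then have "Pow left_half \<subseteq> (\<lambda>A. A \<inter> left_half) ` golay_code" by blast
  then have "card (Pow left_half) \<le> card golay_code"
    by (rule surj_card_le[OF finite])
  then show ?thesis by (simp add: card_Pow halves)
qed

text \<open>In dual terms, no word of weight 2 is orthogonal to the code. This makes the signs at
  distinct coordinates uncorrelated in the octad count.\<close>

lemma golay_separates:
  assumes "x \<noteq> y"
  shows "\<exists>G\<in>golay_code. (x \<in> G) \<noteq> (y \<in> G)"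
proof -
  have *: "list_all (\<lambda>j. list_all (\<lambda>k. j = k \<or> list_ex (\<lambda>w. w ! j \<noteq> w ! k) golay_matrix) [0..<24]) [0..<24]"
    by code_simp
  have img: "z \<in> golay_point ` {..<24}" for z
    using bij_betw_imp_surj_on[OF bij_golay_point] by simp
  obtain j where j: "j < 24" "x = golay_point j" using img[of x] by (elim imageE) simp
  obtain k where k: "k < 24" "y = golay_point k" using img[of y] by (elim imageE) simp
  have "j \<in> set [0..<24]" "k \<in> set [0..<24]" using j k unfolding set_upt by simp_all
  from bspec[OF bspec[OF *[unfolded list_all_iff] this(1), unfolded list_all_iff] this(2)]
  have "\<exists>w\<in>set golay_matrix. w ! j \<noteq> w ! k"
    using assms j(2) k(2) unfolding list_ex_iff by metis
  then obtain w where "w \<in> set golay_matrix" "w ! j \<noteq> w ! k" by blast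
  then obtain l where l: "l < length golay_matrix" "golay_matrix ! l ! j \<noteq> golay_matrix ! l ! k"
    by (metis in_set_conv_nth)
  have "length golay_matrix = 24" by (simp add: golay_matrix_def)
  then have "golay_row l \<in> golay_code" "(x \<in> golay_row l) \<noteq> (y \<in> golay_row l)"
    using l j k golay_row by (simp_all add: golay_row_def)
  then show ?thesis by blast
qed

section \<open>Counting octads\<close>

definition octads :: "23 option set set" where
  "octads = {A \<in> golay_code. card A = 8}"

text \<open>The second moment of \<open>24 - 2 |A|\<close> over the code is that of the full space, since the
  code separates coordinates; with five possible weights this determines the number of octads.\<close>

lemma octads_card_ge: "card octads \<ge> 759"
proof -
  define s where "s A x = (if x \<in> A then -1 else 1 :: int)" for A and x :: "23 option"
  have sum_s: "(\<Sum>x\<in>UNIV. s A x) = 24 - 2 * int (card A)" for A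
  proof -
    have "(\<Sum>x\<in>UNIV. s A x) = (\<Sum>x\<in>UNIV. 1 - 2 * (if x \<in> A then 1 else 0))"
      by (intro sum.cong) (auto simp: s_def)
    also have "\<dots> = int CARD(23 option) - 2 * (\<Sum>x\<in>UNIV. if x \<in> A then 1 else 0)"
      by (simp only: sum_subtractf sum_distrib_left[symmetric]) simp
    also have "(\<Sum>x\<in>UNIV. if x \<in> A then 1 else 0) = int (card A)"
      by (simp add: sum.If_cases)
    finally show ?thesis unfolding card_coordinates by simp
  qed
  have zero: "(\<Sum>A\<in>golay_code. s A x * s A y) = 0" if xy: "x \<noteq> y" for x y :: "23 option"
  proof -
    obtain G where G: "G \<in> golay_code" "(x \<in> G) \<noteq> (y \<in> G)" using golay_separates[OF xy] by blast
    have inv: "sym_diff (sym_diff A G) G = A" for A by blast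
    \<comment> \<open>Adding G permutes the code and flips exactly one of the two signs, since G
      contains exactly one of x and y.\<close>
    have "(\<Sum>A\<in>golay_code. s A x * s A y) = (\<Sum>A\<in>golay_code. s (sym_diff A G) x * s (sym_diff A G) y)"
      by (rule sum.reindex_bij_witness[of _ "\<lambda>A. sym_diff A G" "\<lambda>A. sym_diff A G"])
         (simp_all only: inv golay_code_xor G(1))
    also have "\<dots> = (\<Sum>A\<in>golay_code. - (s A x * s A y))"
      using G(2) by (intro sum.cong) (auto simp: s_def)
    finally show ?thesis by (simp add: sum_negf)
  qed
  have "(\<Sum>A\<in>golay_code. (24 - 2 * int (card A))\<^sup>2) = (\<Sum>A\<in>golay_code. \<Sum>x\<in>UNIV. \<Sum>y\<in>UNIV. s A x * s A y)"
    by (simp add: sum_s[symmetric] power2_eq_square sum_product)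
  also have "\<dots> = (\<Sum>x\<in>UNIV. \<Sum>y\<in>UNIV. \<Sum>A\<in>golay_code. s A x * s A y)"
    by (subst sum.swap) (intro sum.cong refl sum.swap)
  also have "\<dots> = (\<Sum>x\<in>UNIV. \<Sum>y\<in>UNIV. if (x :: 23 option) = y then int (card golay_code) else 0)"
  proof (intro sum.cong refl)
    fix x y :: "23 option"
    have "s A z * s A z = 1" for A z by (simp add: s_def)
    then show "(\<Sum>A\<in>golay_code. s A x * s A y) = (if x = y then int (card golay_code) else 0)"
      using zero[of x y] by simp
  qed
  also have "\<dots> = int CARD(23 option) * int (card golay_code)"
    by simp
  finally have moment: "(\<Sum>A\<in>golay_code. (24 - 2 * int (card A))\<^sup>2) = 24 * int (card golay_code)"
    unfolding card_coordinates by simp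
  define W where "W k = {A \<in> golay_code. card A = k}" for k
  have W0: "W 0 = {{}}" using golay_code.empty by (auto simp: W_def)
  have W24: "W 24 = {UNIV}"
  proof -
    have "A = UNIV" if "card A = 24" for A :: "23 option set"
      using that card_coordinates by (metis card_subset_eq finite subset_UNIV)
    then show ?thesis using UNIV_in_golay card_coordinates by (auto simp: W_def)
  qed
  have W16: "card (W 16) = card (W 8)"
  proof (rule bij_betw_same_card[of uminus], rule bij_betw_byWitness[of _ uminus])
    show "uminus ` W 16 \<subseteq> W 8" "uminus ` W 8 \<subseteq> W 16"
      using golay_complement by (auto simp: W_def card_complement_24)
  qed auto
  have "(\<Sum>A\<in>golay_code. (24 - 2 * int (card A))\<^sup>2) = (\<Sum>k\<in>{0, 8, 12, 16, 24}. \<Sum>A\<in>W k. (24 - 2 * int (card A))\<^sup>2)"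
  proof -
    have "card ` golay_code \<subseteq> {0, 8, 12, 16, 24}" by (rule image_subsetI) (rule golay_weights)
    note * = sum.group[OF finite _ this]
    show ?thesis unfolding W_def by (rule sym) (rule *, simp)
  qed
  also have "\<dots> = (\<Sum>k\<in>{0, 8, 12, 16, 24}. (24 - 2 * int k)\<^sup>2 * int (card (W k)))"
    by (intro sum.cong refl) (simp add: W_def)
  \<comment> \<open>Weights 0 and 24 contribute 24^2 each, weights 8 and 16 contribute 64 per word,
    and weight 12 contributes nothing. Comparison with 24 * 4096 gives 759.\<close>
  also have "\<dots> = 1152 + 128 * int (card (W 8))"
    by (simp add: W0 W24 W16)
  finally show ?thesis using moment golay_card_ge unfolding octads_def W_def by linarith
qed

section \<open>The Leech lattice\<close>

type_synonym ivec = "int ^ (23 option)"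

text \<open>The lattice before scaling by 1 / sqrt 8, so that everything is integer arithmetic:
  \<open>idot\<close> is 8 times the lattice inner product, and minimal vectors have
  \<open>idot z z\<close> = 32.\<close>

definition leech_int :: "ivec \<Rightarrow> bool" where
  "leech_int z \<longleftrightarrow> (\<exists>m\<in>{0, 1}. (\<forall>i. z $ i mod 2 = m) \<and> (\<Sum>i\<in>UNIV. z $ i) mod 8 = 4 * m \<and>
     (\<forall>k. {i. z $ i mod 4 = k} \<in> golay_code))"

definition idot :: "ivec \<Rightarrow> ivec \<Rightarrow> int" where
  "idot z w = (\<Sum>i\<in>UNIV. z $ i * w $ i)"

text \<open>Coordinates for the lattice: m is the common parity and A collects the entries congruent
  to m + 2 modulo 4. Since 4 divides |A|, the condition on the coordinate sum modulo 8 becomes that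
  the sum of c has the parity of m.\<close>

definition leech_vec :: "int \<Rightarrow> 23 option set \<Rightarrow> ivec \<Rightarrow> ivec" where
  "leech_vec m A c = (\<chi> i. m + 2 * of_bool (i \<in> A) + 4 * c $ i)"

lemma sum_of_bool: "(\<Sum>i\<in>UNIV. of_bool (i \<in> A)) = int (card A)" for A :: "23 option set"
  by (simp add: of_bool_def sum.If_cases)

lemma golay_dvd: "A \<in> golay_code \<Longrightarrow> 4 dvd int (card A)"
  using golay_doubly_even int_dvd_int_iff[of 4] by (metis of_nat_numeral)

lemma golay_inter_even: "A \<in> golay_code \<Longrightarrow> B \<in> golay_code \<Longrightarrow> 2 dvd int (card (A \<inter> B))"
  using golay_self_orthogonal by (metis even_of_nat)

lemma sum_leech_vec: "(\<Sum>i\<in>UNIV. leech_vec m A c $ i) = 24 * m + 2 * int (card A) + 4 * (\<Sum>i\<in>UNIV. c $ i)"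
  unfolding leech_vec_def
  by (simp add: sum.distrib sum_distrib_left[symmetric] sum_of_bool card_coordinates)

lemma leech_int_vec:
  assumes "m \<in> {0, 1}" "A \<in> golay_code" "(\<Sum>i\<in>UNIV. c $ i) mod 2 = m"
  shows "leech_int (leech_vec m A c)"
  unfolding leech_int_def
proof (intro bexI[OF _ assms(1)] conjI allI)
  show "leech_vec m A c $ i mod 2 = m" for i
    using assms(1) by (auto simp: leech_vec_def of_bool_def) presburger+
  obtain q where q: "int (card A) = 4 * q" using golay_dvd[OF assms(2)] by (elim dvdE)
  obtain r where r: "(\<Sum>i\<in>UNIV. c $ i) = 2 * r + m"
    using assms(3) by (metis mult_div_mod_eq)
  show "(\<Sum>i\<in>UNIV. leech_vec m A c $ i) mod 8 = 4 * m"
    unfolding sum_leech_vec q r using assms(1) by (auto; presburger)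
  fix k :: int
  have v: "leech_vec m A c $ i mod 4 = (if i \<in> A then m + 2 else m)" for i
    using assms(1) by (auto simp: leech_vec_def)
  consider "k = m" | "k = m + 2" | "k \<noteq> m" "k \<noteq> m + 2" by linarith
  then show "{i. leech_vec m A c $ i mod 4 = k} \<in> golay_code"
  proof cases
    case 1
    then have "{i. leech_vec m A c $ i mod 4 = k} = - A" unfolding v by auto
    then show ?thesis using golay_complement[OF assms(2)] by simp
  next
    case 2
    then have "{i. leech_vec m A c $ i mod 4 = k} = A" unfolding v by auto
    then show ?thesis using assms(2) by simp
  next
    case 3
    then have "{i. leech_vec m A c $ i mod 4 = k} = {}" unfolding v by auto
    then show ?thesis using golay_code.empty by simp
  qed
qed

lemma leech_intE:
  assumes "leech_int z"
  obtains m A c where "m \<in> {0, 1}" "A \<in> golay_code" "(\<Sum>i\<in>UNIV. c $ i) mod 2 = m" "z = leech_vec m A c"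
proof -
  have aux: "m = 0 \<or> m = 1 \<Longrightarrow> (24 * m + 2 * (4 * q) + 4 * s) mod 8 = 4 * m \<Longrightarrow> s mod 2 = m" for m q s :: int
    by presburger
  obtain m where m: "m \<in> {0, 1}" and par: "\<And>i. z $ i mod 2 = m" and sum: "(\<Sum>i\<in>UNIV. z $ i) mod 8 = 4 * m"
    and cls: "\<And>k. {i. z $ i mod 4 = k} \<in> golay_code"
    using assms unfolding leech_int_def by (elim bexE conjE) simp
  define A where "A = {i. z $ i mod 4 = m + 2}"
  define c :: ivec where "c = (\<chi> i. (z $ i - m - 2 * of_bool (i \<in> A)) div 4)"
  have A: "A \<in> golay_code" unfolding A_def by (rule cls)
  have z: "z = leech_vec m A c"
  proof (rule iffD2[OF vec_eq_iff], rule allI)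
    fix i
    have "z $ i mod 2 = m" by (rule par)
    then have "(z $ i - m - 2 * of_bool (i \<in> A)) mod 4 = 0"
      using m unfolding A_def by (auto simp: of_bool_def) presburger+
    then have "4 * ((z $ i - m - 2 * of_bool (i \<in> A)) div 4) = z $ i - m - 2 * of_bool (i \<in> A)"
      by presburger
    then show "z $ i = leech_vec m A c $ i" by (simp add: leech_vec_def c_def)
  qed
  obtain q where q: "int (card A) = 4 * q" using golay_dvd[OF A] by (elim dvdE)
  have "(24 * m + 2 * (4 * q) + 4 * (\<Sum>i\<in>UNIV. c $ i)) mod 8 = 4 * m"
    using sum unfolding z sum_leech_vec q .
  then have "(\<Sum>i\<in>UNIV. c $ i) mod 2 = m" using m aux[of m q] by simp
  then show ?thesis using that[OF m A _ z] by simp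
qed

text \<open>Binary subtraction with a borrow: the indicator of A minus that of B is the indicator of
  their symmetric difference minus twice that of B - A. The borrow passes into c, and |B - A| = |B|
  - |A \<inter> B| is even, so the parity condition survives.\<close>

lemma leech_int_diff:
  assumes "leech_int z" "leech_int w"
  shows "leech_int (z - w)"
proof -
  obtain m A c where z: "m \<in> {0, 1}" "A \<in> golay_code" "(\<Sum>i\<in>UNIV. c $ i) mod 2 = m" "z = leech_vec m A c"
    using assms(1) by (rule leech_intE)
  obtain n B d where w: "n \<in> {0, 1}" "B \<in> golay_code" "(\<Sum>i\<in>UNIV. d $ i) mod 2 = n" "w = leech_vec n B d"
    using assms(2) by (rule leech_intE)
  have par1: "(s - t - b) mod 2 = m - n"
    if "s mod 2 = m" "t mod 2 = n" "2 dvd b" "m - n = 0 \<or> m - n = 1" for s t b m n :: int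
    using that by presburger
  have par2: "(s - t - b - k) mod 2 = 1"
    if "s mod 2 = 0" "t mod 2 = 1" "2 dvd b" "2 dvd k" for s t b k :: int
    using that by presburger
  define D where "D = sym_diff A B"
  have D: "D \<in> golay_code" "- D \<in> golay_code"
    unfolding D_def by (rule golay_code_xor[OF z(2) w(2)], rule golay_complement[OF golay_code_xor[OF z(2) w(2)]])
  have BA: "2 dvd int (card (B - A))"
  proof -
    have "card B = card (B - A) + card (A \<inter> B)"
      by (metis add.commute card_Int_Diff finite Int_commute)
    then have "int (card (B - A)) = int (card B) - int (card (A \<inter> B))" by simp
    moreover have "2 dvd int (card B)" using golay_dvd[OF w(2)] by presburger
    ultimately show ?thesis using golay_inter_even[OF z(2) w(2)] by presburger
  qed
  define e :: ivec where "e = (\<chi> i. c $ i - d $ i - of_bool (i \<in> B - A))"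
  have se: "(\<Sum>i\<in>UNIV. e $ i) = (\<Sum>i\<in>UNIV. c $ i) - (\<Sum>i\<in>UNIV. d $ i) - int (card (B - A))"
    unfolding e_def by (simp only: vec_lambda_beta sum_subtractf sum_of_bool)
  show ?thesis
  proof (cases "m = 0 \<and> n = 1")
    case False
    have "z - w = leech_vec (m - n) D e"
      unfolding z(4) w(4) vec_eq_iff leech_vec_def e_def D_def by (auto simp: of_bool_def)
    moreover have "m - n \<in> {0, 1}" using False z(1) w(1) by auto
    moreover have "(\<Sum>i\<in>UNIV. e $ i) mod 2 = m - n"
      unfolding se using False z(1) w(1) by (intro par1[OF z(3) w(3) BA]) auto
    ultimately show ?thesis using leech_int_vec D(1) by metis
  next
    case True
    \<comment> \<open>The parity m - n = -1 is brought back to 1 by passing to the complement of D,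
      which borrows once more on that complement.\<close>
    define e' :: ivec where "e' = (\<chi> i. e $ i - of_bool (i \<in> - D))"
    have "z - w = leech_vec 1 (- D) e'"
      unfolding z(4) w(4) vec_eq_iff leech_vec_def e'_def e_def D_def using True by (auto simp: of_bool_def)
    moreover have "(\<Sum>i\<in>UNIV. e' $ i) = (\<Sum>i\<in>UNIV. e $ i) - int (card (- D))"
      unfolding e'_def by (simp only: vec_lambda_beta sum_subtractf sum_of_bool)
    moreover have "2 dvd int (card (- D))" using golay_dvd[OF D(2)] by presburger
    ultimately have "z - w = leech_vec 1 (- D) e'" "(\<Sum>i\<in>UNIV. e' $ i) mod 2 = 1"
      using par2[of "\<Sum>i\<in>UNIV. c $ i" "\<Sum>i\<in>UNIV. d $ i" "int (card (B - A))" "int (card (- D))"]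
        se z(3) w(3) BA True by simp_all
    then show ?thesis using leech_int_vec[of 1 "- D" e'] D(2) by simp
  qed
qed

lemma leech_int_uminus:
  assumes "leech_int z"
  shows "leech_int (- z)"
  using leech_int_diff[OF leech_int_diff[OF assms assms] assms] by simp

text \<open>Expand (m + 2a + 4c)(n + 2b + 4d) and sum. Modulo 8 the terms with |A|, |B| and |A
  \<inter> B| vanish by double evenness and self-orthogonality; the two terms with the sums of c and
  d give 4mn each and cancel together.\<close>

lemma idot_dvd:
  assumes "leech_int z" "leech_int w"
  shows "8 dvd idot z w"
proof -
  obtain m A c where z: "m \<in> {0, 1}" "A \<in> golay_code" "(\<Sum>i\<in>UNIV. c $ i) mod 2 = m" "z = leech_vec m A c"
    using assms(1) by (rule leech_intE)
  obtain n B d where w: "n \<in> {0, 1}" "B \<in> golay_code" "(\<Sum>i\<in>UNIV. d $ i) mod 2 = n" "w = leech_vec n B d"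
    using assms(2) by (rule leech_intE)
  define X where "X i = (of_bool (i \<in> A) * d $ i + of_bool (i \<in> B) * c $ i + 2 * c $ i * d $ i)" for i
  have "z $ i * w $ i = m * n + 2 * m * of_bool (i \<in> B) + 2 * n * of_bool (i \<in> A) + 4 * of_bool (i \<in> A \<inter> B) +
      4 * m * d $ i + 4 * n * c $ i + 8 * X i" for i
    unfolding z(4) w(4) leech_vec_def X_def by (auto simp: of_bool_def algebra_simps)
  then have "idot z w = 24 * m * n + 2 * m * int (card B) + 2 * n * int (card A) + 4 * int (card (A \<inter> B)) +
      4 * m * (\<Sum>i\<in>UNIV. d $ i) + 4 * n * (\<Sum>i\<in>UNIV. c $ i) + 8 * (\<Sum>i\<in>UNIV. X i)"
    unfolding idot_def
    by (simp only: sum.distrib sum_distrib_left[symmetric] sum_of_bool) (simp add: card_coordinates)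
  moreover obtain p q r where "int (card A) = 4 * p" "int (card B) = 4 * q" "int (card (A \<inter> B)) = 2 * r"
    using golay_dvd[OF z(2)] golay_dvd[OF w(2)] golay_inter_even[OF z(2) w(2)] by (elim dvdE)
  moreover obtain s t where "(\<Sum>i\<in>UNIV. c $ i) = 2 * s + m" "(\<Sum>i\<in>UNIV. d $ i) = 2 * t + n"
    using z(3) w(3) by (metis mult_div_mod_eq)
  ultimately have "idot z w = 8 * (3 * m * n + m * q + n * p + r + m * t + n * s + m * n + (\<Sum>i\<in>UNIV. X i))"
    by (simp add: algebra_simps)
  then show ?thesis by simp
qed

text \<open>Odd vectors: the value is at least 24 and divisible by 8, and 24 would mean that all
  entries are 1 or -1, which makes the coordinate sum 0 instead of 4 modulo 8. Even vectors: either
  a nonempty Golay word gives at least eight entries of size at least 2, or all entries are 4 c i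
  with even sum of c, whence the sum of squares of c is even and nonzero.\<close>

lemma idot_self_ge:
  assumes z: "leech_int z" and nz: "z \<noteq> 0"
  shows "idot z z \<ge> 32"
proof -
  obtain m where m: "m \<in> {0, 1}" and par: "\<And>i. z $ i mod 2 = m" and sum: "(\<Sum>i\<in>UNIV. z $ i) mod 8 = 4 * m"
    and cls: "\<And>k. {i. z $ i mod 4 = k} \<in> golay_code"
    using z unfolding leech_int_def by (elim bexE conjE) simp
  have dvd: "8 dvd idot z z" by (rule idot_dvd[OF z z])
  have arith1: "8 dvd n \<Longrightarrow> n = 24 + t \<Longrightarrow> t \<noteq> 0 \<Longrightarrow> t \<ge> 0 \<Longrightarrow> n \<ge> 32" for n t :: int
    by presburger
  have arith2: "s = 24 - 2 * a \<Longrightarrow> 4 dvd a \<Longrightarrow> s mod 8 \<noteq> 4" for s a :: int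
    by presburger
  have arith3: "s - t = e \<Longrightarrow> 2 dvd e \<Longrightarrow> (4 * t) mod 8 = 0 \<Longrightarrow> 2 dvd s" for s t e :: int
    by presburger
  have arith4: "2 dvd s \<Longrightarrow> s \<noteq> 0 \<Longrightarrow> s \<ge> 0 \<Longrightarrow> 16 * s \<ge> 32" for s :: int
    by presburger
  show ?thesis
  proof (cases "m = 1")
    case True
    have sq: "z $ i * z $ i \<ge> 1" for i
    proof -
      have "z $ i \<noteq> 0" using par[of i] True by auto
      then show ?thesis by (metis not_square_less_zero mult_eq_0_iff int_one_le_iff_zero_less less_le not_le)
    qed
    have eq: "idot z z = 24 + (\<Sum>i\<in>UNIV. z $ i * z $ i - 1)"
      unfolding idot_def by (simp add: sum_subtractf card_coordinates)
    have "(\<Sum>i\<in>UNIV. z $ i * z $ i - 1) \<noteq> 0"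
    proof
      assume "(\<Sum>i\<in>UNIV. z $ i * z $ i - 1) = 0"
      then have "z $ i * z $ i - 1 = 0" for i
      proof (rule sum_nonneg_0[rotated 2])
        show "0 \<le> z $ j * z $ j - 1" for j using sq[of j] by linarith
      qed simp_all
      then have one: "z $ i * z $ i = 1" for i by simp
      define A where "A = {i. z $ i mod 4 = 3}"
      have "z $ i = 1 - 2 * of_bool (i \<in> A)" for i
      proof -
        have "z $ i = 1 \<or> z $ i = -1" using one[of i] by (metis zmult_eq_1_iff)
        then show ?thesis by (auto simp: A_def)
      qed
      then have "(\<Sum>i\<in>UNIV. z $ i) = 24 - 2 * int (card A)"
        by (simp only: sum_subtractf sum_distrib_left[symmetric] sum_of_bool) (simp add: card_coordinates)
      moreover have "4 dvd int (card A)" unfolding A_def by (rule golay_dvd[OF cls])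
      ultimately show False using arith2 sum True by simp
    qed
    moreover have "(\<Sum>i\<in>UNIV. z $ i * z $ i - 1) \<ge> 0"
      using sq by (intro sum_nonneg) (simp add: algebra_simps)
    ultimately show ?thesis using arith1[OF dvd eq] by blast
  next
    case False
    then have m0: "m = 0" using m by simp
    define A where "A = {i. z $ i mod 4 = 2}"
    have A: "A \<in> golay_code" unfolding A_def by (rule cls)
    show ?thesis
    proof (cases "A = {}")
      case False
      have "32 \<le> 4 * int (card A)" using golay_min_weight[OF A False] by simp
      also have "\<dots> = (\<Sum>i\<in>UNIV. 4 * of_bool (i \<in> A))" by (simp only: sum_distrib_left[symmetric] sum_of_bool)
      also have "\<dots> \<le> idot z z" unfolding idot_def
      proof (rule sum_mono)
        fix i
        have "4 \<le> z $ i * z $ i" if "i \<in> A"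
        proof -
          have "z $ i \<le> -2 \<or> z $ i \<ge> 2" using that unfolding A_def by simp presburger
          then show ?thesis using mult_mono[of 2 "z $ i" 2 "z $ i"] mult_mono[of 2 "- z $ i" 2 "- z $ i"] by auto
        qed
        then show "4 * of_bool (i \<in> A) \<le> z $ i * z $ i" by (cases "i \<in> A") auto
      qed
      finally show ?thesis .
    next
      case True
      define c where "c i = z $ i div 4" for i
      have zc: "z $ i = 4 * c i" for i
      proof -
        have "z $ i mod 4 \<noteq> 2" using True unfolding A_def by (metis (mono_tags) empty_iff mem_Collect_eq)
        then show ?thesis unfolding c_def using par[of i] m0 by presburger
      qed
      have I: "idot z z = 16 * (\<Sum>i\<in>UNIV. c i * c i)"
        unfolding idot_def zc by (simp add: sum_distrib_left algebra_simps)
      have "(\<Sum>i\<in>UNIV. c i * c i) - (\<Sum>i\<in>UNIV. c i) = (\<Sum>i\<in>UNIV. c i * (c i - 1))"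
        by (simp add: sum_subtractf algebra_simps)
      moreover have "2 dvd (\<Sum>i\<in>UNIV. c i * (c i - 1))" by (rule dvd_sum) simp
      moreover have "(4 * (\<Sum>i\<in>UNIV. c i)) mod 8 = 0" using sum m0 unfolding zc by (simp add: sum_distrib_left)
      ultimately have "2 dvd (\<Sum>i\<in>UNIV. c i * c i)" by (rule arith3)
      moreover have "(\<Sum>i\<in>UNIV. c i * c i) \<noteq> 0"
      proof
        assume "(\<Sum>i\<in>UNIV. c i * c i) = 0"
        then have "c i = 0" for i by (subst (asm) sum_nonneg_eq_0_iff) auto
        then show False using nz by (simp add: vec_eq_iff zc)
      qed
      moreover have "(\<Sum>i\<in>UNIV. c i * c i) \<ge> 0" by (intro sum_nonneg) simp
      ultimately show ?thesis unfolding I by (rule arith4)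
    qed
  qed
qed

definition min_ints :: "ivec set" where
  "min_ints = {z. leech_int z \<and> idot z z = 32}"

definition real_vec :: "ivec \<Rightarrow> vec24" where
  "real_vec z = (\<chi> i. real_of_int (z $ i))"

lemma real_vec_inner: "real_vec z \<bullet> real_vec w = real_of_int (idot z w)"
  unfolding real_vec_def inner_vec_def idot_def by simp

lemma real_vec_diff: "real_vec (z - w) = real_vec z - real_vec w"
  by (simp add: real_vec_def vec_eq_iff)

lemma inj_real_vec: "inj real_vec"
  by (rule injI) (simp add: real_vec_def vec_eq_iff)

lemma leech_lattice_eq: "leech_lattice = (\<lambda>z. (1 / sqrt 8) *\<^sub>R real_vec z) ` {z. leech_int z}"
proof -
  have "v \<in> leech_lattice \<longleftrightarrow> (\<exists>z. leech_int z \<and> v = (1 / sqrt 8) *\<^sub>R real_vec z)" for v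
    unfolding leech_lattice_def leech_int_def real_vec_def by blast
  then show ?thesis by (auto simp: image_iff)
qed

section \<open>Explicit minimal vectors and their number\<close>

definition signed_word :: "23 option set \<Rightarrow> 23 option set \<Rightarrow> int \<Rightarrow> ivec" where
  "signed_word A S a = (\<chi> i. if i \<in> A then (if i \<in> S then - a else a) else 0)"

definition odd_word :: "23 option set \<Rightarrow> 23 option \<Rightarrow> ivec" where
  "odd_word A j = (\<chi> i. (if i \<in> A then -1 else 1) * (if i = j then -3 else 1))"

lemma idot_signed_word: "idot (signed_word A S a) (signed_word A S a) = int (card A) * a\<^sup>2"
proof -
  have "idot (signed_word A S a) (signed_word A S a) = (\<Sum>i\<in>UNIV. of_bool (i \<in> A) * a\<^sup>2)"
    unfolding idot_def signed_word_def by (intro sum.cong) (auto simp: power2_eq_square)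
  then show ?thesis by (simp only: sum_distrib_right[symmetric] sum_of_bool)
qed

lemma sum_signed_word:
  assumes "S \<subseteq> A"
  shows "(\<Sum>i\<in>UNIV. signed_word A S a $ i) = a * int (card A) - 2 * a * int (card S)"
proof -
  have "signed_word A S a $ i = a * of_bool (i \<in> A) - 2 * a * of_bool (i \<in> S)" for i
    using assms unfolding signed_word_def by (auto simp: of_bool_def)
  then show ?thesis by (simp only: sum_subtractf sum_distrib_left[symmetric] sum_of_bool)
qed

lemma signed_word_inject:
  assumes "signed_word A S a = signed_word B T a" "S \<subseteq> A" "T \<subseteq> B" "a > 0"
  shows "A = B \<and> S = T"
proof -
  have e: "signed_word A S a $ i = signed_word B T a $ i" for i using assms(1) by simp
  have "i \<in> A \<longleftrightarrow> i \<in> B" and "i \<in> S \<longleftrightarrow> i \<in> T" for i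
    using e[of i] assms(2-4) unfolding signed_word_def by (auto split: if_splits)
  then show ?thesis by (simp add: set_eq_iff)
qed

text \<open>These are the shapes (4, 4, 0^22) with arbitrary signs and (2^8, 0^16) supported on an
  octad with an even number of minus signs; that parity puts the coordinate sum into 8Z.\<close>

lemma signed_word_in_min_ints:
  assumes "S \<subseteq> A" and "card A = 2 \<and> a = 4 \<or> A \<in> octads \<and> even (card S) \<and> a = 2"
  shows "signed_word A S a \<in> min_ints"
proof -
  have "idot (signed_word A S a) (signed_word A S a) = 32"
    unfolding idot_signed_word using assms(2) by (auto simp: octads_def)
  moreover have "leech_int (signed_word A S a)"
    unfolding leech_int_def
  proof (intro bexI[of _ 0] conjI allI)
    show "signed_word A S a $ i mod 2 = 0" for i
      using assms(2) by (auto simp: signed_word_def)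
    show "(\<Sum>i\<in>UNIV. signed_word A S a $ i) mod 8 = 4 * 0"
      unfolding sum_signed_word[OF assms(1)] using assms(2)
    proof (elim disjE conjE)
      assume "A \<in> octads" "even (card S)" "a = 2"
      moreover from this obtain s where "card S = 2 * s" by (elim evenE)
      ultimately show "(a * int (card A) - 2 * a * int (card S)) mod 8 = 4 * 0"
        by (simp add: octads_def)
    qed simp
    fix k :: int
    show "{i. signed_word A S a $ i mod 4 = k} \<in> golay_code"
    proof (cases "a = 4")
      case True
      then have "signed_word A S a $ i mod 4 = 0" for i by (auto simp: signed_word_def)
      then show ?thesis by (cases "k = 0") (simp_all add: UNIV_in_golay golay_code.empty)
    next
      case False
      then have a: "a = 2" and A: "A \<in> golay_code" using assms(2) by (auto simp: octads_def)
      have m: "signed_word A S a $ i mod 4 = (if i \<in> A then 2 else 0)" for i by (simp add: signed_word_def a)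
      consider "k = 0" | "k = 2" | "k \<noteq> 0" "k \<noteq> 2" by blast
      then show ?thesis
      proof cases
        case 1
        then have "{i. signed_word A S a $ i mod 4 = k} = - A" unfolding m by auto
        then show ?thesis using golay_complement[OF A] by simp
      next
        case 2
        then have "{i. signed_word A S a $ i mod 4 = k} = A" unfolding m by auto
        then show ?thesis using A by simp
      next
        case 3
        then have "{i. signed_word A S a $ i mod 4 = k} = {}" unfolding m by auto
        then show ?thesis using golay_code.empty by simp
      qed
    qed
  qed simp
  ultimately show ?thesis by (simp add: min_ints_def)
qed

text \<open>The shape (3, 1^23) up to signs: start with -3 at j and 1 elsewhere, then change signs
  on a Golay word. Both -3 and 1 are 1 modulo 4, so the class of 3 is exactly A.\<close>

lemma odd_word_in_min_ints:
  assumes A: "A \<in> golay_code"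
  shows "odd_word A j \<in> min_ints"
proof -
  have "odd_word A j $ i * odd_word A j $ i = 1 + 8 * of_bool (i \<in> {j})" for i
    by (simp add: odd_word_def)
  then have "idot (odd_word A j) (odd_word A j) = 32"
    unfolding idot_def by (simp only: sum.distrib sum_distrib_left[symmetric] sum_of_bool) (simp add: card_coordinates)
  moreover have "leech_int (odd_word A j)"
    unfolding leech_int_def
  proof (intro bexI[of _ 1] conjI allI)
    show "odd_word A j $ i mod 2 = 1" for i by (simp add: odd_word_def)
    have "odd_word A j $ i = 1 - 2 * of_bool (i \<in> A) + (if j \<in> A then 4 else -4) * of_bool (i \<in> {j})" for i
      by (auto simp: odd_word_def)
    then have "(\<Sum>i\<in>UNIV. odd_word A j $ i) = 24 - 2 * int (card A) + (if j \<in> A then 4 else -4)"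
      by (simp only: sum.distrib sum_subtractf sum_distrib_left[symmetric] sum_of_bool) (simp add: card_coordinates)
    moreover obtain q where "int (card A) = 4 * q" using golay_dvd[OF A] by (elim dvdE)
    moreover have "s mod 8 = 4 * 1" if "s = 24 - 2 * a + (if P then 4 else -4)" "a = 4 * q" for s a q :: int and P
      unfolding that by (cases P) (simp_all only: if_True if_False, presburger+)
    ultimately show "(\<Sum>i\<in>UNIV. odd_word A j $ i) mod 8 = 4 * 1" by blast
    fix k :: int
    have m: "odd_word A j $ i mod 4 = (if i \<in> A then 3 else 1)" for i by (simp add: odd_word_def)
    consider "k = 1" | "k = 3" | "k \<noteq> 1" "k \<noteq> 3" by blast
    then show "{i. odd_word A j $ i mod 4 = k} \<in> golay_code"
    proof cases
      case 1
      then have "{i. odd_word A j $ i mod 4 = k} = - A" unfolding m by auto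
      then show ?thesis using golay_complement[OF A] by simp
    next
      case 2
      then have "{i. odd_word A j $ i mod 4 = k} = A" unfolding m by auto
      then show ?thesis using A by simp
    next
      case 3
      then have "{i. odd_word A j $ i mod 4 = k} = {}" unfolding m by auto
      then show ?thesis using golay_code.empty by simp
    qed
  qed simp
  ultimately show ?thesis by (simp add: min_ints_def)
qed

lemma odd_word_inject:
  assumes "odd_word A j = odd_word B k"
  shows "A = B \<and> j = k"
proof -
  have e: "odd_word A j $ i = odd_word B k $ i" for i using assms by simp
  have "i \<in> A \<longleftrightarrow> i \<in> B" for i
    using e[of i] unfolding odd_word_def by (auto split: if_splits)
  moreover have "j = k"
    using e[of j] unfolding odd_word_def by (auto split: if_splits)
  ultimately show ?thesis by (simp add: set_eq_iff)
qed

text \<open>Deleting a fixed element a is a bijection onto the subsets of A - {a}, since parity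
  decides whether a was present.\<close>

lemma card_even_subsets:
  assumes "finite A" "A \<noteq> {}"
  shows "card {S. S \<subseteq> A \<and> even (card S)} = 2 ^ (card A - 1)"
proof -
  obtain a where a: "a \<in> A" using assms(2) by blast
  have "bij_betw (\<lambda>S. S - {a}) {S. S \<subseteq> A \<and> even (card S)} (Pow (A - {a}))"
  proof (rule bij_betw_byWitness[of _ "\<lambda>T. if even (card T) then T else insert a T"])
    show "\<forall>S\<in>{S. S \<subseteq> A \<and> even (card S)}. (if even (card (S - {a})) then S - {a} else insert a (S - {a})) = S"
    proof
      fix S assume "S \<in> {S. S \<subseteq> A \<and> even (card S)}"
      then have "finite S" "even (card S)" using finite_subset assms(1) by auto
      then show "(if even (card (S - {a})) then S - {a} else insert a (S - {a})) = S"
        by (cases "a \<in> S") (auto simp: card_Diff_singleton_if card_gt_0_iff)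
    qed
    show "\<forall>T\<in>Pow (A - {a}). (if even (card T) then T else insert a T) - {a} = T" by auto
    show "(\<lambda>S. S - {a}) ` {S. S \<subseteq> A \<and> even (card S)} \<subseteq> Pow (A - {a})" by auto
    show "(\<lambda>T. if even (card T) then T else insert a T) ` Pow (A - {a}) \<subseteq> {S. S \<subseteq> A \<and> even (card S)}"
    proof (intro image_subsetI)
      fix T assume T: "T \<in> Pow (A - {a})"
      then have "finite T" "a \<notin> T" using finite_subset assms(1) by auto
      then show "(if even (card T) then T else insert a T) \<in> {S. S \<subseteq> A \<and> even (card S)}" using T a by auto
    qed
  qed
  then have "card {S. S \<subseteq> A \<and> even (card S)} = card (Pow (A - {a}))" by (rule bij_betw_same_card)
  then show ?thesis using assms a by (simp add: card_Pow)
qed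

lemma finite_min_ints: "finite min_ints"
proof -
  have "min_ints \<subseteq> vec_lambda ` (PiE UNIV (\<lambda>_. {-32..32}))"
  proof
    fix z assume z: "z \<in> min_ints"
    have "z $ i \<in> {-32..32}" for i
    proof -
      have "z $ i * z $ i \<le> idot z z" unfolding idot_def by (rule member_le_sum) simp_all
      then have "z $ i * z $ i \<le> 32" using z by (simp add: min_ints_def)
      moreover have "\<bar>z $ i\<bar> \<le> z $ i * z $ i"
        by (metis abs_ge_zero abs_mult_self_eq mult_cancel_left1 mult_le_cancel_left1 linorder_not_le abs_of_nonneg int_one_le_iff_zero_less less_le)
      ultimately show ?thesis by auto
    qed
    then show "z \<in> vec_lambda ` (PiE UNIV (\<lambda>_. {-32..32}))"
      by (intro image_eqI[of _ _ "vec_nth z"]) auto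
  qed
  then show ?thesis by (rule finite_subset) (intro finite_imageI finite_PiE, simp_all)
qed

text \<open>The three shapes contribute 276 * 4 = 1104, at least 759 * 128 = 97152, and at least
  4096 * 24 = 98304.\<close>

lemma card_min_ints: "card min_ints \<ge> 196560"
proof -
  let ?P1 = "Sigma {A :: 23 option set. card A = 2} Pow"
  let ?P2 = "Sigma octads (\<lambda>A. {S. S \<subseteq> A \<and> even (card S)})"
  let ?P3 = "golay_code \<times> (UNIV :: 23 option set)"
  let ?F1 = "(\<lambda>(A, S). signed_word A S 4) ` ?P1"
  let ?F2 = "(\<lambda>(A, S). signed_word A S 2) ` ?P2"
  let ?F3 = "(\<lambda>(A, j). odd_word A j) ` ?P3"
  have "card ?F1 = card ?P1"
  proof (rule card_image, rule inj_onI, clarify)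
    fix A S B T :: "23 option set"
    assume "S \<subseteq> A" "T \<subseteq> B" "signed_word A S 4 = signed_word B T 4"
    then show "A = B \<and> S = T" by (intro signed_word_inject) auto
  qed
  also have "\<dots> = (\<Sum>A\<in>{A :: 23 option set. card A = 2}. 4)"
    by (subst card_SigmaI) (auto simp: card_Pow intro!: sum.cong)
  also have "\<dots> = 1104"
    using n_subsets[of "UNIV :: 23 option set" 2] by (simp add: card_coordinates choose_two)
  finally have F1: "card ?F1 = 1104" .
  have "card ?F2 = card ?P2"
  proof (rule card_image, rule inj_onI, clarify)
    fix A S B T :: "23 option set"
    assume "S \<subseteq> A" "T \<subseteq> B" "signed_word A S 2 = signed_word B T 2"
    then show "A = B \<and> S = T" by (intro signed_word_inject) auto
  qed
  also have "\<dots> = (\<Sum>A\<in>octads. card {S. S \<subseteq> A \<and> even (card S)})"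
    by (rule card_SigmaI) simp_all
  also have "\<dots> = (\<Sum>A\<in>octads. 128)"
  proof (rule sum.cong[OF refl])
    fix A :: "23 option set" assume "A \<in> octads"
    then have "card A = 8" by (simp add: octads_def)
    show "card {S. S \<subseteq> A \<and> even (card S)} = 128"
      using card_even_subsets[OF finite, of A] \<open>card A = 8\<close> by (cases "A = {}") simp_all
  qed
  finally have F2: "card ?F2 \<ge> 97152" using octads_card_ge by simp
  have "card ?F3 = card ?P3"
    by (rule card_image, rule inj_onI) (auto dest!: odd_word_inject)
  then have F3: "card ?F3 \<ge> 98304"
    using golay_card_ge by (simp add: card_cartesian_product card_coordinates)
  have d12: "?F1 \<inter> ?F2 = {}"
  proof -
    have False if tw: "signed_word A S 4 = signed_word B T 2" "card A = 2" for A S B T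
    proof -
      have "A \<noteq> {}" using tw(2) by auto
      then obtain i where "i \<in> A" by blast
      moreover have "signed_word A S 4 $ i = signed_word B T 2 $ i" using tw(1) by simp
      ultimately show False by (simp add: signed_word_def split: if_splits)
    qed
    then show ?thesis by auto
  qed
  have d3: "(?F1 \<union> ?F2) \<inter> ?F3 = {}"
  proof -
    have "odd_word B j \<noteq> signed_word A S a" if "even a" for A S a B j
    proof
      assume "odd_word B j = signed_word A S a"
      then have "signed_word A S a $ j = odd_word B j $ j" by simp
      moreover have "even (signed_word A S a $ j)" using that by (simp add: signed_word_def)
      ultimately show False by (simp add: odd_word_def split: if_splits)
    qed
    then show ?thesis by auto
  qed
  have "?F1 \<union> ?F2 \<union> ?F3 \<subseteq> min_ints"
    using signed_word_in_min_ints odd_word_in_min_ints by auto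
  then have "card (?F1 \<union> ?F2 \<union> ?F3) \<le> card min_ints"
    by (rule card_mono[OF finite_min_ints])
  moreover have "card (?F1 \<union> ?F2 \<union> ?F3) = card ?F1 + card ?F2 + card ?F3"
    using d12 d3 by (simp add: card_Un_disjoint)
  ultimately show ?thesis using F1 F2 F3 by linarith
qed

lemma leech_code_eq: "leech_code = (\<lambda>z. (1 / sqrt 32) *\<^sub>R real_vec z) ` min_ints"
proof -
  have norm: "norm ((1 / sqrt 8) *\<^sub>R real_vec z) = sqrt (real_of_int (idot z z) / 8)" for z
    by (simp add: norm_eq_sqrt_inner real_vec_inner real_sqrt_divide real_sqrt_mult[symmetric])
  have zero: "(1 / sqrt 8) *\<^sub>R real_vec z = 0 \<longleftrightarrow> z = 0" for z
    by (simp add: real_vec_def vec_eq_iff)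
  obtain y where y: "y \<in> min_ints"
    using card_min_ints by (metis card.empty ex_in_conv not_numeral_le_zero)
  have "minimal_vectors leech_lattice = (\<lambda>z. (1 / sqrt 8) *\<^sub>R real_vec z) ` min_ints"
  proof (rule set_eqI)
    fix v
    show "v \<in> minimal_vectors leech_lattice \<longleftrightarrow> v \<in> (\<lambda>z. (1 / sqrt 8) *\<^sub>R real_vec z) ` min_ints"
    proof
      assume v: "v \<in> minimal_vectors leech_lattice"
      then obtain z where z: "leech_int z" "z \<noteq> 0" "v = (1 / sqrt 8) *\<^sub>R real_vec z"
        unfolding minimal_vectors_def leech_lattice_eq using zero by auto
      have "(1 / sqrt 8) *\<^sub>R real_vec y \<in> leech_lattice - {0}"
        using y zero[of y] unfolding leech_lattice_eq min_ints_def by (auto simp: idot_def)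
      then have "norm v \<le> norm ((1 / sqrt 8) *\<^sub>R real_vec y)"
        using v unfolding minimal_vectors_def by blast
      then have "idot z z \<le> 32" using y unfolding z(3) norm by (simp add: min_ints_def)
      then have "z \<in> min_ints" using idot_self_ge[OF z(1,2)] z(1) by (simp add: min_ints_def)
      then show "v \<in> (\<lambda>z. (1 / sqrt 8) *\<^sub>R real_vec z) ` min_ints" using z(3) by blast
    next
      assume "v \<in> (\<lambda>z. (1 / sqrt 8) *\<^sub>R real_vec z) ` min_ints"
      then obtain z where z: "leech_int z" "idot z z = 32" "v = (1 / sqrt 8) *\<^sub>R real_vec z"
        unfolding min_ints_def by blast
      have "z \<noteq> 0" using z(2) by (auto simp: idot_def)
      then have "v \<in> leech_lattice - {0}" using z zero unfolding leech_lattice_eq by auto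
      moreover have "norm v \<le> norm u" if u: "u \<in> leech_lattice - {0}" for u
      proof -
        obtain w where w: "leech_int w" "w \<noteq> 0" "u = (1 / sqrt 8) *\<^sub>R real_vec w"
          using u zero unfolding leech_lattice_eq by auto
        show ?thesis unfolding w(3) z(3) norm
          by (intro real_sqrt_le_mono divide_right_mono) (use idot_self_ge[OF w(1,2)] z(2) in simp_all)
      qed
      ultimately show "v \<in> minimal_vectors leech_lattice" unfolding minimal_vectors_def by blast
    qed
  qed
  moreover have "sgn ((1 / sqrt 8) *\<^sub>R real_vec z) = (1 / sqrt 32) *\<^sub>R real_vec z" if "z \<in> min_ints" for z
  proof -
    have "sqrt 32 = 2 * sqrt 8" using real_sqrt_mult[of 4 8] by simp
    moreover have "norm ((1 / sqrt 8) *\<^sub>R real_vec z) = 2" using that unfolding norm by (simp add: min_ints_def)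
    ultimately show ?thesis by (simp add: sgn_div_norm)
  qed
  ultimately show ?thesis unfolding leech_code_def by (simp add: image_image)
qed

lemma leech_code_inner:
  assumes "x = (1 / sqrt 32) *\<^sub>R real_vec z" "y = (1 / sqrt 32) *\<^sub>R real_vec w"
  shows "x \<bullet> y = real_of_int (idot z w) / 32"
  using assms by (simp add: real_vec_inner)

lemma finite_leech_code: "finite leech_code"
  unfolding leech_code_eq using finite_min_ints by simp

lemma card_leech_code: "card leech_code \<ge> 196560"
proof -
  have "inj (\<lambda>z. (1 / sqrt 32) *\<^sub>R real_vec z)"
    using inj_real_vec by (auto simp: inj_def)
  then have "card leech_code = card min_ints"
    unfolding leech_code_eq by (intro card_image) (rule inj_on_subset, auto)
  then show ?thesis using card_min_ints by simp
qed

lemma leech_code_norm: "x \<in> leech_code \<Longrightarrow> x \<bullet> x = 1"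
  unfolding leech_code_eq min_ints_def by (auto simp: real_vec_inner)

lemma idot_diff: "idot (z - w) (z - w) = idot z z - 2 * idot z w + idot w w"
  "idot (z + w) (z + w) = idot z z + 2 * idot z w + idot w w"
  unfolding idot_def by (simp_all add: sum.distrib sum_subtractf sum_distrib_left algebra_simps)

lemma idot_uminus: "idot (- z) w = - idot z w" "idot z (- w) = - idot z w"
  unfolding idot_def by (simp_all add: sum_negf)

lemma leech_code_uminus: "x \<in> leech_code \<Longrightarrow> - x \<in> leech_code"
proof -
  assume "x \<in> leech_code"
  then obtain z where z: "leech_int z" "idot z z = 32" "x = (1 / sqrt 32) *\<^sub>R real_vec z"
    unfolding leech_code_eq min_ints_def by blast
  have "- x = (1 / sqrt 32) *\<^sub>R real_vec (- z)"
    unfolding z(3) by (simp add: real_vec_def vec_eq_iff)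
  moreover have "- z \<in> min_ints" using z leech_int_uminus by (simp add: min_ints_def idot_uminus)
  ultimately show ?thesis unfolding leech_code_eq by blast
qed

lemma leech_code_diff:
  assumes "x \<in> leech_code" "y \<in> leech_code" "x \<bullet> y = 1/2"
  shows "x - y \<in> leech_code"
proof -
  obtain z where z: "leech_int z" "idot z z = 32" "x = (1 / sqrt 32) *\<^sub>R real_vec z"
    using assms(1) unfolding leech_code_eq min_ints_def by blast
  obtain w where w: "leech_int w" "idot w w = 32" "y = (1 / sqrt 32) *\<^sub>R real_vec w"
    using assms(2) unfolding leech_code_eq min_ints_def by blast
  have "idot z w = 16" using assms(3) leech_code_inner[OF z(3) w(3)] by simp
  then have "z - w \<in> min_ints"
    using z w leech_int_diff by (simp add: min_ints_def idot_diff)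
  moreover have "x - y = (1 / sqrt 32) *\<^sub>R real_vec (z - w)"
    unfolding z(3) w(3) real_vec_diff by (simp add: scaleR_diff_right)
  ultimately show ?thesis unfolding leech_code_eq by blast
qed

text \<open>Divisibility by 8 makes inner products multiples of 1/4. The values 3/4 and -3/4 are
  excluded because x - y or x + y would be a nonzero vector shorter than the minimum.\<close>

lemma leech_code_inner_products:
  assumes "x \<in> leech_code" "y \<in> leech_code"
  shows "x \<bullet> y \<in> {-1, -1/2, -1/4, 0, 1/4, 1/2, 1}"
proof -
  obtain z where z: "leech_int z" "idot z z = 32" "x = (1 / sqrt 32) *\<^sub>R real_vec z"
    using assms(1) unfolding leech_code_eq min_ints_def by blast
  obtain w where w: "leech_int w" "idot w w = 32" "y = (1 / sqrt 32) *\<^sub>R real_vec w"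
    using assms(2) unfolding leech_code_eq min_ints_def by blast
  obtain k where k: "idot z w = 8 * k" using idot_dvd[OF z(1) w(1)] by (elim dvdE)
  have ge: "idot u u \<ge> 32 \<or> idot u u = 0" if "leech_int u" for u
    using idot_self_ge[OF that] by (cases "u = 0") (auto simp: idot_def)
  have "64 - 16 * k \<ge> 32 \<or> 64 - 16 * k = 0"
    using ge[OF leech_int_diff[OF z(1) w(1)]] z(2) w(2) k by (simp add: idot_diff)
  moreover have "64 + 16 * k \<ge> 32 \<or> 64 + 16 * k = 0"
    using ge[OF leech_int_diff[OF z(1) leech_int_uminus[OF w(1)]]] z(2) w(2) k by (simp add: idot_diff idot_uminus)
  ultimately have "k \<in> {-4, -2, -1, 0, 1, 2, 4}" by auto
  moreover have "x \<bullet> y = real_of_int k / 4" using leech_code_inner[OF z(3) w(3)] k by simp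
  ultimately show ?thesis by auto
qed

section \<open>Derived codes\<close>

lemma isometry_inner:
  assumes f: "linear f" and V: "subspace V" and n: "\<And>x. x \<in> V \<Longrightarrow> norm (f x) = norm x" and xy: "x \<in> V" "y \<in> V"
  shows "f x \<bullet> f y = x \<bullet> y"
proof -
  have "norm (f (x + y)) = norm (x + y)" using V xy by (intro n subspace_add)
  then have "norm (f x + f y)^2 = norm (x + y)^2" using f by (simp add: linear_add)
  then show ?thesis using n[OF xy(1)] n[OF xy(2)]
    by (simp add: dot_norm)
qed

lemma count_moments:
  assumes "finite S" "subspace V" "n > 0"
    and "\<And>x k. x \<in> V \<Longrightarrow> norm x = 1 \<Longrightarrow> k \<le> d \<Longrightarrow> (\<Sum>y\<in>S. (x \<bullet> y)^k) = card S * sphere_moment n k"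
  shows "moments (count_space S) V n d"
proof
  show "integrable (count_space S) (\<lambda>u. (x \<bullet> u) ^ i * (y \<bullet> u) ^ j * (z \<bullet> u) ^ l)" for x y z and i j l
    using assms(1) by (rule integrable_count_space)
  fix x k assume x: "x \<in> V" and k: "k \<le> d"
  have "(\<Sum>y\<in>S. (x \<bullet> y)^k) = card S * sphere_moment n k * norm x ^ k"
  proof (cases "x = 0")
    case True
    then show ?thesis by (cases k) simp_all
  next
    case False
    have sx: "sgn x \<in> V" "norm (sgn x) = 1"
      using False x assms(2) by (auto simp: norm_sgn sgn_div_norm subspace_scale)
    have "x = norm x *\<^sub>R sgn x" using False by (simp add: sgn_div_norm)
    then have "(\<Sum>y\<in>S. (x \<bullet> y)^k) = (\<Sum>y\<in>S. norm x ^ k * (sgn x \<bullet> y)^k)"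
      by (metis inner_scaleR_left power_mult_distrib)
    then show ?thesis using assms(4)[OF sx k] by (simp add: sum_distrib_left[symmetric])
  qed
  then show "(\<integral>u. (x \<bullet> u)^k \<partial>count_space S) = measure (count_space S) (space (count_space S)) * sphere_moment n k * norm x ^ k"
    using assms(1) by (simp add: lebesgue_integral_count_space_finite measure_count_space)
qed (use assms in auto)

lemma count_moments_sum:
  assumes "moments (count_space S) V n d" "finite S" "x \<in> V" "z \<in> V" "norm x = 1" "norm z = 1" "i + j \<le> d"
  shows "(\<Sum>y\<in>S. (x \<bullet> y)^i * (z \<bullet> y)^j) = card S * mixed_moment n (x \<bullet> z) i j"
  using moments.mixed_moment[OF assms(1,3,4,5,6,7)] assms(2)
  by (simp add: lebesgue_integral_count_space_finite measure_count_space)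

lemma count_moments_sum1:
  assumes "moments (count_space S) V n d" "finite S" "x \<in> V" "norm x = 1" "k \<le> d"
  shows "(\<Sum>y\<in>S. (x \<bullet> y)^k) = card S * sphere_moment n k"
  using count_moments_sum[OF assms(1,2,3,3,4,4), of 0 k] assms(5) by simp

lemma mixed_moment_odd: "odd (i + j) \<Longrightarrow> mixed_moment n t i j = 0"
proof (induction i arbitrary: j rule: less_induct)
  case (less i)
  show ?case
  proof (cases i)
    case 0
    then show ?thesis using less.prems by (simp add: sphere_moment_odd)
  next
    case (Suc k)
    have "k = 0 \<or> mixed_moment n t (k - 1) j = 0"
      using less.IH[of "k - 1" j] less.prems Suc by (cases k) auto
    moreover have "j = 0 \<or> mixed_moment n t k (j - 1) = 0"
      using less.IH[of k "j - 1"] less.prems Suc by (cases j) auto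
    ultimately show ?thesis by (auto simp: Suc)
  qed
qed

lemma mixed_moment_orthogonal_odd: "odd i \<Longrightarrow> mixed_moment n 0 i j = 0"
proof (induction i arbitrary: j rule: less_induct)
  case (less i)
  then obtain k where k: "i = Suc k" by (cases i) auto
  have "k = 0 \<or> mixed_moment n 0 (k - 1) j = 0"
    using less.IH[of "k - 1" j] less.prems k by (cases k) auto
  then show ?case by (auto simp: k)
qed

text \<open>The kissing code argument lives in \<open>real^24\<close>, since the sphere moments are
  established for well-ordered index types; an isometry carries the code there and the moments
  back.\<close>

lemma leech_moments: "moments (count_space leech_code) UNIV 24 11" and card_leech: "card leech_code = 196560"
proof -
  have d: "dim (UNIV :: vec24 set) = dim (UNIV :: (real^24) set)"
    by (simp add: card_coordinates)
  obtain f :: "vec24 \<Rightarrow> real^24" where f: "linear f" "\<And>x. norm (f x) = norm x"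
  proof (rule isometries_subspaces[OF subspace_UNIV subspace_UNIV d])
    fix f :: "vec24 \<Rightarrow> real^24"
    assume "linear f" "\<And>x. x \<in> UNIV \<Longrightarrow> norm (f x) = norm x"
    then show thesis using that by simp
  qed
  have f_inner: "f x \<bullet> f y = x \<bullet> y" for x y
    by (rule isometry_inner[OF f(1) subspace_UNIV]) (simp_all add: f(2))
  have inj: "inj f"
  proof -
    have "f x = 0 \<Longrightarrow> x = 0" for x using f(2)[of x] by simp
    then show ?thesis using linear_injective_0[OF f(1)] by blast
  qed
  have injL: "inj_on f leech_code" using inj by (rule inj_on_subset) simp
  interpret kissing_code "f ` leech_code"
  proof
    show "finite (f ` leech_code)" using finite_leech_code by simp
    show "norm x = 1" if "x \<in> f ` leech_code" for x
      using that leech_code_norm by (auto simp: f_inner norm_eq_1)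
    show "- x \<in> f ` leech_code" if x: "x \<in> f ` leech_code" for x
    proof -
      obtain y where y: "y \<in> leech_code" "x = f y" using x by (rule imageE)
      show ?thesis unfolding y(2) linear_neg[OF f(1), symmetric] using leech_code_uminus[OF y(1)] by (rule imageI)
    qed
    show "x \<bullet> y \<in> {-1, -1/2, -1/4, 0, 1/4, 1/2, 1}" if xy: "x \<in> f ` leech_code" "y \<in> f ` leech_code" for x y
    proof -
      obtain a b where "a \<in> leech_code" "x = f a" "b \<in> leech_code" "y = f b" using xy by blast
      then show ?thesis using leech_code_inner_products[of a b] by (simp only: f_inner)
    qed
    show "196560 \<le> card (f ` leech_code)"
      using card_leech_code injL by (simp add: card_image)
  qed
  show c: "card leech_code = 196560" using zonal_sums(1) injL by (simp add: card_image)
  show "moments (count_space leech_code) UNIV 24 11"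
  proof (rule count_moments[OF finite_leech_code subspace_UNIV])
    fix x :: vec24 and k :: nat assume x: "norm x = 1" "k \<le> 11"
    have "(\<Sum>y\<in>leech_code. (x \<bullet> y)^k) = (\<Sum>y\<in>f ` leech_code. (f x \<bullet> y)^k)"
      by (subst sum.reindex[OF injL]) (simp add: f_inner)
    also have "\<dots> = card leech_code * sphere_moment 24 k"
      using count_moments_sum1[OF moments finite UNIV_I, of "f x" k] x injL by (simp add: f(2) card_image)
    finally show "(\<Sum>y\<in>leech_code. (x \<bullet> y)^k) = card leech_code * sphere_moment 24 k" .
  qed simp
qed

section \<open>The layer at inner product 1/2 and its 7-design\<close>

definition half_layer :: "vec24 \<Rightarrow> vec24 set" where
  "half_layer x = {y \<in> leech_code. x \<bullet> y = 1/2}"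

lemma C_half_eq: "C_half x = (\<lambda>y. (2 / sqrt 3) *\<^sub>R (y - (1/2) *\<^sub>R x)) ` half_layer x"
proof -
  have "sqrt (1 - 1/4) = sqrt 3 / 2"
    using real_sqrt_divide[of 3 4] by simp
  then have c: "1 / sqrt (1 - 1/4) = 2 / sqrt (3::real)" by (simp only:) simp
  show ?thesis unfolding C_half_def half_layer_def c by (rule setcompr_eq_image)
qed

lemma leech_layers:
  assumes x: "x \<in> leech_code" and y: "y \<in> leech_code"
  shows "x \<bullet> y \<in> {-1/2, -1/4, 0, 1/4, 1/2} \<or> y = x \<or> y = - x"
proof -
  have xx: "x \<bullet> x = 1" "y \<bullet> y = 1" using leech_code_norm x y by auto
  have "y = x" if "x \<bullet> y = 1"
  proof -
    have "(x - y) \<bullet> (x - y) = 0" using xx that by (simp add: inner_diff inner_commute)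
    then show ?thesis by simp
  qed
  moreover have "y = - x" if "x \<bullet> y = -1"
  proof -
    have "(x + y) \<bullet> (x + y) = 0" using xx that by (simp add: inner_add inner_commute)
    then show ?thesis by (simp add: add_eq_0_iff)
  qed
  ultimately show ?thesis using leech_code_inner_products[OF x y] by auto
qed

lemma finite_half_layer: "finite (half_layer x)"
  using finite_leech_code by (simp add: half_layer_def)

text \<open>The polynomial \<open>q\<close> vanishes on all layers around \<open>x\<close> except \<open>1/2\<close> (and possibly \<open>x\<close> and \<open>- x\<close>,
  where \<open>g\<close> takes over).\<close>

lemma half_layer_sum:
  fixes q :: "real \<Rightarrow> real" and g :: "vec24 \<Rightarrow> real"
  assumes x: "x \<in> leech_code"
    and q: "q (-1/2) = 0" "q (-1/4) = 0" "q 0 = 0" "q (1/4) = 0"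
    and g: "q 1 * g x = 0" "q (-1) * g (- x) = 0"
  shows "(\<Sum>y\<in>leech_code. q (x \<bullet> y) * g y) = q (1/2) * (\<Sum>y\<in>half_layer x. g y)"
proof -
  have xx: "x \<bullet> x = 1" by (rule leech_code_norm[OF x])
  have "(\<Sum>y\<in>leech_code. q (x \<bullet> y) * g y) = (\<Sum>y\<in>half_layer x. q (x \<bullet> y) * g y)"
  proof (rule sum.mono_neutral_right[OF finite_leech_code])
    show "half_layer x \<subseteq> leech_code" by (auto simp: half_layer_def)
    show "\<forall>y\<in>leech_code - half_layer x. q (x \<bullet> y) * g y = 0"
    proof
      fix y assume y: "y \<in> leech_code - half_layer x"
      then have "x \<bullet> y \<in> {-1/2, -1/4, 0, 1/4} \<or> y = x \<or> y = - x"
        using leech_layers[OF x, of y] unfolding half_layer_def by auto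
      moreover have "q (x \<bullet> y) = 0" if "x \<bullet> y \<in> {-1/2, -1/4, 0, 1/4}"
        using that q by (elim insertE emptyE) (simp_all only:)
      ultimately show "q (x \<bullet> y) * g y = 0"
        using g xx by auto
    qed
  qed
  also have "\<dots> = (\<Sum>y\<in>half_layer x. q (1/2) * g y)"
  proof (rule sum.cong[OF refl])
    fix y assume "y \<in> half_layer x"
    then have "x \<bullet> y = 1/2" by (simp add: half_layer_def)
    then show "q (x \<bullet> y) * g y = q (1/2) * g y" by (simp only:)
  qed
  finally show ?thesis by (simp add: sum_distrib_left)
qed

lemma mixed_moment_24_orthogonal:
  "mixed_moment 24 0 2 2 = 1/624" "mixed_moment 24 0 4 2 = 1/5824"
  "mixed_moment 24 0 2 4 = 1/5824" "mixed_moment 24 0 4 4 = 1/58240"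
  "mixed_moment 24 0 2 6 = 1/34944" "mixed_moment 24 0 4 6 = 1/372736"
  by (simp_all add: mixed_moment_24_2 mixed_moment_24_4)

lemma card_half_layer:
  assumes x: "x \<in> leech_code"
  shows "card (half_layer x) = 4600"
proof -
  have n: "norm x = 1" using leech_code_norm[OF x] by (simp add: norm_eq_1)
  \<comment> \<open>This is s (s + 1/2) (s^2 - 1/16) (s^2 - 1). The last factor removes x and -x,
    because the constant weight does not vanish there.\<close>
  let ?q = "\<lambda>s::real. s^6 + (1/2) * s^5 - (17/16) * s^4 - (17/32) * s^3 + (1/16) * s^2 + (1/32) * s"
  note m = count_moments_sum1[OF leech_moments finite_leech_code UNIV_I n]
  have q: "?q (-1/2) = 0" "?q (-1/4) = 0" "?q 0 = 0" "?q (1/4) = 0" "?q 1 = 0" "?q (-1) = 0" "?q (1/2) = -9/128"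
    by (simp_all add: power_numeral_even power_numeral_odd power2_eq_square)
  have "(\<Sum>y\<in>leech_code. ?q (x \<bullet> y) * 1) = ?q (1/2) * (\<Sum>y\<in>half_layer x. 1)"
    by (rule half_layer_sum[OF x]) (use q in simp_all)
  also have "\<dots> = -9/128 * card (half_layer x)" unfolding q by simp
  also have "(\<Sum>y\<in>leech_code. ?q (x \<bullet> y) * 1) =
     (\<Sum>y\<in>leech_code. (x \<bullet> y)^6) + (1/2) * (\<Sum>y\<in>leech_code. (x \<bullet> y)^5) - (17/16) * (\<Sum>y\<in>leech_code. (x \<bullet> y)^4)
     - (17/32) * (\<Sum>y\<in>leech_code. (x \<bullet> y)^3) + (1/16) * (\<Sum>y\<in>leech_code. (x \<bullet> y)^2) + (1/32) * (\<Sum>y\<in>leech_code. (x \<bullet> y)^1)"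
    by (simp only: sum.distrib sum_subtractf sum_distrib_left mult_1_right power_one_right)
  also have "\<dots> = 196560 * (5/5824 - (17/16) * (1/208) + (1/16) * (1/24))"
    by (subst (1 2 3 4 5 6) m) (simp_all add: card_leech sphere_moment_24 sphere_moment_odd)
  finally show ?thesis by simp
qed

text \<open>After projection orthogonal to x this is the antipodal map: (x - y) - x/2 = -(y -
  x/2).\<close>

lemma half_layer_reflect:
  assumes "x \<in> leech_code"
  shows "bij_betw (\<lambda>y. x - y) (half_layer x) (half_layer x)"
proof (rule bij_betw_byWitness[of _ "\<lambda>y. x - y"])
  have xx: "x \<bullet> x = 1" by (rule leech_code_norm[OF assms])
  show "(\<lambda>y. x - y) ` half_layer x \<subseteq> half_layer x"
    using leech_code_diff[OF assms] xx by (auto simp: half_layer_def inner_diff_right)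
  then show "(\<lambda>y. x - y) ` half_layer x \<subseteq> half_layer x" .
qed auto

text \<open>The isolating polynomial has degree 4, so the moments of the 11-design suffice. The
  factor 3/4 is the squared length of y - x/2, the part of y orthogonal to x.\<close>

lemma half_layer_moment:
  assumes x: "x \<in> leech_code" and v: "v \<bullet> x = 0" "norm v = 1" and k: "k \<in> {2, 4, 6}"
  shows "(\<Sum>y\<in>half_layer x. (v \<bullet> y)^k) = 4600 * (3/4)^(k div 2) * sphere_moment 23 k"
proof -
  have n: "norm x = 1" using leech_code_norm[OF x] by (simp add: norm_eq_1)
  have xv: "x \<bullet> v = 0" using v(1) by (simp add: inner_commute)
  \<comment> \<open>This is s (s + 1/2) (s^2 - 1/16). The points x and -x drop out because v is
    orthogonal to x and k is positive.\<close>
  let ?q = "\<lambda>s::real. s^4 + (1/2) * s^3 - (1/16) * s^2 - (1/32) * s^1"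
  have m: "(\<Sum>y\<in>leech_code. (x \<bullet> y)^i * (v \<bullet> y)^k) = 196560 * mixed_moment 24 0 i k" if "i \<le> 4" for i
    using count_moments_sum[OF leech_moments finite_leech_code UNIV_I UNIV_I n v(2), of i k] that k xv
    by (auto simp: card_leech)
  have q: "?q (-1/2) = 0" "?q (-1/4) = 0" "?q 0 = 0" "?q (1/4) = 0" "?q (1/2) = 3/32"
    by (simp_all add: power_numeral_even power_numeral_odd power2_eq_square)
  have "(\<Sum>y\<in>leech_code. ?q (x \<bullet> y) * (v \<bullet> y)^k) = ?q (1/2) * (\<Sum>y\<in>half_layer x. (v \<bullet> y)^k)"
    by (rule half_layer_sum[OF x]) (use q k v(1) in auto)
  also have "\<dots> = 3/32 * (\<Sum>y\<in>half_layer x. (v \<bullet> y)^k)" unfolding q by simp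
  also have "(\<Sum>y\<in>leech_code. ?q (x \<bullet> y) * (v \<bullet> y)^k) =
      (\<Sum>y\<in>leech_code. (x \<bullet> y)^4 * (v \<bullet> y)^k) + (1/2) * (\<Sum>y\<in>leech_code. (x \<bullet> y)^3 * (v \<bullet> y)^k)
      - (1/16) * (\<Sum>y\<in>leech_code. (x \<bullet> y)^2 * (v \<bullet> y)^k) - (1/32) * (\<Sum>y\<in>leech_code. (x \<bullet> y)^1 * (v \<bullet> y)^k)"
    by (simp only: distrib_right left_diff_distrib mult.assoc sum.distrib sum_subtractf sum_distrib_left)
  also have "\<dots> = 196560 * (mixed_moment 24 0 4 k - (1/16) * mixed_moment 24 0 2 k)"
    using k by (subst (1 2 3 4) m) (auto simp: mixed_moment_odd simp del: mixed_moment.simps)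
  finally have "(\<Sum>y\<in>half_layer x. (v \<bullet> y)^k) = 32/3 * (196560 * (mixed_moment 24 0 4 k - (1/16) * mixed_moment 24 0 2 k))"
    by simp
  moreover have "sphere_moment 23 2 = 1/23" "sphere_moment 23 4 = 3/575" "sphere_moment 23 6 = 15/15525"
    by (simp_all add: eval_nat_numeral)
  ultimately show ?thesis
    using k by (auto simp: mixed_moment_24_orthogonal power2_eq_square power3_eq_cube simp del: mixed_moment.simps sphere_moment.simps)
qed

lemma C_half_moments:
  assumes x: "x \<in> leech_code"
  shows "finite (C_half x)" "card (C_half x) = 4600" "moments (count_space (C_half x)) {v. v \<bullet> x = 0} 23 7"
proof -
  let ?f = "\<lambda>y. (2 / sqrt 3) *\<^sub>R (y - (1/2) *\<^sub>R x)"
  have inj: "inj_on ?f (half_layer x)" by (rule inj_onI) simp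
  show fin: "finite (C_half x)" unfolding C_half_eq using finite_half_layer by simp
  show card: "card (C_half x) = 4600" unfolding C_half_eq using inj card_half_layer[OF x] by (simp add: card_image)
  show "moments (count_space (C_half x)) {v. v \<bullet> x = 0} 23 7"
  proof (rule count_moments[OF fin])
    show "subspace {v. v \<bullet> x = 0}" by (simp add: subspace_def inner_add_left)
    fix v :: vec24 and k :: nat assume v: "v \<in> {v. v \<bullet> x = 0}" "norm v = 1" and k: "k \<le> 7"
    have "(\<Sum>y\<in>C_half x. (v \<bullet> y)^k) = (\<Sum>y\<in>half_layer x. (2 / sqrt 3)^k * (v \<bullet> y)^k)"
      unfolding C_half_eq using v by (subst sum.reindex[OF inj]) (simp add: inner_diff_right power_mult_distrib[symmetric])
    also have "\<dots> = (2 / sqrt 3)^k * (\<Sum>y\<in>half_layer x. (v \<bullet> y)^k)" by (simp add: sum_distrib_left)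
    also have "\<dots> = 4600 * sphere_moment 23 k"
    proof (cases "even k")
      case True
      have pow: "(2 / sqrt 3)^k = (4/3)^(k div 2)"
      proof -
        have "(2 / sqrt 3)^k = ((2 / sqrt 3)^2)^(k div 2)" using True by (simp flip: power_mult)
        then show ?thesis by (simp add: power_divide)
      qed
      have "k \<in> {0, 2, 4, 6}" using True k by (auto elim!: evenE)
      then consider "k = 0" | "k \<in> {2, 4, 6}" by auto
      then show ?thesis
      proof cases
        case 1
        then show ?thesis using card_half_layer[OF x] by simp
      next
        case 2
        then show ?thesis using half_layer_moment[OF x _ v(2) 2] v(1) unfolding pow
          by (simp add: power_mult_distrib[symmetric])
      qed
    next
      case False
      have "(\<Sum>y\<in>half_layer x. (v \<bullet> y)^k) = (\<Sum>y\<in>half_layer x. (v \<bullet> (x - y))^k)"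
        by (rule sum.reindex_bij_betw[OF half_layer_reflect[OF x], symmetric])
      also have "\<dots> = - (\<Sum>y\<in>half_layer x. (v \<bullet> y)^k)"
        using v False by (simp add: inner_diff_right sum_negf)
      finally show ?thesis using False by (simp add: sphere_moment_odd)
    qed
    finally show "(\<Sum>y\<in>C_half x. (v \<bullet> y)^k) = card (C_half x) * sphere_moment 23 k" using card by simp
  qed simp
qed

text \<open>Both y . z and (x - y) . z = 1/2 - y . z are inner products of the Leech code, which
  excludes -1 and -1/4.\<close>

lemma half_layer_inner:
  assumes "x \<in> leech_code" "y \<in> half_layer x" "z \<in> half_layer x"
  shows "y \<bullet> z \<in> {-1/2, 0, 1/4, 1/2, 1}"
proof -
  have L: "y \<in> leech_code" "z \<in> leech_code" "x \<bullet> y = 1/2" "x \<bullet> z = 1/2"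
    using assms by (auto simp: half_layer_def)
  have "x - y \<in> leech_code" by (rule leech_code_diff[OF assms(1) L(1,3)])
  then have "(x - y) \<bullet> z \<in> {-1, -1/2, -1/4, 0, 1/4, 1/2, 1}" using leech_code_inner_products L(2) by blast
  moreover have "(x - y) \<bullet> z = 1/2 - y \<bullet> z" using L by (simp add: inner_diff_left)
  ultimately show ?thesis using leech_code_inner_products[OF L(1,2)] by auto
qed

lemma C_half_inner:
  assumes x: "x \<in> leech_code" and "c \<in> C_half x" "d \<in> C_half x"
  shows "c \<bullet> d \<in> {-1, -1/3, 0, 1/3, 1}" "c \<bullet> x = 0" "c \<bullet> c = 1"
proof -
  have xx: "x \<bullet> x = 1" by (rule leech_code_norm[OF x])
  have e: "((2 / sqrt 3) *\<^sub>R (y - (1/2) *\<^sub>R x)) \<bullet> ((2 / sqrt 3) *\<^sub>R (z - (1/2) *\<^sub>R x)) = (4 * (y \<bullet> z) - 1) / 3"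
    if "y \<in> half_layer x" "z \<in> half_layer x" for y z
    using that xx by (simp add: half_layer_def inner_diff inner_commute field_simps)
  obtain y z where yz: "y \<in> half_layer x" "z \<in> half_layer x"
    "c = (2 / sqrt 3) *\<^sub>R (y - (1/2) *\<^sub>R x)" "d = (2 / sqrt 3) *\<^sub>R (z - (1/2) *\<^sub>R x)"
    using assms(2,3) unfolding C_half_eq by blast
  have yy: "y \<bullet> y = 1" using yz(1) leech_code_norm by (simp add: half_layer_def)
  show "c \<bullet> d \<in> {-1, -1/3, 0, 1/3, 1}"
    using half_layer_inner[OF x yz(1,2)] unfolding yz(3,4) e[OF yz(1,2)] by auto
  show "c \<bullet> c = 1" unfolding yz(3) e[OF yz(1,1)] yy by simp
  show "c \<bullet> x = 0" unfolding yz(3) using yz(1) xx by (simp add: half_layer_def inner_diff inner_commute)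
qed

section \<open>Points seeing the 7-design at four inner products, and their layers\<close>

abbreviation node_inner :: real where "node_inner \<equiv> sqrt 5 / 15"
abbreviation node_outer :: real where "node_outer \<equiv> sqrt 5 / 5"

text \<open>This is all that is used about a minimum of the potential; the multiplicity 2025 is
  recovered from the design property.\<close>

definition deep_hole :: "vec24 \<Rightarrow> vec24 \<Rightarrow> bool" where
  "deep_hole x w \<longleftrightarrow> norm w = 1 \<and> w \<bullet> x = 0 \<and>
     (\<forall>c\<in>C_half x. w \<bullet> c \<in> {- node_outer, - node_inner, node_inner, node_outer})"

lemma quarter_neighbour:
  assumes x: "x \<in> leech_code"
  shows "\<exists>z\<in>leech_code. x \<bullet> z = 1/4"
proof (rule ccontr)
  assume no: "\<not> (\<exists>z\<in>leech_code. x \<bullet> z = 1/4)"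
  have xx: "x \<bullet> x = 1" by (rule leech_code_norm[OF x])
  have n: "norm x = 1" using xx by (simp add: norm_eq_1)
  \<comment> \<open>This is s (s + 1/4) (s^2 - 1/4) (s^2 - 1), which vanishes at every possible
    inner product except 1/4, while its moment sum is not zero.\<close>
  let ?q = "\<lambda>s::real. s^6 + (1/4) * s^5 - (5/4) * s^4 - (5/16) * s^3 + (1/4) * s^2 + (1/16) * s"
  have q: "?q (-1/2) = 0" "?q (-1/4) = 0" "?q 0 = 0" "?q (1/2) = 0" "?q 1 = 0" "?q (-1) = 0"
    by (simp_all add: power_numeral_even power_numeral_odd power2_eq_square)
  note m = count_moments_sum1[OF leech_moments finite_leech_code UNIV_I n]
  have "(\<Sum>y\<in>leech_code. ?q (x \<bullet> y)) = 0"
  proof (rule sum.neutral, rule ballI)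
    fix y assume y: "y \<in> leech_code"
    then have "x \<bullet> y \<noteq> 1/4" using no by blast
    then have "x \<bullet> y \<in> {-1, -1/2, -1/4, 0, 1/2, 1}" using leech_code_inner_products[OF x y] by auto
    then show "?q (x \<bullet> y) = 0" using q by (elim insertE emptyE) (simp_all only:)
  qed
  moreover have "(\<Sum>y\<in>leech_code. ?q (x \<bullet> y)) =
     (\<Sum>y\<in>leech_code. (x \<bullet> y)^6) + (1/4) * (\<Sum>y\<in>leech_code. (x \<bullet> y)^5) - (5/4) * (\<Sum>y\<in>leech_code. (x \<bullet> y)^4)
     - (5/16) * (\<Sum>y\<in>leech_code. (x \<bullet> y)^3) + (1/4) * (\<Sum>y\<in>leech_code. (x \<bullet> y)^2) + (1/16) * (\<Sum>y\<in>leech_code. (x \<bullet> y)^1)"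
    by (simp only: sum.distrib sum_subtractf sum_distrib_left power_one_right)
  moreover have "\<dots> = 196560 * (5/5824 - (5/4) * (1/208) + (1/4) * (1/24))"
    by (subst (1 2 3 4 5 6) m) (simp_all add: card_leech sphere_moment_24 sphere_moment_odd)
  ultimately show False by simp
qed

text \<open>The witness is the normalized projection z - x/4 of a neighbour z at inner product 1/4.
  For y in the half layer both z . y and z . (x - y) = 1/4 - z . y are admissible, which leaves
  -1/4, 0, 1/4, 1/2 for z . y; these become the four nodes.\<close>

lemma deep_hole_exists:
  assumes x: "x \<in> leech_code"
  shows "\<exists>w. deep_hole x w"
proof -
  obtain z where z: "z \<in> leech_code" "x \<bullet> z = 1/4" using quarter_neighbour[OF x] by blast
  have xx: "x \<bullet> x = 1" "z \<bullet> z = 1" using leech_code_norm x z by auto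
  define w where "w = (1 / sqrt 15) *\<^sub>R (4 *\<^sub>R z - x)"
  have "w \<bullet> w = 1" using xx z(2) by (simp add: w_def inner_diff inner_commute)
  moreover have "w \<bullet> x = 0" using xx z(2) by (simp add: w_def inner_diff inner_commute)
  moreover have "w \<bullet> c \<in> {- node_outer, - node_inner, node_inner, node_outer}" if c: "c \<in> C_half x" for c
  proof -
    obtain y where y: "y \<in> half_layer x" "c = (2 / sqrt 3) *\<^sub>R (y - (1/2) *\<^sub>R x)"
      using c unfolding C_half_eq by blast
    have yL: "y \<in> leech_code" "x \<bullet> y = 1/2" using y(1) by (auto simp: half_layer_def)
    have "x - y \<in> leech_code" by (rule leech_code_diff[OF x yL])
    then have "z \<bullet> (x - y) \<in> {-1, -1/2, -1/4, 0, 1/4, 1/2, 1}" using leech_code_inner_products z(1) by blast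
    moreover have "z \<bullet> (x - y) = 1/4 - z \<bullet> y" using z(2) by (simp add: inner_diff_right inner_commute)
    ultimately have zy: "z \<bullet> y \<in> {-1/4, 0, 1/4, 1/2}"
      using leech_code_inner_products[OF z(1) yL(1)] by auto
    have s: "sqrt 15 * sqrt 3 = 3 * sqrt 5"
    proof -
      have "sqrt 15 = sqrt 3 * sqrt 5" using real_sqrt_mult[of 3 5] by simp
      then show ?thesis by simp
    qed
    have "w \<bullet> c = (1 / sqrt 15) * (2 / sqrt 3) * (4 * (z \<bullet> y) - 1/2)"
    proof -
      have "(4 *\<^sub>R z - x) \<bullet> (y - (1/2) *\<^sub>R x) = 4 * (z \<bullet> y) - 1/2"
        using xx z(2) yL(2) by (simp add: inner_diff inner_commute)
      then show ?thesis unfolding w_def y(2) by (simp only: inner_scaleR_left inner_scaleR_right) simp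
    qed
    also have "\<dots> = 2 / (sqrt 15 * sqrt 3) * (4 * (z \<bullet> y) - 1/2)" by simp
    also have "\<dots> = 2 / (3 * sqrt 5) * (4 * (z \<bullet> y) - 1/2)" unfolding s ..
    also have "\<dots> = 2 * sqrt 5 / 15 * (4 * (z \<bullet> y) - 1/2)"
      by (simp add: field_simps)
    finally have wc: "w \<bullet> c = 2 * sqrt 5 / 15 * (4 * (z \<bullet> y) - 1/2)" .
    show ?thesis using zy unfolding wc by (elim insertE emptyE) (simp_all only:, simp_all)
  qed
  ultimately show ?thesis unfolding deep_hole_def by (auto simp: norm_eq_1)
qed

definition inner_layer :: "vec24 \<Rightarrow> vec24 \<Rightarrow> vec24 set" where
  "inner_layer x w = {c \<in> C_half x. c \<bullet> w = node_inner}"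

text \<open>The cubic (s + \<open>node_inner\<close>) (s^2 - 1/5) isolates the layer and spends
  three of the seven degrees. As v is orthogonal to w, odd powers of w . c average out and a factor
  \<open>node_inner\<close> cancels; 12937.5 is 4600 * 45/16.\<close>

lemma deep_hole_layer_sum:
  assumes x: "x \<in> leech_code" and w: "deep_hole x w" and v: "v \<bullet> x = 0" "v \<bullet> w = 0" "norm v = 1" and k: "k \<le> 4"
  shows "(\<Sum>c\<in>inner_layer x w. (v \<bullet> c)^k) = 12937.5 * (mixed_moment 23 0 0 k / 5 - mixed_moment 23 0 2 k)"
proof -
  note C = C_half_moments[OF x]
  have wv: "w \<in> {v. v \<bullet> x = 0}" "v \<in> {v. v \<bullet> x = 0}" "norm w = 1" "w \<bullet> v = 0"
    using w v by (auto simp: deep_hole_def inner_commute)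
  let ?\<alpha> = "node_inner"
  let ?q = "\<lambda>s::real. s^3 + ?\<alpha> * s^2 - (1/5) * s^1 - (?\<alpha>/5) * s^0"
  have fact: "?q s = (s + ?\<alpha>) * (s^2 - 1/5)" for s
    by (simp add: field_simps power3_eq_cube power2_eq_square)
  have q0: "?q (- node_outer) = 0" "?q node_outer = 0" "?q (- ?\<alpha>) = 0" "?q ?\<alpha> = - (16/45) * ?\<alpha>"
    unfolding fact by (simp_all add: power_divide)
  have m: "(\<Sum>c\<in>C_half x. (w \<bullet> c)^i * (v \<bullet> c)^k) = 4600 * mixed_moment 23 0 i k" if "i \<le> 3" for i
    using count_moments_sum[OF C(3,1) wv(1,2,3) v(3), of i k] that k wv(4) C(2) by simp
  have "(\<Sum>c\<in>C_half x. ?q (w \<bullet> c) * (v \<bullet> c)^k) = (\<Sum>c\<in>inner_layer x w. ?q (w \<bullet> c) * (v \<bullet> c)^k)"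
  proof (rule sum.mono_neutral_right[OF C(1)])
    show "inner_layer x w \<subseteq> C_half x" by (auto simp: inner_layer_def)
    show "\<forall>c\<in>C_half x - inner_layer x w. ?q (w \<bullet> c) * (v \<bullet> c)^k = 0"
    proof
      fix c assume c: "c \<in> C_half x - inner_layer x w"
      then have "w \<bullet> c \<noteq> ?\<alpha>" by (simp add: inner_layer_def inner_commute)
      then have "w \<bullet> c \<in> {- node_outer, - ?\<alpha>, node_outer}"
        using w c unfolding deep_hole_def by blast
      then have "?q (w \<bullet> c) = 0" using q0 by (elim insertE emptyE) (simp_all only:)
      then show "?q (w \<bullet> c) * (v \<bullet> c)^k = 0" by simp
    qed
  qed
  also have "\<dots> = (\<Sum>c\<in>inner_layer x w. ?q ?\<alpha> * (v \<bullet> c)^k)"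
  proof (rule sum.cong[OF refl])
    fix c assume "c \<in> inner_layer x w"
    then have "w \<bullet> c = ?\<alpha>" by (simp add: inner_layer_def inner_commute)
    then show "?q (w \<bullet> c) * (v \<bullet> c)^k = ?q ?\<alpha> * (v \<bullet> c)^k" by (simp only:)
  qed
  also have "\<dots> = - (16/45) * ?\<alpha> * (\<Sum>c\<in>inner_layer x w. (v \<bullet> c)^k)"
    unfolding q0(4) by (simp only: sum_distrib_left)
  also have "(\<Sum>c\<in>C_half x. ?q (w \<bullet> c) * (v \<bullet> c)^k) =
      (\<Sum>c\<in>C_half x. (w \<bullet> c)^3 * (v \<bullet> c)^k) + ?\<alpha> * (\<Sum>c\<in>C_half x. (w \<bullet> c)^2 * (v \<bullet> c)^k)
      - (1/5) * (\<Sum>c\<in>C_half x. (w \<bullet> c)^1 * (v \<bullet> c)^k) - (?\<alpha>/5) * (\<Sum>c\<in>C_half x. (w \<bullet> c)^0 * (v \<bullet> c)^k)"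
    by (simp only: distrib_right left_diff_distrib mult.assoc sum.distrib sum_subtractf sum_distrib_left)
  also have "\<dots> = ?\<alpha> * (4600 * (mixed_moment 23 0 2 k - mixed_moment 23 0 0 k / 5))"
    by (subst (1 2 3 4) m) (simp_all add: mixed_moment_orthogonal_odd algebra_simps del: mixed_moment.simps)
  finally have "?\<alpha> * (4600 * (mixed_moment 23 0 2 k - mixed_moment 23 0 0 k / 5)) =
     ?\<alpha> * (- (16/45) * (\<Sum>c\<in>inner_layer x w. (v \<bullet> c)^k))"
    by (simp only: mult_ac)
  then have "4600 * (mixed_moment 23 0 2 k - mixed_moment 23 0 0 k / 5) = - (16/45) * (\<Sum>c\<in>inner_layer x w. (v \<bullet> c)^k)"
    by (simp only: mult_cancel_left) simp
  then show ?thesis by (simp add: field_simps)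
qed

lemma C2025_eq: "C2025 x w = (\<lambda>y. (1 / sqrt (44/45)) *\<^sub>R (y - node_inner *\<^sub>R w)) ` inner_layer x w"
proof -
  have "1 - (sqrt 5 / 15)\<^sup>2 = (44/45 :: real)" by (simp add: power_divide)
  then show ?thesis unfolding C2025_def Let_def inner_layer_def by (simp only: setcompr_eq_image)
qed

text \<open>Projecting along w maps an inner product s of the layer to (45 s - 1) / 44, so -1/3, 0,
  1/3 become the three listed values.\<close>

lemma C2025_properties:
  assumes x: "x \<in> leech_code" and w: "deep_hole x w"
  shows "finite (C2025 x w)"
    and "c \<in> C2025 x w \<Longrightarrow> c \<bullet> x = 0 \<and> c \<bullet> w = 0 \<and> norm c = 1"
    and "c \<in> C2025 x w \<Longrightarrow> d \<in> C2025 x w \<Longrightarrow> c \<noteq> d \<Longrightarrow> c \<bullet> d \<in> {-4/11, -1/44, 7/22}"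
    and "\<exists>v. v \<bullet> x = 0 \<and> v \<bullet> w = 0 \<and> norm v = 1 \<Longrightarrow> card (C2025 x w) = 2025"
    and "v \<bullet> x = 0 \<Longrightarrow> v \<bullet> w = 0 \<Longrightarrow> norm v = 1 \<Longrightarrow> k \<le> 4 \<Longrightarrow>
      (\<Sum>c\<in>C2025 x w. (v \<bullet> c)^k) = 2025 * sphere_moment 22 k"
proof -
  let ?f = "\<lambda>y. (1 / sqrt (44/45)) *\<^sub>R (y - node_inner *\<^sub>R w)"
  have inj: "inj_on ?f (inner_layer x w)" by (rule inj_onI) simp
  have ww: "w \<bullet> w = 1" "w \<bullet> x = 0" using w by (auto simp: deep_hole_def norm_eq_1)
  have fin: "finite (inner_layer x w)" using C_half_moments(1)[OF x] by (simp add: inner_layer_def)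
  then show "finite (C2025 x w)" unfolding C2025_eq by simp
  have L: "y \<in> C_half x" "y \<bullet> w = node_inner" "y \<bullet> x = 0" "y \<bullet> y = 1" if "y \<in> inner_layer x w" for y
    using that C_half_inner[OF x, of y y] by (auto simp: inner_layer_def)
  have inner: "?f y \<bullet> ?f z = (45 * (y \<bullet> z) - 1) / 44" if "y \<in> inner_layer x w" "z \<in> inner_layer x w" for y z
  proof -
    have "w \<bullet> z = node_inner" using L(2)[OF that(2)] by (simp only: inner_commute)
    then have "(y - node_inner *\<^sub>R w) \<bullet> (z - node_inner *\<^sub>R w) = y \<bullet> z - node_inner * node_inner"
      using L(2)[OF that(1)] ww(1)
      by (simp only: inner_diff_left inner_diff_right inner_scaleR_left inner_scaleR_right) simp
    also have "node_inner * node_inner = 1/45" by (simp add: field_simps)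
    finally have "(y - node_inner *\<^sub>R w) \<bullet> (z - node_inner *\<^sub>R w) = y \<bullet> z - 1/45" .
    moreover have "(1 / sqrt (44/45)) * (1 / sqrt (44/45)) = (45/44 :: real)" by simp
    ultimately show ?thesis
      by (simp only: inner_scaleR_left inner_scaleR_right mult.assoc[symmetric]) (simp add: field_simps)
  qed
  show "c \<in> C2025 x w \<Longrightarrow> c \<bullet> x = 0 \<and> c \<bullet> w = 0 \<and> norm c = 1"
  proof -
    assume "c \<in> C2025 x w"
    then obtain y where y: "y \<in> inner_layer x w" "c = ?f y" unfolding C2025_eq by blast
    have "c \<bullet> c = 1" unfolding y(2) inner[OF y(1,1)] L(4)[OF y(1)] by simp
    then have "norm c = 1" by (simp only: norm_eq_1)
    moreover have "c \<bullet> x = 0" "c \<bullet> w = 0" using L(2,3)[OF y(1)] ww unfolding y(2) by (simp_all add: inner_diff_left)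
    ultimately show ?thesis by blast
  qed
  show "c \<bullet> d \<in> {-4/11, -1/44, 7/22}" if cd: "c \<in> C2025 x w" "d \<in> C2025 x w" "c \<noteq> d"
  proof -
    obtain y where y: "y \<in> inner_layer x w" "c = ?f y" using cd(1) unfolding C2025_eq by blast
    obtain z where z: "z \<in> inner_layer x w" "d = ?f z" using cd(2) unfolding C2025_eq by blast
    have yz: "y \<bullet> z \<in> {-1, -1/3, 0, 1/3, 1}" using C_half_inner(1)[OF x L(1)[OF y(1)] L(1)[OF z(1)]] .
    have "y \<bullet> z \<noteq> 1"
    proof
      assume "y \<bullet> z = 1"
      then have "(y - z) \<bullet> (y - z) = 0"
        using L(4)[OF y(1)] L(4)[OF z(1)] by (simp add: inner_diff inner_commute)
      then show False using cd(3) y(2) z(2) by simp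
    qed
    \<comment> \<open>Antipodal points cannot both have the positive inner product
      \<open>node_inner\<close> with w.\<close>
    moreover have "y \<bullet> z \<noteq> -1"
    proof
      assume "y \<bullet> z = -1"
      then have "(y + z) \<bullet> (y + z) = 0"
        using L(4)[OF y(1)] L(4)[OF z(1)] by (simp add: inner_add inner_commute)
      then have "y + z = 0" by simp
      then have "y \<bullet> w + z \<bullet> w = 0" by (metis inner_add_left inner_zero_left)
      then show False using L(2)[OF y(1)] L(2)[OF z(1)] by simp
    qed
    ultimately have "y \<bullet> z \<in> {-1/3, 0, 1/3}" using yz by blast
    then show ?thesis unfolding y(2) z(2) inner[OF y(1) z(1)] by (elim insertE emptyE) (simp_all only:, simp_all)
  qed
  have mom: "sphere_moment 22 2 = 1/22" "sphere_moment 22 4 = 1/176"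
    "mixed_moment 23 0 0 0 = 1" "mixed_moment 23 0 2 0 = 1/23"
    "mixed_moment 23 0 0 2 = 1/23" "mixed_moment 23 0 2 2 = 1/575"
    "mixed_moment 23 0 0 4 = 3/575" "mixed_moment 23 0 2 4 = 3/15525"
    by (simp_all add: eval_nat_numeral)
  show "card (C2025 x w) = 2025" if ex: "\<exists>v. v \<bullet> x = 0 \<and> v \<bullet> w = 0 \<and> norm v = 1"
  proof -
    obtain v where v: "v \<bullet> x = 0" "v \<bullet> w = 0" "norm v = 1" using ex by blast
    \<comment> \<open>Exponent 0 makes the layer sum a cardinality: 12937.5 * (1/5 - 1/23) =
      2025.\<close>
    have "real (card (inner_layer x w)) = 2025"
      using deep_hole_layer_sum[OF x w v, of 0] mom by simp
    then show ?thesis unfolding C2025_eq using inj by (simp add: card_image)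
  qed
  show "(\<Sum>c\<in>C2025 x w. (v \<bullet> c)^k) = 2025 * sphere_moment 22 k"
    if v: "v \<bullet> x = 0" "v \<bullet> w = 0" "norm v = 1" and k: "k \<le> 4"
  proof -
    have "(\<Sum>c\<in>C2025 x w. (v \<bullet> c)^k) = (\<Sum>y\<in>inner_layer x w. (1 / sqrt (44/45))^k * (v \<bullet> y)^k)"
      unfolding C2025_eq using v by (subst sum.reindex[OF inj]) (simp add: inner_diff_right power_mult_distrib[symmetric] power_divide)
    also have "\<dots> = (1 / sqrt (44/45))^k * (12937.5 * (mixed_moment 23 0 0 k / 5 - mixed_moment 23 0 2 k))"
      unfolding sum_distrib_left[symmetric] deep_hole_layer_sum[OF x w v k] ..
    also have "\<dots> = 2025 * sphere_moment 22 k"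
    proof (cases "even k")
      case False
      then show ?thesis using mixed_moment_odd[of 0 k] mixed_moment_odd[of 2 k]
        by (simp add: sphere_moment_odd del: mixed_moment.simps)
    next
      case True
      then have "k \<in> {0, 2, 4}" using k by (auto elim!: evenE)
      moreover have "(1 / sqrt (44/45))^2 = (45/44 :: real)" "(1 / sqrt (44/45))^4 = (45/44 :: real)^2"
        by (simp_all add: power_divide power4_eq_xxxx power2_eq_square)
      ultimately show ?thesis using mom
        by (elim insertE emptyE) (simp_all only: power_0, simp_all add: power2_eq_square)
    qed
    finally show ?thesis .
  qed
qed

section \<open>Interpolation of absolutely monotone potentials\<close>

text \<open>One zero of the derivative lies strictly inside each gap of Z. Differentiability is
  asked for only between points of Z, so an outermost point may be an end of [-1, 1], where
  potentials are merely continuous.\<close>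

lemma rolle_between:
  fixes g g' :: "real \<Rightarrow> real"
  assumes "finite Z" "Z \<noteq> {}"
    and zero: "\<And>z. z \<in> Z \<Longrightarrow> g z = 0"
    and cont: "\<And>x y. x \<in> Z \<Longrightarrow> y \<in> Z \<Longrightarrow> x < y \<Longrightarrow> continuous_on {x..y} g"
    and deriv: "\<And>x y t. x \<in> Z \<Longrightarrow> y \<in> Z \<Longrightarrow> x < t \<Longrightarrow> t < y \<Longrightarrow> (g has_real_derivative g' t) (at t)"
  shows "\<exists>Z'. finite Z' \<and> Suc (card Z') = card Z \<and> Z' \<inter> Z = {} \<and>
    (\<forall>t\<in>Z'. g' t = 0 \<and> (\<exists>x\<in>Z. \<exists>y\<in>Z. x < t \<and> t < y))"
  using assms
proof (induction Z rule: finite_linorder_max_induct)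
  case empty
  then show ?case by simp
next
  case (insert b A)
  show ?case
  proof (cases "A = {}")
    case True
    then show ?thesis by (intro exI[of _ "{}"]) simp
  next
    case False
    have "\<exists>Z'. finite Z' \<and> Suc (card Z') = card A \<and> Z' \<inter> A = {} \<and>
      (\<forall>t\<in>Z'. g' t = 0 \<and> (\<exists>x\<in>A. \<exists>y\<in>A. x < t \<and> t < y))"
    proof (rule insert.IH[OF False])
      show "g z = 0" if "z \<in> A" for z
        using that by (intro insert.prems(2)) simp
      show "continuous_on {x..y} g" if "x \<in> A" "y \<in> A" "x < y" for x y
        using that by (intro insert.prems(3)) simp_all
      show "(g has_real_derivative g' t) (at t)" if "x \<in> A" "y \<in> A" "x < t" "t < y" for x y t
        using that by (intro insert.prems(4)[of x y]) simp_all
    qed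
    then obtain Z' where Z': "finite Z'" "Suc (card Z') = card A" "Z' \<inter> A = {}"
      and between: "\<forall>t\<in>Z'. g' t = 0 \<and> (\<exists>x\<in>A. \<exists>y\<in>A. x < t \<and> t < y)"
      by (elim exE conjE)
    note Z' = Z' bspec[OF between]
    define m where "m = Max A"
    have m: "m \<in> A" "\<And>x. x \<in> A \<Longrightarrow> x \<le> m" using insert.hyps(1) False by (auto simp: m_def)
    have mb: "m < b" using insert.hyps(2) m(1) by blast
    have "\<exists>\<xi>. m < \<xi> \<and> \<xi> < b \<and> (g has_real_derivative 0) (at \<xi>)"
      using mb insert.prems(2)[of m] insert.prems(2)[of b] insert.prems(3)[of m b] insert.prems(4)[of m b] m(1)
      by (intro Rolle) (auto simp: real_differentiable_def)
    then obtain \<xi> where \<xi>: "m < \<xi>" "\<xi> < b" "(g has_real_derivative 0) (at \<xi>)" by blast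
    have "g' \<xi> = 0"
      using DERIV_unique[OF insert.prems(4)[of m b \<xi>] \<xi>(3)] m(1) \<xi> by simp
    have less: "t < m" if "t \<in> Z'" for t using Z'(4)[OF that] m(2) by fastforce
    have nin: "\<xi> \<notin> Z'" using less \<xi>(1) by fastforce
    have "\<xi> \<notin> insert b A" using \<xi> m(2) by fastforce
    moreover have "b \<notin> Z'" using less mb by fastforce
    moreover have "b \<notin> A" using insert.hyps(2) by blast
    ultimately show ?thesis
      using Z' nin \<open>g' \<xi> = 0\<close> \<xi> m(1) insert.hyps(1)
      by (intro exI[of _ "insert \<xi> Z'"]) auto
  qed
qed

lemma rolle_iterated:
  fixes f :: "nat \<Rightarrow> real \<Rightarrow> real"
  assumes "\<And>j t. a < t \<Longrightarrow> t < b \<Longrightarrow> (f j has_real_derivative f (Suc j) t) (at t)"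
    and "finite Z" "card Z = Suc m" "Z \<subseteq> {a<..<b}" "\<And>z. z \<in> Z \<Longrightarrow> f 0 z = 0"
  shows "\<exists>t\<in>{a<..<b}. f m t = 0"
  using assms
proof (induction m arbitrary: f Z)
  case 0
  then obtain z where "Z = {z}" by (auto simp: card_1_singleton_iff)
  then show ?case using 0 by auto
next
  case (Suc m)
  have "Z \<noteq> {}" using Suc.prems(3) by auto
  have in_ab: "a < t \<and> t < b" if "x \<in> Z" "y \<in> Z" "x \<le> t" "t \<le> y" for x y t
    using that Suc.prems(4) by (auto simp: subset_iff intro: less_le_trans le_less_trans)
  have "\<exists>Z'. finite Z' \<and> Suc (card Z') = card Z \<and> Z' \<inter> Z = {} \<and>
    (\<forall>t\<in>Z'. f 1 t = 0 \<and> (\<exists>x\<in>Z. \<exists>y\<in>Z. x < t \<and> t < y))"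
  proof (rule rolle_between[OF Suc.prems(2) \<open>Z \<noteq> {}\<close> Suc.prems(5)])
    fix x y assume "x \<in> Z" "y \<in> Z"
    then show "continuous_on {x..y} (f 0)"
      using in_ab Suc.prems(1)[of _ 0] by (intro DERIV_continuous_on[of _ _ "f 1"]) (auto intro: has_field_derivative_at_within)
    fix t assume "x < t" "t < y"
    then show "(f 0 has_real_derivative f 1 t) (at t)"
      using in_ab[OF \<open>x \<in> Z\<close> \<open>y \<in> Z\<close>, of t] Suc.prems(1)[of t 0] by simp
  qed
  then obtain Z' where Z': "finite Z'" "card Z' = Suc m" "\<And>t. t \<in> Z' \<Longrightarrow> f 1 t = 0 \<and> (\<exists>x\<in>Z. \<exists>y\<in>Z. x < t \<and> t < y)"
    using Suc.prems(3) by auto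
  have "\<exists>t\<in>{a<..<b}. f (Suc m) t = 0"
  proof (rule Suc.IH[of "\<lambda>j. f (Suc j)" Z'])
    show "Z' \<subseteq> {a<..<b}" using Z'(3) in_ab by fastforce
  qed (use Z' Suc.prems(1) in auto)
  then show ?case .
qed

text \<open>Newton's scheme: add W * L, where W is the product of squared factors of the old nodes
  and therefore preserves values and derivatives there, and the linear L adjusts both at the new
  node.\<close>

lemma hermite_interpolation:
  fixes a b :: "real \<Rightarrow> real"
  assumes "finite N"
  shows "\<exists>p :: real poly. degree p \<le> 2 * card N - 1 \<and> (\<forall>t\<in>N. poly p t = a t \<and> poly (pderiv p) t = b t)"
  using assms
proof (induction N)
  case (insert s N)
  obtain p :: "real poly" where p: "degree p \<le> 2 * card N - 1" "\<And>t. t \<in> N \<Longrightarrow> poly p t = a t \<and> poly (pderiv p) t = b t"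
    using insert.IH by blast
  define W where "W = (\<Prod>t\<in>N. [:-t, 1:]^2 :: real poly)"
  have W0: "poly W t = 0" "poly (pderiv W) t = 0" if "t \<in> N" for t
  proof -
    define R where "R = (\<Prod>t\<in>N - {t}. [:-t, 1:]^2 :: real poly)"
    have "W = [:-t, 1:]^2 * R"
      unfolding W_def R_def using insert.hyps(1) that by (rule prod.remove)
    then have W: "W = [:-t, 1:] * ([:-t, 1:] * R)" by (simp only: power2_eq_square mult.assoc)
    have "poly [:-t, 1:] t = 0" by simp
    then show "poly W t = 0" "poly (pderiv W) t = 0"
      unfolding W by (simp_all only: pderiv_mult poly_add poly_mult mult_zero_left mult_zero_right add_0)
  qed
  have Ws: "poly W s \<noteq> 0"
    unfolding W_def poly_prod using insert.hyps by (auto simp: prod_zero_iff)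
  have "degree W \<le> (\<Sum>t\<in>N. degree ([:-t, 1:]^2 :: real poly))"
    using degree_prod_sum_le[OF insert.hyps(1), of "\<lambda>t. [:-t, 1:]^2 :: real poly"]
    unfolding W_def by (simp only: o_def)
  also have "\<dots> = 2 * card N" by (simp add: degree_power_eq)
  finally have degW: "degree W \<le> 2 * card N" .
  define A where "A = (a s - poly p s) / poly W s"
  define B where "B = (b s - poly (pderiv p) s - A * poly (pderiv W) s) / poly W s"
  define L where "L = [:A - B * s, B:]"
  have L: "poly L s = A" "pderiv L = [:B:]" "degree L \<le> 1" by (simp_all add: L_def pderiv_pCons)
  define q where "q = p + W * L"
  have "degree (W * L) \<le> 2 * card N + 1"
    using degree_mult_le[of W L] degW L(3) by linarith
  then have "degree q \<le> 2 * card (insert s N) - 1"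
    unfolding q_def using p(1) insert.hyps by (intro degree_add_le) auto
  moreover have "poly q t = a t \<and> poly (pderiv q) t = b t" if "t \<in> insert s N" for t
  proof (cases "t = s")
    case True
    have "poly q s = poly p s + poly W s * A" "poly (pderiv q) s = poly (pderiv p) s + A * poly (pderiv W) s + poly W s * B"
      unfolding q_def by (simp_all add: pderiv_add pderiv_mult L)
    then show ?thesis using True Ws by (simp add: A_def B_def)
  next
    case False
    then show ?thesis using that p(2)[of t] W0[of t] unfolding q_def by (simp add: pderiv_add pderiv_mult)
  qed
  ultimately show ?case by blast
qed (auto intro!: exI[of _ 0])

lemma higher_pderiv_eq_0: "degree p < k \<Longrightarrow> (pderiv ^^ k) (p :: real poly) = 0"
proof (induction k arbitrary: p)
  case (Suc k)
  then show ?case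
  proof (cases "degree p = 0")
    case True
    then have "pderiv p = 0" by (simp add: pderiv_eq_0_iff)
    moreover have "(pderiv ^^ k) (0 :: real poly) = 0" for k by (induction k) simp_all
    ultimately show ?thesis by (simp add: funpow_Suc_right del: funpow.simps)
  next
    case False
    then have "degree (pderiv p) < k" using Suc.prems by (simp add: degree_pderiv)
    then show ?thesis using Suc.IH by (simp add: funpow_Suc_right del: funpow.simps)
  qed
qed simp

text \<open>Bernstein's argument: Taylor expansion at r bounds the n-th derivative at r by
  \<open>k b * n! / (b - r)^n\<close>, so the Taylor remainder at a zero c of infinite order tends to 0.\<close>

lemma absolutely_monotone_zero_step:
  fixes k :: "nat \<Rightarrow> real \<Rightarrow> real"
  assumes deriv: "\<And>j t. -1 < t \<Longrightarrow> t < 1 \<Longrightarrow> (k j has_real_derivative k (Suc j) t) (at t)"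
    and nonneg: "\<And>j t. -1 < t \<Longrightarrow> t < 1 \<Longrightarrow> k j t \<ge> 0"
    and c: "-1 < c" "\<And>j. k j c = 0" and r: "c < r" "r < b" "b < 1" "r - c < b - r"
  shows "k 0 r = 0"
proof -
  let ?q = "(r - c) / (b - r)"
  have q: "0 \<le> ?q" "?q < 1" using r by auto
  have bound: "k 0 r \<le> k 0 b * ?q ^ n" if n: "n > 0" for n
  proof -
    have "\<exists>t. (if r < c then r < t \<and> t < c else c < t \<and> t < r) \<and>
        k 0 r = (\<Sum>m<n. (k m c / fact m) * (r - c)^m) + (k n t / fact n) * (r - c)^n"
      by (rule Taylor[of n k "k 0" c r c r]) (use n r c deriv in auto)
    then obtain t where t: "c < t" "t < r" "k 0 r = (k n t / fact n) * (r - c)^n"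
      using r c(2) by auto
    have mono: "k n t \<le> k n r"
    proof (rule DERIV_nonneg_imp_nondecreasing[of t r "k n"])
      show "t \<le> r" using t by simp
      fix x assume x: "t \<le> x" "x \<le> r"
      show "\<exists>y. (k n has_real_derivative y) (at x) \<and> y \<ge> 0"
        using deriv[of x n] nonneg[of x "Suc n"] x t r c by (intro exI[of _ "k (Suc n) x"]) auto
    qed
    have "\<exists>t. (if b < r then b < t \<and> t < r else r < t \<and> t < b) \<and>
        k 0 b = (\<Sum>m<Suc n. (k m r / fact m) * (b - r)^m) + (k (Suc n) t / fact (Suc n)) * (b - r)^Suc n"
      by (rule Taylor[of "Suc n" k "k 0" r b r b]) (use r c deriv in auto)
    then obtain s where s: "r < s" "s < b"
      "k 0 b = (\<Sum>m<Suc n. (k m r / fact m) * (b - r)^m) + (k (Suc n) s / fact (Suc n)) * (b - r)^Suc n"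
      using r by auto
    have "(k n r / fact n) * (b - r)^n \<le> (\<Sum>m<Suc n. (k m r / fact m) * (b - r)^m)"
      by (rule member_le_sum) (use nonneg r c in auto)
    also have "\<dots> \<le> k 0 b" unfolding s(3) using nonneg[of s "Suc n"] s r c by simp
    finally have "k n r / fact n \<le> k 0 b / (b - r)^n" using r by (simp add: field_simps)
    have "k 0 r \<le> (k n r / fact n) * (r - c)^n"
      unfolding t(3) using mono r by (intro mult_right_mono divide_right_mono) auto
    also have "\<dots> \<le> k 0 b / (b - r)^n * (r - c)^n"
      using \<open>k n r / fact n \<le> k 0 b / (b - r)^n\<close> r by (intro mult_right_mono) auto
    finally show ?thesis by (simp add: power_divide)
  qed
  have "(\<lambda>n. k 0 b * ?q ^ n) \<longlonglongrightarrow> k 0 b * 0"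
    using q by (intro tendsto_mult tendsto_const LIMSEQ_realpow_zero)
  then have "k 0 r \<le> k 0 b * 0"
    by (rule LIMSEQ_le_const) (use bound in \<open>auto intro!: exI[of _ 1]\<close>)
  then show ?thesis using nonneg[of r 0] r c by simp
qed

text \<open>By monotonicity a zero spreads to the left, and strictly left of it all derivatives
  vanish. If the supremum of the zeros were below 1, \<open>absolutely_monotone_zero_step\<close>
  would produce a zero beyond it.\<close>

lemma absolutely_monotone_zero:
  fixes k :: "nat \<Rightarrow> real \<Rightarrow> real"
  assumes deriv: "\<And>j t. -1 < t \<Longrightarrow> t < 1 \<Longrightarrow> (k j has_real_derivative k (Suc j) t) (at t)"
    and nonneg: "\<And>j t. -1 < t \<Longrightarrow> t < 1 \<Longrightarrow> k j t \<ge> 0"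
    and \<xi>: "-1 < \<xi>" "\<xi> < 1" "k 0 \<xi> = 0" and t: "-1 < t" "t < 1"
  shows "k 0 t = 0"
proof -
  have mono: "k 0 x \<le> k 0 y" if "-1 < x" "x \<le> y" "y < 1" for x y
  proof (rule DERIV_nonneg_imp_nondecreasing[of x y "k 0", OF that(2)])
    fix z assume "x \<le> z" "z \<le> y"
    then show "\<exists>d. (k 0 has_real_derivative d) (at z) \<and> d \<ge> 0"
      using deriv[of z 0] nonneg[of z 1] that by (intro exI[of _ "k 1 z"]) auto
  qed
  have left: "k 0 x = 0" if "-1 < x" "x \<le> s" "s < 1" "k 0 s = 0" for x s
    using mono[of x s] nonneg[of x 0] that by simp
  have all: "k j x = 0" if "-1 < x" "x < s" "s < 1" "k 0 s = 0" for j x s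
    using that(1,2)
  proof (induction j arbitrary: x)
    case 0
    then show ?case using left[of x s] that by simp
  next
    case (Suc j)
    have "(k j has_real_derivative k (Suc j) x) (at x)" using deriv[of x j] Suc.prems that by simp
    then have "((\<lambda>_. 0) has_real_derivative k (Suc j) x) (at x)"
      by (rule has_field_derivative_transform_within_open[where S = "{-1<..<s}"]) (use Suc in auto)
    from DERIV_unique[OF this DERIV_const] show ?case .
  qed
  define S where "S = {s. -1 < s \<and> s < 1 \<and> k 0 s = 0}"
  have S: "\<xi> \<in> S" "bdd_above S" using \<xi> by (auto simp: S_def intro!: bdd_aboveI[of _ 1])
  define u where "u = Sup S"
  have u: "-1 < u" "u \<le> 1"
    using cSup_upper[OF S] \<xi> cSup_least[of S 1] S(1) unfolding u_def by (auto simp: S_def)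
  have "u = 1"
  proof (rule ccontr)
    assume "u \<noteq> 1"
    then have u1: "u < 1" using u by simp
    \<comment> \<open>With c = u - \<delta>/4, r = u + \<delta>/4 and b = u + \<delta> the gaps are
      \<delta>/2 < 3\<delta>/4, and the minimum keeps c and b inside (-1, 1).\<close>
    define \<delta> where "\<delta> = min ((1 - u) / 2) (u + 1)"
    have \<delta>: "\<delta> > 0" "u + \<delta> < 1" "-1 < u - \<delta> / 4" using u u1 by (auto simp: \<delta>_def min_def field_simps)
    obtain s where s: "s \<in> S" "u - \<delta> / 4 < s" using less_cSup_iff[of S "u - \<delta> / 4"] S \<delta>(1) unfolding u_def by auto
    have "k 0 (u + \<delta> / 4) = 0"
      by (rule absolutely_monotone_zero_step[where k = k and c = "u - \<delta> / 4" and r = "u + \<delta> / 4" and b = "u + \<delta>"])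
         (use \<delta> s all[of "u - \<delta> / 4" s] deriv nonneg in \<open>auto simp: S_def\<close>)
    then have "u + \<delta> / 4 \<in> S" using \<delta> u by (auto simp: S_def)
    then have "u + \<delta> / 4 \<le> u" unfolding u_def using S(2) by (rule cSup_upper)
    then show False using \<delta> by simp
  qed
  then obtain s where "s \<in> S" "t < s" using less_cSup_iff[of S t] S t unfolding u_def by auto
  then show ?thesis using left[of t s] t by (auto simp: S_def)
qed

section \<open>Hermite interpolation of the potential at the four nodes\<close>

definition nodes :: "real set" where
  "nodes = {- (sqrt 5 / 5), - (sqrt 5 / 15), sqrt 5 / 15, sqrt 5 / 5}"

text \<open>The product of the squares of \<open>t - u\<close> over the nodes u.\<close>

definition node_poly :: "real poly" where
  "node_poly = ([:-1/5, 0, 1:] * [:-1/45, 0, 1:])^2"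

lemma nodes: "finite nodes" "card nodes = 4" "nodes \<subseteq> {-1<..<1}"
proof -
  have s: "0 < sqrt 5" "sqrt 5 < (5::real)" by (simp_all add: real_less_lsqrt)
  then have s': "-5 < sqrt (5::real)" "-15 < sqrt (5::real)" by linarith+
  have "card {- (a / 5), - (a / 15), a / 15, a / 5} = 4" if "a > 0" for a :: real
  proof -
    have "distinct [- (a / 5), - (a / 15), a / 15, a / 5]" using that by auto
    from distinct_card[OF this] show ?thesis by simp
  qed
  from this[OF s(1)] show "finite nodes" "card nodes = 4" unfolding nodes_def by simp_all
  show "nodes \<subseteq> {-1<..<1}" using s s' unfolding nodes_def by auto
qed

lemma poly_node_poly: "poly node_poly t = ((t^2 - 1/5) * (t^2 - 1/45))^2"
  by (simp add: node_poly_def power2_eq_square algebra_simps)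

lemma node_poly_zero: "t \<in> nodes \<Longrightarrow> poly node_poly t = 0 \<and> poly (pderiv node_poly) t = 0"
proof
  assume t: "t \<in> nodes"
  have z: "poly ([:-1/5, 0, 1:] * [:-1/45, 0, 1:]) t = 0"
    using t unfolding nodes_def by (elim insertE emptyE; hypsubst; simp add: field_simps)
  show "poly node_poly t = 0" unfolding node_poly_def by (simp only: poly_power z) simp
  show "poly (pderiv node_poly) t = 0"
  proof -
    have "poly (pderiv (Q^2)) t = 0" if "poly Q t = 0" for Q
      using that by (simp add: power2_eq_square pderiv_mult)
    from this[OF z] show ?thesis unfolding node_poly_def .
  qed
qed

lemma node_poly_pos:
  assumes "t \<notin> nodes"
  shows "poly node_poly t > 0"
proof -
  have "t^2 \<noteq> 1/5"
  proof
    assume "t^2 = 1/5"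
    also have "1/5 = (sqrt 5 / 5)^2" by (simp add: power_divide)
    finally show False using assms by (simp add: power2_eq_iff nodes_def)
  qed
  moreover have "t^2 \<noteq> 1/45"
  proof
    assume "t^2 = 1/45"
    also have "1/45 = (sqrt 5 / 15)^2" by (simp add: power_divide)
    finally show False using assms by (simp add: power2_eq_iff nodes_def)
  qed
  ultimately show ?thesis unfolding poly_node_poly by simp
qed

lemma node_poly_pderiv_8: "(pderiv ^^ 8) node_poly = [:40320:]"
proof -
  have e: "node_poly = [:1/50625, 0, -4/2025, 0, 118/2025, 0, -4/9, 0, 1:]"
    by (simp add: node_poly_def power2_eq_square)
  show ?thesis unfolding e by (simp add: eval_nat_numeral pderiv_pCons)
qed

lemma has_real_derivative_higher_pderiv:
  "((\<lambda>s. poly ((pderiv ^^ j) p) s) has_real_derivative poly ((pderiv ^^ Suc j) p) t) (at t)"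
  by (simp add: poly_DERIV)

text \<open>The Hermite error formula; 40320 is 8!. Subtract from H the interpolant plus the
  multiple of \<open>node_poly\<close> that makes the difference vanish at t as well. Rolle between
  its five zeros gives four zeros of the derivative, the double zeros at the nodes give four more,
  and seven further steps reach order 8.\<close>

lemma interpolation_error:
  fixes D :: "nat \<Rightarrow> real \<Rightarrow> real" and H :: "real \<Rightarrow> real"
  assumes D0: "D 0 = H"
    and deriv: "\<And>j t. -1 < t \<Longrightarrow> t < 1 \<Longrightarrow> (D j has_real_derivative D (Suc j) t) (at t)"
    and p: "degree p \<le> 7" "\<And>u. u \<in> nodes \<Longrightarrow> poly p u = H u \<and> poly (pderiv p) u = D 1 u"
    and t: "-1 \<le> t" "t \<le> 1" "t \<notin> nodes"
    and cont: "continuous_on (insert t {-1<..<1}) H"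
  shows "\<exists>\<xi>\<in>{-1<..<1}. D 8 \<xi> * poly node_poly t = 40320 * (H t - poly p t)"
proof -
  define K where "K = (H t - poly p t) / poly node_poly t"
  have pos: "poly node_poly t > 0" by (rule node_poly_pos[OF t(3)])
  define r where "r = p + smult K node_poly"
  define f where "f j s = D j s - poly ((pderiv ^^ j) r) s" for j s
  have fd: "(f j has_real_derivative f (Suc j) s) (at s)" if "-1 < s" "s < 1" for j s
    unfolding f_def by (intro DERIV_diff deriv that has_real_derivative_higher_pderiv)
  have f0: "f 0 z = 0" if "z \<in> insert t nodes" for z
  proof (cases "z = t")
    case True
    then show ?thesis using pos unfolding f_def r_def D0 by (simp add: K_def)
  next
    case False
    then show ?thesis using that p(2)[of z] node_poly_zero[of z] unfolding f_def r_def D0 by simp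
  qed
  have f1: "f 1 z = 0" if "z \<in> nodes" for z
    using p(2)[OF that] node_poly_zero[OF that] unfolding f_def r_def by (simp add: pderiv_add pderiv_smult)
  have "\<exists>Z'. finite Z' \<and> Suc (card Z') = card (insert t nodes) \<and> Z' \<inter> insert t nodes = {} \<and>
    (\<forall>s\<in>Z'. f 1 s = 0 \<and> (\<exists>x\<in>insert t nodes. \<exists>y\<in>insert t nodes. x < s \<and> s < y))"
  proof (rule rolle_between[where g = "f 0"])
    show "finite (insert t nodes)" "insert t nodes \<noteq> {}" using nodes(1) by simp_all
    show "f 0 z = 0" if "z \<in> insert t nodes" for z using that by (rule f0)
    have range: "-1 \<le> z \<and> z \<le> 1" if "z \<in> insert t nodes" for z
      using that t nodes(3) by (auto simp: subset_iff less_imp_le)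
    have "-1 < z \<and> z < 1 \<or> z = t" if "z \<in> insert t nodes" for z
      using that nodes(3) by (metis greaterThanLessThan_iff insert_iff subset_iff)
    fix x y assume xy: "x \<in> insert t nodes" "y \<in> insert t nodes"
    then have "{x..y} \<subseteq> insert t {-1<..<1}"
      using \<open>\<And>z. z \<in> insert t nodes \<Longrightarrow> -1 < z \<and> z < 1 \<or> z = t\<close>[OF xy(1)]
        \<open>\<And>z. z \<in> insert t nodes \<Longrightarrow> -1 < z \<and> z < 1 \<or> z = t\<close>[OF xy(2)] t(1,2)
      by auto
    then show "continuous_on {x..y} (f 0)"
      unfolding f_def D0 by (intro continuous_intros continuous_on_subset[OF cont])
    fix s assume "x < s" "s < y"
    then show "(f 0 has_real_derivative f 1 s) (at s)"
      using range[OF xy(1)] range[OF xy(2)] fd[of s 0] by simp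
  qed
  then obtain Z' where Z': "finite Z'" "Suc (card Z') = card (insert t nodes)" "Z' \<inter> insert t nodes = {}"
    and between: "\<forall>s\<in>Z'. f 1 s = 0 \<and> (\<exists>x\<in>insert t nodes. \<exists>y\<in>insert t nodes. x < s \<and> s < y)"
    by (elim exE conjE)
  have rng: "-1 \<le> z \<and> z \<le> 1" if "z \<in> insert t nodes" for z
    using that t nodes(3) by (metis greaterThanLessThan_iff insert_iff less_le subset_iff)
  have "Suc (card Z') = 5" using Z'(2) card_insert_disjoint[OF nodes(1) t(3)] nodes(2) by simp
  then have c4: "card Z' = 4" by simp
  have "\<exists>\<xi>\<in>{-1<..<1}. f (Suc 7) \<xi> = 0"
  proof (rule rolle_iterated[where f = "\<lambda>j. f (Suc j)" and Z = "Z' \<union> nodes"])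
    show "(f (Suc j) has_real_derivative f (Suc (Suc j)) s) (at s)" if "-1 < s" "s < 1" for j s
      using that by (rule fd)
    show "finite (Z' \<union> nodes)" using Z'(1) nodes(1) by simp
    have "Z' \<inter> nodes = {}" using Z'(3) by blast
    then show "card (Z' \<union> nodes) = Suc 7"
      using card_Un_disjoint[OF Z'(1) nodes(1)] c4 nodes(2) by simp
    have "Z' \<subseteq> {-1<..<1}"
    proof
      fix s assume "s \<in> Z'"
      from bspec[OF between this] obtain x y where "x \<in> insert t nodes" "y \<in> insert t nodes" "x < s" "s < y" by blast
      with rng[of x] rng[of y] show "s \<in> {-1<..<1}" by simp
    qed
    then show "Z' \<union> nodes \<subseteq> {-1<..<1}" using nodes(3) by blast
    show "f (Suc 0) z = 0" if "z \<in> Z' \<union> nodes" for z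
      using that bspec[OF between, of z] f1[of z] by auto
  qed
  then obtain \<xi> where \<xi>: "\<xi> \<in> {-1<..<1}" "f 8 \<xi> = 0" by auto
  have "(pderiv ^^ 8) r = (pderiv ^^ 8) p + smult K ((pderiv ^^ 8) node_poly)"
    unfolding r_def by (simp add: numeral_eq_Suc pderiv_add pderiv_smult)
  then have "D 8 \<xi> = 40320 * K"
    using \<xi>(2) higher_pderiv_eq_0[of p 8] p(1) node_poly_pderiv_8 unfolding f_def by simp
  then show ?thesis using \<xi>(1) pos by (intro bexI[of _ \<xi>]) (simp_all add: K_def)
qed

text \<open>The sign of h - p is that of the eighth derivative, because \<open>node_poly\<close> is
  positive off the nodes. Strictness therefore needs this derivative to be positive throughout (-1,
  1), and the point 1 needs care since h may be infinite there.\<close>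

lemma potential_interpolant:
  assumes h: "absolutely_monotone_potential h"
    and nonpoly: "\<not> (\<exists>p :: real poly. degree p \<le> 7 \<and> (\<forall>t\<in>{-1<..<1}. h t = ereal (poly p t)))"
  obtains p :: "real poly" where "degree p \<le> 7"
    and "\<And>t. t \<in> {-1..1} \<Longrightarrow> ereal (poly p t) \<le> h t"
    and "\<And>t. t \<in> {-1..1} \<Longrightarrow> t \<notin> nodes \<Longrightarrow> ereal (poly p t) < h t"
    and "\<And>t. t \<in> nodes \<Longrightarrow> h t = ereal (poly p t)"
proof -
  define H where "H s = real_of_ereal (h s)" for s
  define D where "D j = (deriv ^^ j) H" for j
  have D0: "D 0 = H" by (simp add: D_def)
  note hdef = h[unfolded absolutely_monotone_potential_def]
  note hc = conjunct1[OF hdef] and fin = bspec[OF conjunct1[OF conjunct2[OF hdef]]]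
    and hd = conjunct1[OF conjunct2[OF conjunct2[OF hdef]]] and hn = conjunct2[OF conjunct2[OF conjunct2[OF hdef]]]
  have deriv: "(D j has_real_derivative D (Suc j) t) (at t)" if "-1 < t" "t < 1" for j t
    using bspec[OF spec[OF hd, of j], of t] that unfolding D_def H_def[abs_def]
    by (simp add: field_differentiable_derivI)
  have nonneg: "D j t \<ge> 0" if "j \<ge> 1" "-1 < t" "t < 1" for j t
    using hn that unfolding D_def H_def[abs_def] by simp
  have hH: "h t = ereal (H t)" if "\<bar>h t\<bar> \<noteq> \<infinity>" for t
    using that unfolding H_def by (simp add: ereal_real)
  \<comment> \<open>The derivatives of order 8 and higher form an absolutely monotone sequence, so
    one zero of the eighth makes it vanish identically; Taylor expansion at 0 then exhibits h as an
    excluded polynomial.\<close>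
  have pos8: "D 8 t > 0" if t: "-1 < t" "t < 1" for t
  proof (rule ccontr)
    assume "\<not> D 8 t > 0"
    then have z: "D 8 t = 0" using nonneg[of 8 t] t by simp
    have D8: "D 8 s = 0" if "-1 < s" "s < 1" for s
    proof -
      have "D (8 + 0) s = 0"
      proof (rule absolutely_monotone_zero[where k = "\<lambda>j. D (8 + j)" and \<xi> = t and t = s])
        show "(D (8 + j) has_real_derivative D (8 + Suc j) u) (at u)" if "-1 < u" "u < 1" for j u
          using deriv[OF that, of "8 + j"] by simp
        show "0 \<le> D (8 + j) u" if "-1 < u" "u < 1" for j u
          using nonneg[of "8 + j" u] that by simp
      qed (use t z that in simp_all)
      then show ?thesis by simp
    qed
    define p where "p = (\<Sum>m<8. monom (D m 0 / fact m) m)"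
    have "degree p \<le> 7" unfolding p_def
      by (rule degree_sum_le) (auto intro: order_trans[OF degree_monom_le])
    moreover have "h s = ereal (poly p s)" if s: "s \<in> {-1<..<1}" for s
    proof -
      have "H s = poly p s"
      proof (cases "s = 0")
        case True
        have "poly p 0 = (\<Sum>m<8. D m 0 / fact m * 0 ^ m)" by (simp add: p_def poly_sum poly_monom)
        also have "\<dots> = (\<Sum>m\<in>{0}. D m 0 / fact m * 0 ^ m)" by (rule sum.mono_neutral_right) auto
        finally show ?thesis using True by (simp add: D0)
      next
        case False
        have "\<exists>u. (if s < 0 then s < u \<and> u < 0 else 0 < u \<and> u < s) \<and>
          H s = (\<Sum>m<8. (D m 0 / fact m) * (s - 0)^m) + (D 8 u / fact 8) * (s - 0)^8"
          by (rule Taylor[of 8 D H "min s 0" "max s 0" 0 s]) (use s False deriv D0 in auto)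
        then obtain u where u: "if s < 0 then s < u \<and> u < 0 else 0 < u \<and> u < s"
          "H s = (\<Sum>m<8. (D m 0 / fact m) * (s - 0)^m) + (D 8 u / fact 8) * (s - 0)^8" by blast
        have "D 8 u = 0" using u(1) s by (intro D8) (auto split: if_splits)
        then show ?thesis using u(2) by (simp add: p_def poly_sum poly_monom)
      qed
      then show ?thesis using hH[OF fin[of s]] s by simp
    qed
    ultimately show False using nonpoly by blast
  qed
  obtain p :: "real poly" where p: "degree p \<le> 2 * card nodes - 1"
    "\<forall>u\<in>nodes. poly p u = H u \<and> poly (pderiv p) u = D 1 u"
    using hermite_interpolation[OF nodes(1), of H "D 1"] by blast
  have deg: "degree p \<le> 7" using p(1) unfolding nodes(2) by simp
  have strict: "poly p t < H t" if t: "t \<in> {-1..1}" "t \<notin> nodes" "\<bar>h t\<bar> \<noteq> \<infinity>" for t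
  proof -
    have "insert t {-1<..<1} \<subseteq> {-1..1}" using t(1) by auto
    then have "continuous_on (insert t {-1<..<1}) h" by (rule continuous_on_subset[OF hc])
    moreover have "\<bar>h u\<bar> \<noteq> \<infinity>" if "u \<in> insert t {-1<..<1}" for u
    proof (cases "u = t")
      case False
      then have "u \<in> {-1..<1}" using that by simp
      then show ?thesis by (rule fin)
    qed (use t(3) in simp)
    ultimately have "continuous_on (insert t {-1<..<1}) (real_of_ereal \<circ> h)"
      using continuous_on_iff_real[of "insert t {-1<..<1}" h] by blast
    then have c: "continuous_on (insert t {-1<..<1}) H" by (simp add: H_def[abs_def] o_def)
    obtain \<xi> where \<xi>: "\<xi> \<in> {-1<..<1}" "D 8 \<xi> * poly node_poly t = 40320 * (H t - poly p t)"
      using interpolation_error[OF D0 deriv deg bspec[OF p(2)] _ _ t(2) c] t(1) by auto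
    have "D 8 \<xi> * poly node_poly t > 0" using pos8 \<xi>(1) node_poly_pos[OF t(2)] by simp
    then show ?thesis using \<xi>(2) by simp
  qed
  have eq: "h t = ereal (poly p t)" if t: "t \<in> nodes" for t
  proof -
    have "t \<in> {-1..<1}" using t nodes(3) by (metis atLeastLessThan_iff greaterThanLessThan_iff less_le subset_iff)
    then show ?thesis using hH[OF fin[of t]] bspec[OF p(2) t] by simp
  qed
  have le: "ereal (poly p t) \<le> h t" if "t \<in> {-1..<1}" for t
  proof (cases "t \<in> nodes")
    case True
    then show ?thesis using eq by simp
  next
    case False
    then show ?thesis using strict[of t] that fin[OF that] hH[OF fin[OF that]] by (simp add: less_imp_le)
  qed
  \<comment> \<open>Passing to the limit from the left covers finite and infinite values at 1 alike;
    an infinite value then yields the strict inequality without the error formula.\<close>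
  have le1: "ereal (poly p 1) \<le> h 1"
  proof (rule tendsto_le[of "at_left (1::real)" h "h 1" "\<lambda>t. ereal (poly p t)"])
    have "(h \<longlongrightarrow> h 1) (at 1 within {-1..1})" using hc by (simp add: continuous_on)
    then show "(h \<longlongrightarrow> h 1) (at_left 1)"
      by (simp add: at_within_Icc_at_left)
    show "((\<lambda>t. ereal (poly p t)) \<longlongrightarrow> ereal (poly p 1)) (at_left 1)"
      by (intro tendsto_intros)
    have "eventually (\<lambda>t. t \<in> {-1<..<1}) (at_left (1::real))"
      by (rule eventually_at_left_real) simp
    then show "eventually (\<lambda>t. ereal (poly p t) \<le> h t) (at_left 1)"
      by (rule eventually_mono) (intro le, simp)
  qed simp
  have all_le: "ereal (poly p t) \<le> h t" if "t \<in> {-1..1}" for t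
    using le[of t] le1 that by (cases "t = 1") auto
  have "ereal (poly p t) < h t" if t: "t \<in> {-1..1}" "t \<notin> nodes" for t
  proof (cases "\<bar>h t\<bar> = \<infinity>")
    case True
    then show ?thesis using all_le[OF t(1)] by (cases "h t") auto
  next
    case False
    then show ?thesis using strict[OF t False] hH[OF False] by simp
  qed
  then show thesis using that[OF deg all_le _ eq] by blast
qed

section \<open>Gegenbauer polynomials\<close>

text \<open>\<open>gegenbauer\<close> is a definite description, so existence and uniqueness must be
  established before any expansion has content. For n > 3 the exponent of the weight is positive,
  which keeps the weight continuous up to both ends.\<close>

locale gegenbauer_weight =
  fixes n :: nat
  assumes n: "n > 3"
begin

definition \<beta> :: real where "\<beta> = (real n - 3) / 2"

lemma \<beta>: "\<beta> > 0" "2 * (\<beta> + 1) = real n - 1"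
  using n by (auto simp: \<beta>_def field_simps)

definition w :: "real \<Rightarrow> real" where "w t = (1 - t\<^sup>2) powr \<beta>"

definition I :: "real poly \<Rightarrow> real" where "I p = integral {-1..1} (\<lambda>t. poly p t * w t)"

lemma one_minus_sq: "t \<in> {-1..1} \<Longrightarrow> 0 \<le> 1 - t\<^sup>2" "t \<in> {-1<..<1} \<Longrightarrow> 0 < 1 - t\<^sup>2" for t :: real
  by (auto simp: abs_square_le_1 abs_square_less_1)

lemma cont_w: "continuous_on {-1..1} w"
  unfolding w_def[abs_def] using \<beta>(1) one_minus_sq(1) by (intro continuous_on_powr' continuous_intros) auto

lemma int: "(\<lambda>t. poly p t * w t) integrable_on {-1..1}"
  by (intro integrable_continuous_interval continuous_on_mult cont_w continuous_intros)

lemma I_add: "I (p + q) = I p + I q"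
  unfolding I_def by (simp add: distrib_right integral_add[OF int int])

lemma I_smult: "I (smult c p) = c * I p"
  unfolding I_def by (simp add: mult.assoc integral_mult_right)

lemma I_diff: "I (p - q) = I p - I q"
  unfolding I_def by (simp add: left_diff_distrib integral_diff[OF int int])

lemma I_0: "I 0 = 0" unfolding I_def by simp

lemma I_sum: "finite A \<Longrightarrow> I (\<Sum>i\<in>A. f i) = (\<Sum>i\<in>A. I (f i))"
  by (induction A rule: finite_induct) (auto simp: I_add I_0)

lemma I_definite:
  assumes "I (p * p) = 0"
  shows "p = 0"
proof (rule ccontr)
  assume "p \<noteq> 0"
  have cont: "continuous_on {-1..1} (\<lambda>t. poly (p * p) t * w t)"
    by (intro continuous_on_mult cont_w continuous_intros)
  have "\<forall>t\<in>{-1..1}. poly (p * p) t * w t = 0"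
    using assms unfolding I_def
    by (subst (asm) integral_eq_0_iff[OF cont]) (auto simp: w_def)
  then have "poly p t = 0" if "t \<in> {-1<..<1}" for t
    using that one_minus_sq(2)[OF that] by (force simp: w_def)
  then have "{-1<..<1} \<subseteq> {t. poly p t = 0}" by blast
  then have "finite {-1<..<1::real}" using poly_roots_finite[OF \<open>p \<noteq> 0\<close>] finite_subset by blast
  then show False using infinite_Ioo[of "-1::real" 1] by simp
qed

text \<open>Integrate the derivative of p(t) (1 - t^2)^(\<beta> + 1), which vanishes at both ends; 2
  (\<beta> + 1) = n - 1.\<close>

lemma I_stokes: "I (pderiv p * [:1, 0, -1:] - smult (real n - 1) (p * [:0, 1:])) = 0"
proof -
  let ?F = "\<lambda>t. poly p t * (1 - t\<^sup>2) powr (\<beta> + 1)"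
  let ?q = "pderiv p * [:1, 0, -1:] - smult (real n - 1) (p * [:0, 1:])"
  have "((\<lambda>t. poly ?q t * w t) has_integral (?F 1 - ?F (-1))) {-1..1}"
  proof (rule fundamental_theorem_of_calculus_interior)
    show "continuous_on {-1..1} ?F"
      using \<beta>(1) one_minus_sq(1) by (intro continuous_on_mult continuous_on_powr' continuous_intros) auto
    fix t :: real assume t: "t \<in> {-1<..<1}"
    have pos: "0 < 1 - t\<^sup>2" by (rule one_minus_sq(2)[OF t])
    have "((\<lambda>t. 1 - t\<^sup>2) has_real_derivative - 2 * t) (at t)"
      by (auto intro!: derivative_eq_intros)
    from DERIV_fun_powr[OF this pos, of "\<beta> + 1"]
    have "((\<lambda>t. (1 - t\<^sup>2) powr (\<beta> + 1)) has_real_derivative (\<beta> + 1) * (1 - t\<^sup>2) powr \<beta> * (- 2 * t)) (at t)"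
      by simp
    from DERIV_mult[OF poly_DERIV this]
    have "(?F has_real_derivative poly (pderiv p) t * (1 - t\<^sup>2) powr (\<beta> + 1)
        + (\<beta> + 1) * (1 - t\<^sup>2) powr \<beta> * (- 2 * t) * poly p t) (at t)" .
    moreover have "poly (pderiv p) t * (1 - t\<^sup>2) powr (\<beta> + 1)
        + (\<beta> + 1) * (1 - t\<^sup>2) powr \<beta> * (- 2 * t) * poly p t = poly ?q t * w t"
    proof -
      have e: "(1 - t\<^sup>2) powr (\<beta> + 1) = (1 - t\<^sup>2) * w t"
        using pos by (simp add: w_def powr_add)
      show ?thesis
        unfolding e w_def[symmetric] \<beta>(2)[symmetric] by (simp add: algebra_simps power2_eq_square)
    qed
    ultimately have "(?F has_real_derivative poly ?q t * w t) (at t)" by (simp only:)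
    then show "(?F has_vector_derivative poly ?q t * w t) (at t)"
      by (simp only: has_real_derivative_iff_has_vector_derivative)
  qed simp
  then show ?thesis using \<beta>(1) unfolding I_def by (simp add: integral_unique)
qed

definition L :: "real poly \<Rightarrow> real poly" where
  "L p = pderiv (pderiv p) * [:1, 0, -1:] - smult (real n - 1) (pderiv p * [:0, 1:])"

text \<open>The Gegenbauer operator \<open>L\<close> is self-adjoint: by \<open>I_stokes\<close> for
  p' q both sides equal minus the integral of p' q' (1 - t^2) against the weight.\<close>

lemma I_symmetric: "I (q * L p) = I (p * L q)"
proof -
  have ring: "(p1 * q1 + q0 * p2) * A - smult c ((p1 * q0) * T)
      = q0 * (p2 * A - smult c (p1 * T)) + p1 * q1 * A" for p1 p2 q0 q1 A T :: "real poly" and c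
    by (simp add: algebra_simps)
  have "I (q * L p) = - I (pderiv p * pderiv q * [:1, 0, -1:])" for p q
  proof -
    have "pderiv (pderiv p * q) * [:1, 0, -1:] - smult (real n - 1) ((pderiv p * q) * [:0, 1:])
        = q * L p + pderiv p * pderiv q * [:1, 0, -1:]"
      unfolding L_def pderiv_mult by (rule ring)
    then show ?thesis using I_stokes[of "pderiv p * q"] by (simp only: I_add)
  qed
  from this[of q p] this[of p q] show ?thesis by (simp only: mult.commute[of "pderiv p"])
qed

definition eigenvalue :: "nat \<Rightarrow> real" where "eigenvalue k = real k * (real k + real n - 2)"

lemma eigenvalue_less: "j < k \<Longrightarrow> eigenvalue j < eigenvalue k"
  unfolding eigenvalue_def using n by (intro mult_strict_mono') auto

text \<open>The coefficient of t^(k - i) in the monic eigenpolynomial of \<open>L\<close>, obtained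
  by solving the eigenvalue equation downwards from the leading term. The denominators are
  differences of distinct eigenvalues.\<close>

fun top_coeff :: "nat \<Rightarrow> nat \<Rightarrow> real" where
  "top_coeff k 0 = 1"
| "top_coeff k (Suc 0) = 0"
| "top_coeff k (Suc (Suc i)) =
    - (real (k - i) * real (k - i - 1) * top_coeff k i) / (eigenvalue k - eigenvalue (k - i - 2))"

definition eigenpoly :: "nat \<Rightarrow> real poly" where
  "eigenpoly k = (\<Sum>j\<le>k. monom (top_coeff k (k - j)) j)"

lemma coeff_eigenpoly: "coeff (eigenpoly k) j = (if j \<le> k then top_coeff k (k - j) else 0)"
  unfolding eigenpoly_def by (simp add: coeff_sum)

lemma degree_eigenpoly: "degree (eigenpoly k) = k"
  by (rule antisym) (auto intro!: degree_le le_degree simp: coeff_eigenpoly)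

lemma coeff_L: "coeff (L p) j = (real j + 1) * (real j + 2) * coeff p (j + 2) - eigenvalue j * coeff p j"
proof -
  have 1: "coeff (q * [:1, 0, -1:]) j = coeff q j - (if j < 2 then 0 else coeff q (j - 2))" for q :: "real poly"
  proof -
    have "q * [:1, 0, -1:] = q - pCons 0 (pCons 0 q)" by (simp add: algebra_simps)
    then show ?thesis by (cases j; cases "j - 1") (auto simp: coeff_pCons)
  qed
  have 2: "coeff (q * [:0, 1:]) j = (if j = 0 then 0 else coeff q (j - 1))" for q :: "real poly"
    by (cases j) (simp_all add: coeff_pCons)
  consider "j = 0" | "j = 1" | i where "j = Suc (Suc i)"
    by (metis One_nat_def not0_implies_Suc)
  then show ?thesis
    unfolding L_def coeff_diff coeff_smult 1 2
    by cases (auto simp: coeff_pderiv eigenvalue_def algebra_simps)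
qed

lemma L_eigenpoly: "L (eigenpoly k) = smult (- eigenvalue k) (eigenpoly k)"
proof (rule poly_eqI)
  fix j
  consider "j > k" | "j = k" | "k = Suc j" | i where "k = Suc (Suc i) + j"
    by (metis less_imp_Suc_add linorder_neqE_nat add_Suc_right add.commute Suc_lessI)
  then show "coeff (L (eigenpoly k)) j = coeff (smult (- eigenvalue k) (eigenpoly k)) j"
  proof cases
    case (4 i)
    have less: "eigenvalue k - eigenvalue j > 0" using eigenvalue_less[of j k] 4 by simp
    have "top_coeff k (k - j) = - ((real j + 2) * (real j + 1) * top_coeff k (k - (j + 2))) / (eigenvalue k - eigenvalue j)"
      using 4 by (simp add: algebra_simps)
    then have "(eigenvalue k - eigenvalue j) * top_coeff k (k - j) = - ((real j + 2) * (real j + 1) * top_coeff k (k - (j + 2)))"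
      using less by (simp add: field_simps)
    then show ?thesis using 4 unfolding coeff_L coeff_smult coeff_eigenpoly by (simp add: algebra_simps del: top_coeff.simps)
  qed (simp_all add: coeff_L coeff_eigenpoly)
qed

text \<open>The point 1 is singular for the equation, so a zero there propagates to the derivative, which solves
  an equation of the same shape.\<close>

lemma ode_zero:
  fixes p :: "real poly"
  assumes "pderiv (pderiv p) * [:1, 0, -1:] - smult a (pderiv p * [:0, 1:]) + smult b p = 0" "a > 0" "poly p 1 = 0"
  shows "p = 0"
  using assms
proof (induction "degree p" arbitrary: p a b)
  case 0
  then obtain c where "p = [:c:]" by (metis degree_eq_zeroE)
  then show ?case using 0 by simp
next
  case (Suc d)
  let ?q = "pderiv p"
  have "poly (pderiv (pderiv p) * [:1, 0, -1:] - smult a (pderiv p * [:0, 1:]) + smult b p) 1 = 0"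
    unfolding Suc.prems(1) by simp
  \<comment> \<open>At t = 1 the second-order term drops out, leaving -a p'(1) + b p(1) = 0 with a >
    0.\<close>
  then have q1: "poly ?q 1 = 0" using Suc.prems(2,3) by simp
  \<comment> \<open>Differentiating the equation replaces a by a + 2 and b by b - a, so positivity
    of a persists while the degree falls.\<close>
  have ring: "pderiv (X * A - smult a (Y * T) + smult b p)
      = pderiv X * A - smult (a + 2) (X * T) + smult (b - a) Y"
    if "pderiv A = smult (-2) T" "pderiv T = 1" "pderiv Y = X" "pderiv p = Y" for A T X Y :: "real poly"
    by (simp add: that pderiv_add pderiv_diff pderiv_smult pderiv_mult smult_add_left smult_add_right smult_diff_left algebra_simps)
  have "pderiv [:1, 0, -1:] = smult (-2) [:0, 1 :: real:]" "pderiv [:0, 1 :: real:] = 1"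
    by (simp_all add: pderiv_pCons one_pCons)
  from ring[OF this refl refl]
  have "pderiv (pderiv ?q) * [:1, 0, -1:] - smult (a + 2) (pderiv ?q * [:0, 1:]) + smult (b - a) ?q = 0"
    unfolding Suc.prems(1) by simp
  moreover have "d = degree ?q" using Suc.hyps(2) by (simp add: degree_pderiv)
  ultimately have "?q = 0" using Suc.hyps(1)[of ?q "a + 2" "b - a"] Suc.prems(2) q1 by simp
  then have "degree p = 0" by (simp add: pderiv_eq_0_iff)
  then show ?case using Suc.hyps(2) by simp
qed

lemma eigenpoly_1: "poly (eigenpoly k) 1 \<noteq> 0"
proof
  assume z: "poly (eigenpoly k) 1 = 0"
  have "L (eigenpoly k) + smult (eigenvalue k) (eigenpoly k) = 0"
    by (simp add: L_eigenpoly)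
  from ode_zero[OF this[unfolded L_def] _ z] have "eigenpoly k = 0" using n by simp
  then have "coeff (eigenpoly k) k = 0" by simp
  then show False by (simp add: coeff_eigenpoly)
qed

lemma eigenpoly_orthogonal:
  assumes "j \<noteq> k"
  shows "I (eigenpoly j * eigenpoly k) = 0"
proof -
  have "I (eigenpoly j * L (eigenpoly k)) = I (eigenpoly k * L (eigenpoly j))" by (rule I_symmetric)
  then have "eigenvalue k * I (eigenpoly j * eigenpoly k) = eigenvalue j * I (eigenpoly j * eigenpoly k)"
    unfolding L_eigenpoly mult_smult_right I_smult by (simp add: mult.commute)
  moreover have "eigenvalue j \<noteq> eigenvalue k"
    using assms eigenvalue_less by (metis less_irrefl linorder_neqE_nat)
  ultimately show ?thesis by simp
qed

definition orthonormal_at_1 :: "(nat \<Rightarrow> real poly) \<Rightarrow> bool" where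
  "orthonormal_at_1 P \<longleftrightarrow> (\<forall>i. degree (P i) = i \<and> poly (P i) 1 = 1) \<and> (\<forall>i j. i \<noteq> j \<longrightarrow> I (P i * P j) = 0)"

lemma orthonormal_exists: "\<exists>P. orthonormal_at_1 P"
proof
  show "orthonormal_at_1 (\<lambda>k. smult (1 / poly (eigenpoly k) 1) (eigenpoly k))"
    unfolding orthonormal_at_1_def
    using eigenpoly_1 eigenpoly_orthogonal by (simp add: degree_eigenpoly I_smult)
qed

lemma graded_expansion:
  fixes P :: "nat \<Rightarrow> real poly"
  assumes P: "\<And>i. degree (P i) = i" "\<And>i. P i \<noteq> 0" and "degree f \<le> d"
  shows "\<exists>c. f = (\<Sum>i\<le>d. smult (c i) (P i))"
  using assms(3)
proof (induction d arbitrary: f)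
  case 0
  then obtain a where a: "f = [:a:]" by (metis degree_eq_zeroE le_zero_eq)
  obtain b where b: "P 0 = [:b:]" using P(1)[of 0] by (metis degree_eq_zeroE)
  then have "b \<noteq> 0" using P(2)[of 0] by simp
  then show ?case by (intro exI[of _ "\<lambda>_. a / b"]) (simp add: a b)
next
  case (Suc d)
  define a where "a = coeff f (Suc d) / coeff (P (Suc d)) (Suc d)"
  have lead: "coeff (P (Suc d)) (Suc d) \<noteq> 0"
    using P(1)[of "Suc d"] P(2)[of "Suc d"] leading_coeff_neq_0[of "P (Suc d)"] by simp
  have "degree (f - smult a (P (Suc d))) \<le> d"
  proof (rule degree_le, intro allI impI)
    fix i assume "d < i"
    then consider "i = Suc d" | "i > Suc d" by linarith
    then show "coeff (f - smult a (P (Suc d))) i = 0"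
    proof cases
      case 2
      then show ?thesis using Suc.prems P(1)[of "Suc d"] by (simp add: coeff_eq_0)
    qed (simp add: a_def lead)
  qed
  from Suc.IH[OF this] obtain c where c: "f - smult a (P (Suc d)) = (\<Sum>i\<le>d. smult (c i) (P i))" by blast
  have "f = (\<Sum>i\<le>Suc d. smult (if i = Suc d then a else c i) (P i))"
    using c by (simp add: diff_eq_eq)
  then show ?case by (rule exI[of _ "\<lambda>i. if i = Suc d then a else c i"])
qed

lemma orthonormal_lower:
  assumes P: "orthonormal_at_1 P" and f: "degree f < k"
  shows "I (P k * f) = 0"
proof -
  have Pd: "degree (P i) = i" "P i \<noteq> 0" for i
    using P unfolding orthonormal_at_1_def by (auto dest: spec[of _ i])
  have "degree f \<le> k - 1" using f by linarith
  from graded_expansion[OF Pd this] obtain c where c: "f = (\<Sum>i\<le>k - 1. smult (c i) (P i))" by blast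
  have "I (P k * f) = (\<Sum>i\<le>k - 1. c i * I (P k * P i))"
    unfolding c sum_distrib_left by (simp add: I_sum I_smult)
  also have "\<dots> = 0"
    using P f unfolding orthonormal_at_1_def by (intro sum.neutral) auto
  finally show ?thesis .
qed

text \<open>Cancelling leading terms leaves R = P k - r * Q k of degree below k, hence orthogonal to
  P k and to Q k, thus to itself. The normalization at 1 then forces r = 1.\<close>

lemma orthonormal_unique:
  assumes P: "orthonormal_at_1 P" and Q: "orthonormal_at_1 Q"
  shows "P = Q"
proof
  fix k
  have d: "degree (P k) = k" "poly (P k) 1 = 1" "degree (Q k) = k" "poly (Q k) 1 = 1" "Q k \<noteq> 0"
    using P Q unfolding orthonormal_at_1_def by (auto dest: spec[of _ k])
  define r where "r = coeff (P k) k / coeff (Q k) k"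
  have lead: "coeff (Q k) k \<noteq> 0" using d(3,5) leading_coeff_neq_0[of "Q k"] by simp
  define R where "R = P k - smult r (Q k)"
  have "R = 0"
  proof (cases "k = 0")
    case True
    then obtain a b where "P k = [:a:]" "Q k = [:b:]" using d(1,3) by (metis degree_eq_zeroE)
    then show ?thesis using True lead unfolding R_def r_def by simp
  next
    case False
    have "degree R < k"
    proof -
      have "degree R \<le> k - 1"
      proof (rule degree_le, intro allI impI)
        fix i assume "k - 1 < i"
        then consider "i = k" | "i > k" by linarith
        then show "coeff R i = 0"
        proof cases
          case 2
          then show ?thesis using d unfolding R_def by (simp add: coeff_eq_0)
        qed (use lead in \<open>simp add: R_def r_def\<close>)
      qed
      then show ?thesis using False by linarith
    qed
    then have "I (P k * R) = 0" "I (Q k * R) = 0" using orthonormal_lower P Q by blast+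
    moreover have "(P k - smult r (Q k)) * R = P k * R - smult r (Q k * R)"
      by (simp only: left_diff_distrib mult_smult_left)
    ultimately have "I (R * R) = 0" by (simp add: I_diff I_smult R_def[symmetric])
    then show ?thesis by (rule I_definite)
  qed
  then have e: "P k = smult r (Q k)" by (simp add: R_def)
  then have "r = 1" using d(2,4) by simp
  then show "P k = Q k" using e by simp
qed

lemma gegenbauer: "orthonormal_at_1 (gegenbauer n)"
proof -
  have "gegenbauer n = (THE P. orthonormal_at_1 P)"
    unfolding gegenbauer_def orthonormal_at_1_def I_def w_def \<beta>_def by (simp add: mult.assoc)
  moreover have "\<exists>!P. orthonormal_at_1 P"
    using orthonormal_exists orthonormal_unique by blast
  ultimately show ?thesis using theI'[of orthonormal_at_1] by simp
qed

text \<open>\<open>I_stokes\<close> at successive powers of t gives the recursion of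
  \<open>sphere_moment\<close>: up to its total mass the weight is the distribution of one
  coordinate on the sphere.\<close>

lemma I_moments:
  "I [:0, 1:] = 0" "I [:0, 0, 1:] = I 1 / n" "I [:0, 0, 0, 1:] = 0" "I [:0, 0, 0, 0, 1:] = I 1 * (3 / (real n * (real n + 2)))"
proof -
  have sm: "I (p - smult c q) = I p - c * I q" for c p q by (simp add: I_diff I_smult)
  have a: "(real n - 1) * I [:0, 1:] = 0"
    using I_stokes[of 1] by (simp only: sm) (simp add: I_0 pderiv_1)
  then show 1: "I [:0, 1:] = 0" using n by simp
  have "I ([:1:] - smult 1 [:0, 0, 1:]) - (real n - 1) * I [:0, 0, 1:] = 0"
    using I_stokes[of "[:0, 1:]"] unfolding sm[of _ "real n - 1"] by (simp add: pderiv_pCons)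
  then have "I 1 = n * I [:0, 0, 1:]" unfolding sm by (simp add: one_pCons algebra_simps)
  then show 2: "I [:0, 0, 1:] = I 1 / n" using n by (simp add: field_simps)
  have "I (smult 2 [:0, 1:] - smult 2 [:0, 0, 0, 1:]) - (real n - 1) * I [:0, 0, 0, 1:] = 0"
    using I_stokes[of "[:0, 0, 1:]"] unfolding sm[of _ "real n - 1"] by (simp add: pderiv_pCons)
  then have "(real n + 1) * I [:0, 0, 0, 1:] = 0" unfolding sm I_smult using 1 by (simp add: algebra_simps)
  then show "I [:0, 0, 0, 1:] = 0" by simp
  have "I (smult 3 [:0, 0, 1:] - smult 3 [:0, 0, 0, 0, 1:]) - (real n - 1) * I [:0, 0, 0, 0, 1:] = 0"
    using I_stokes[of "[:0, 0, 0, 1:]"] unfolding sm[of _ "real n - 1"] by (simp add: pderiv_pCons)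
  then have "(real n + 2) * I [:0, 0, 0, 0, 1:] = 3 * (I 1 / n)" unfolding sm I_smult 2 by (simp add: algebra_simps)
  then have "I [:0, 0, 0, 0, 1:] = 3 * (I 1 / n) / (real n + 2)"
    using n by (simp add: eq_divide_eq mult.commute)
  then show "I [:0, 0, 0, 0, 1:] = I 1 * (3 / (real n * (real n + 2)))" by simp
qed

text \<open>Orthogonality to the constant polynomial makes c 0 the mean of f under the normalized
  weight. Written in sphere moments, it is the quantity that linear programming produces.\<close>

lemma gegenbauer_expansion_exists:
  fixes f :: "real poly"
  assumes "degree f \<le> 4"
  shows "\<exists>c. gegenbauer_expansion n f c \<and> c 0 = (\<Sum>k\<le>4. coeff f k * sphere_moment n k)"
proof -
  have G: "degree (gegenbauer n i) = i" "poly (gegenbauer n i) 1 = 1" "gegenbauer n i \<noteq> 0" for i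
    using gegenbauer unfolding orthonormal_at_1_def by (auto dest: spec[of _ i])
  obtain c where c: "f = (\<Sum>i\<le>degree f. smult (c i) (gegenbauer n i))"
    using graded_expansion[OF G(1,3) order_refl] by blast
  define c' where "c' i = (if i \<le> degree f then c i else 0)" for i
  have f: "f = (\<Sum>i\<le>degree f. smult (c' i) (gegenbauer n i))"
    by (subst c) (simp add: c'_def)
  have G0: "gegenbauer n 0 = 1"
  proof -
    obtain a where "gegenbauer n 0 = [:a:]" using G(1)[of 0] by (metis degree_eq_zeroE)
    then show ?thesis using G(2)[of 0] by (simp add: one_pCons)
  qed
  have I1: "I 1 \<noteq> 0" using I_definite[of 1] by auto
  have "I f = (\<Sum>i\<le>degree f. c' i * I (gegenbauer n i))"
    by (subst f) (simp add: I_sum I_smult)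
  also have "\<dots> = (\<Sum>i\<in>{0}. c' i * I (gegenbauer n i))"
  proof (rule sum.mono_neutral_right)
    show "\<forall>i\<in>{..degree f} - {0}. c' i * I (gegenbauer n i) = 0"
      using orthonormal_lower[OF gegenbauer, of 1] by simp
  qed auto
  finally have If: "I f = c' 0 * I 1" by (simp add: G0)
  have "f = (\<Sum>k\<le>4. monom (coeff f k) k)"
    using poly_as_sum_of_monoms'[OF assms] by simp
  also have "\<dots> = smult (coeff f 0) 1 + smult (coeff f 1) [:0, 1:] + smult (coeff f 2) [:0, 0, 1:]
      + smult (coeff f 3) [:0, 0, 0, 1:] + smult (coeff f 4) [:0, 0, 0, 0, 1:]"
    by (simp add: eval_nat_numeral monom_Suc monom_0)
  finally have "I f = coeff f 0 * I 1 + coeff f 1 * I [:0, 1:] + coeff f 2 * I [:0, 0, 1:]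
      + coeff f 3 * I [:0, 0, 0, 1:] + coeff f 4 * I [:0, 0, 0, 0, 1:]"
    by (metis I_add I_smult)
  then have "I f = I 1 * (coeff f 0 + coeff f 2 / n + coeff f 4 * (3 / (real n * (real n + 2))))"
    unfolding I_moments by (simp add: algebra_simps)
  then have "c' 0 = coeff f 0 + coeff f 2 / n + coeff f 4 * (3 / (real n * (real n + 2)))"
    using If I1 by simp
  also have "\<dots> = (\<Sum>k\<le>4. coeff f k * sphere_moment n k)"
    by (simp add: eval_nat_numeral field_simps)
  finally have "c' 0 = (\<Sum>k\<le>4. coeff f k * sphere_moment n k)" .
  moreover have "gegenbauer_expansion n f c'"
    unfolding gegenbauer_expansion_def using f by (simp add: c'_def)
  ultimately show ?thesis by blast
qed

end

section \<open>Designs and linear programming\<close>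

lemma finite_multi_indices: "finite {a :: 'n::finite \<Rightarrow> nat. (\<Sum>i\<in>UNIV. a i) \<le> d}"
proof (rule finite_subset)
  show "{a :: 'n \<Rightarrow> nat. (\<Sum>i\<in>UNIV. a i) \<le> d} \<subseteq> PiE UNIV (\<lambda>_. {..d})"
  proof
    fix a :: "'n \<Rightarrow> nat" assume a: "a \<in> {a. (\<Sum>i\<in>UNIV. a i) \<le> d}"
    have "a i \<le> d" for i
      using member_le_sum[of i UNIV a] a by simp
    then show "a \<in> PiE UNIV (\<lambda>_. {..d})" by auto
  qed
qed (intro finite_PiE, simp_all)

lemma polynomials_uptoI:
  assumes "f = (\<lambda>x. \<Sum>a | (\<Sum>i\<in>UNIV. a i) \<le> d. c a * (\<Prod>i\<in>UNIV. (x $ i) ^ a i))"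
  shows "f \<in> polynomials_upto d"
  unfolding polynomials_upto_def by (rule CollectI, rule exI[of _ c]) (simp only: assms UNIV_I simp_thms)

lemma polynomials_uptoE:
  assumes "f \<in> polynomials_upto d"
  obtains c where "f = (\<lambda>x. \<Sum>a | (\<Sum>i\<in>UNIV. a i) \<le> d. c a * (\<Prod>i\<in>UNIV. (x $ i) ^ a i))"
  using assms unfolding polynomials_upto_def by (elim CollectE exE conjE)

lemma polynomials_upto_add:
  assumes "f \<in> polynomials_upto d" "g \<in> polynomials_upto d"
  shows "(\<lambda>x. f x + g x) \<in> polynomials_upto d"
proof -
  obtain c where c: "f = (\<lambda>x. \<Sum>a | (\<Sum>i\<in>UNIV. a i) \<le> d. c a * (\<Prod>i\<in>UNIV. (x $ i) ^ a i))"
    using assms(1) by (rule polynomials_uptoE)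
  obtain e where e: "g = (\<lambda>x. \<Sum>a | (\<Sum>i\<in>UNIV. a i) \<le> d. e a * (\<Prod>i\<in>UNIV. (x $ i) ^ a i))"
    using assms(2) by (rule polynomials_uptoE)
  from c e have "(\<lambda>x. f x + g x) = (\<lambda>x. \<Sum>a | (\<Sum>i\<in>UNIV. a i) \<le> d. (c a + e a) * (\<Prod>i\<in>UNIV. (x $ i) ^ a i))"
    by (simp add: sum.distrib distrib_right)
  then show ?thesis by (rule polynomials_uptoI)
qed

lemma polynomials_upto_monomial:
  assumes "(\<Sum>i\<in>UNIV. b i) \<le> d"
  shows "(\<lambda>x. r * (\<Prod>i\<in>UNIV. (x $ i) ^ b i)) \<in> polynomials_upto d"
proof -
  have "(\<lambda>x. r * (\<Prod>i\<in>UNIV. (x $ i) ^ b i)) =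
      (\<lambda>x. \<Sum>a | (\<Sum>i\<in>UNIV. a i) \<le> d. (if a = b then r else 0) * (\<Prod>i\<in>UNIV. (x $ i) ^ a i))"
  proof
    fix x :: "real ^ 'a"
    have "(\<Sum>a | (\<Sum>i\<in>UNIV. a i) \<le> d. (if a = b then r else 0) * (\<Prod>i\<in>UNIV. (x $ i) ^ a i)) =
        (\<Sum>a | (\<Sum>i\<in>UNIV. a i) \<le> d. if a = b then r * (\<Prod>i\<in>UNIV. (x $ i) ^ a i) else 0)"
      by (intro sum.cong) auto
    also have "\<dots> = r * (\<Prod>i\<in>UNIV. (x $ i) ^ b i)"
      using assms finite_multi_indices by (subst sum.delta) auto
    finally show "r * (\<Prod>i\<in>UNIV. (x $ i) ^ b i) =
      (\<Sum>a | (\<Sum>i\<in>UNIV. a i) \<le> d. (if a = b then r else 0) * (\<Prod>i\<in>UNIV. (x $ i) ^ a i))" ..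
  qed
  then show ?thesis by (rule polynomials_uptoI)
qed

lemma polynomials_upto_sum:
  assumes "finite S" "\<And>j. j \<in> S \<Longrightarrow> f j \<in> polynomials_upto d"
  shows "(\<lambda>x. \<Sum>j\<in>S. f j x) \<in> polynomials_upto d"
  using assms
proof (induction S rule: finite_induct)
  case empty
  show ?case using polynomials_upto_monomial[of "\<lambda>_. 0" d 0] by simp
next
  case (insert j S)
  then show ?case using polynomials_upto_add[of "f j" d] by simp
qed

lemma polynomials_upto_coordinate:
  assumes "f \<in> polynomials_upto d"
  shows "(\<lambda>x. r * (x $ j) * f x) \<in> polynomials_upto (Suc d)"
proof -
  obtain c where f: "f = (\<lambda>x. \<Sum>a | (\<Sum>i\<in>UNIV. a i) \<le> d. c a * (\<Prod>i\<in>UNIV. (x $ i) ^ a i))"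
    using assms by (rule polynomials_uptoE)
  define e where "e a i = (if i = j then Suc (a i) else a i)" for a :: "'a \<Rightarrow> nat" and i
  have mono: "(x $ j) * (\<Prod>i\<in>UNIV. (x $ i) ^ a i) = (\<Prod>i\<in>UNIV. (x $ i) ^ e a i)" for x :: "real ^ 'a" and a
  proof -
    have "(\<Prod>i\<in>UNIV. (x $ i) ^ e a i) = (x $ j) ^ Suc (a j) * (\<Prod>i\<in>UNIV - {j}. (x $ i) ^ a i)"
      by (subst prod.remove[of _ j]) (auto simp: e_def intro!: prod.cong)
    moreover have "(\<Prod>i\<in>UNIV. (x $ i) ^ a i) = (x $ j) ^ a j * (\<Prod>i\<in>UNIV - {j}. (x $ i) ^ a i)"
      by (subst prod.remove[of _ j]) auto
    ultimately show ?thesis by simp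
  qed
  have deg: "(\<Sum>i\<in>UNIV. e a i) = Suc (\<Sum>i\<in>UNIV. a i)" for a
  proof -
    have "(\<Sum>i\<in>UNIV. e a i) = (\<Sum>i\<in>UNIV. a i + (if i = j then 1 else 0))"
      by (intro sum.cong) (auto simp: e_def)
    then show ?thesis by (simp add: sum.distrib)
  qed
  have "(\<lambda>x. r * (x $ j) * f x) =
      (\<lambda>x. \<Sum>a | (\<Sum>i\<in>UNIV. a i) \<le> d. (r * c a) * (\<Prod>i\<in>UNIV. (x $ i) ^ e a i))"
    unfolding f mono[symmetric] by (simp add: sum_distrib_left mult_ac)
  also have "\<dots> \<in> polynomials_upto (Suc d)"
    by (intro polynomials_upto_sum finite_multi_indices polynomials_upto_monomial) (simp add: deg)
  finally show ?thesis .
qed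

lemma inner_power_polynomial: "(\<lambda>y. (x \<bullet> y)^k) \<in> polynomials_upto k"
proof (induction k)
  case 0
  show ?case using polynomials_upto_monomial[of "\<lambda>_. 0" 0 1] by simp
next
  case (Suc k)
  have "(\<lambda>y. (x \<bullet> y)^Suc k) = (\<lambda>y. \<Sum>j\<in>UNIV. (x $ j) * (y $ j) * (x \<bullet> y)^k)"
    by (simp add: inner_vec_def sum_distrib_right mult_ac)
  also have "\<dots> \<in> polynomials_upto (Suc k)"
    by (intro polynomials_upto_sum polynomials_upto_coordinate Suc.IH) simp
  finally show ?case .
qed

lemma polynomials_upto_mono:
  assumes "f \<in> polynomials_upto k" "k \<le> d"
  shows "f \<in> polynomials_upto d"
proof -
  obtain c where f: "f = (\<lambda>x. \<Sum>a | (\<Sum>i\<in>UNIV. a i) \<le> k. c a * (\<Prod>i\<in>UNIV. (x $ i) ^ a i))"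
    using assms(1) by (rule polynomials_uptoE)
  show ?thesis unfolding f
    using assms(2) by (intro polynomials_upto_sum finite_multi_indices polynomials_upto_monomial) simp
qed

section \<open>Designs through moments, and the linear programming bound\<close>

lemma sphere_integral_power:
  fixes x :: "real^'n::{finite,wellorder}"
  shows "(\<integral>u. (x \<bullet> u)^k \<partial>sphere_measure) = sphere_moment CARD('n) k * norm x ^ k"
  using moments.moment[OF moments_sphere[where 'n = 'n and d = k], of x k]
    prob_space.prob_space[OF prob_space_sphere[where 'n = 'n]] by simp

lemma design_moment:
  fixes C :: "(real^'n::{finite,wellorder}) set"
  assumes C: "spherical_design d C" and k: "k \<le> d"
  shows "(\<Sum>y\<in>C. (x \<bullet> y)^k) = real (card C) * (sphere_moment CARD('n) k * norm x ^ k)"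
proof -
  have "(\<lambda>y. (x \<bullet> y)^k) \<in> polynomials_upto d"
    by (rule polynomials_upto_mono[OF inner_power_polynomial k])
  then have "(\<Sum>y\<in>C. (x \<bullet> y)^k) / real (card C) = (\<integral>u. (x \<bullet> u)^k \<partial>sphere_measure)"
    using C unfolding spherical_design_def by blast
  moreover have "card C > 0"
    using C unfolding spherical_design_def spherical_code_def by (simp add: card_gt_0_iff)
  ultimately show ?thesis unfolding sphere_integral_power by (simp add: field_simps)
qed

text \<open>Polarization: if the averages of all powers \<open>(x \<bullet> y)^k\<close> agree with their integrals, comparing
  coefficients of \<open>s\<close> in \<open>((x + s e) \<bullet> y)^k\<close> splits off one coordinate at a time.\<close>

lemma moment_design:
  fixes C :: "(real^'n::{finite,wellorder}) set"
  assumes fin: "finite C" and ne: "C \<noteq> {}" and unit: "\<And>y. y \<in> C \<Longrightarrow> norm y = 1"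
    and mom: "\<And>x k. k \<le> d \<Longrightarrow> (\<Sum>y\<in>C. (x \<bullet> y)^k) = real (card C) * (sphere_moment CARD('n) k * norm x ^ k)"
  shows "spherical_design d C"
proof -
  define \<Delta> where "\<Delta> f = (\<Sum>y\<in>C. f y) / real (card C) - (\<integral>u. f u \<partial>sphere_measure)" for f :: "real^'n::_ \<Rightarrow> real"
  have \<Delta>_sum: "\<Delta> (\<lambda>y. \<Sum>j\<in>J. r j * f j y) = (\<Sum>j\<in>J. r j * \<Delta> (f j))"
    if "finite J" "\<And>j. j \<in> J \<Longrightarrow> continuous_on UNIV (f j)" for J :: "'i set" and r f
  proof -
    have "(\<integral>u. (\<Sum>j\<in>J. r j * f j u) \<partial>sphere_measure) = (\<Sum>j\<in>J. r j * (\<integral>u. f j u \<partial>sphere_measure))"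
      using that(2) by (subst Bochner_Integration.integral_sum) (auto intro: integrable_sphere)
    moreover have "(\<Sum>y\<in>C. \<Sum>j\<in>J. r j * f j y) / real (card C) = (\<Sum>j\<in>J. r j * ((\<Sum>y\<in>C. f j y) / real (card C)))"
      by (subst sum.swap) (simp add: sum_distrib_left sum_divide_distrib)
    ultimately show ?thesis unfolding \<Delta>_def by (simp add: right_diff_distrib sum_subtractf)
  qed
  \<comment> \<open>The statement interpolates between the hypothesis (S empty) and plain monomials
    (S everything, k = 0), which is what the induction on S requires.\<close>
  have zero: "\<Delta> (\<lambda>y. (\<Prod>i\<in>S. (y $ i) ^ a i) * (x \<bullet> y)^k) = 0"
    if "finite S" "(\<Sum>i\<in>S. a i) + k \<le> d" for S a k x
    using that
  proof (induction S arbitrary: k x rule: finite_induct)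
    case empty
    have "card C > 0" using fin ne by (simp add: card_gt_0_iff)
    then show ?case using mom[of k x] empty unfolding \<Delta>_def by (simp add: sphere_integral_power)
  next
    case (insert j S)
    let ?g = "\<lambda>l y. (\<Prod>i\<in>S. (y $ i) ^ a i) * ((y $ j)^l * (x \<bullet> y)^(a j + k - l))"
    have cont: "continuous_on UNIV (?g l)" for l
      by (intro continuous_intros)
    have "(\<Sum>l\<le>a j + k. (real (a j + k choose l) * \<Delta> (?g l)) * s^l) = 0" for s
    proof -
      have "(\<Prod>i\<in>S. (y $ i) ^ a i) * ((x + s *\<^sub>R axis j 1) \<bullet> y)^(a j + k) =
          (\<Sum>l\<le>a j + k. (real (a j + k choose l) * s^l) * ?g l y)" for y
      proof -
        have "(x + s *\<^sub>R axis j 1) \<bullet> y = s * (y $ j) + x \<bullet> y"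
          by (simp add: inner_add_left inner_axis' add.commute)
        then show ?thesis
          by (simp only: binomial_ring sum_distrib_left) (auto intro!: sum.cong simp: power_mult_distrib)
      qed
      then have "\<Delta> (\<lambda>y. (\<Prod>i\<in>S. (y $ i) ^ a i) * ((x + s *\<^sub>R axis j 1) \<bullet> y)^(a j + k)) =
          (\<Sum>l\<le>a j + k. (real (a j + k choose l) * s^l) * \<Delta> (?g l))"
        using \<Delta>_sum[of "{..a j + k}" ?g "\<lambda>l. real (a j + k choose l) * s^l"] cont by simp
      moreover have "\<Delta> (\<lambda>y. (\<Prod>i\<in>S. (y $ i) ^ a i) * ((x + s *\<^sub>R axis j 1) \<bullet> y)^(a j + k)) = 0"
        using insert.prems insert.hyps by (intro insert.IH) simp
      ultimately show ?thesis by (simp add: mult_ac)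
    qed
    then have "\<forall>s. (\<Sum>l\<le>a j + k. (real (a j + k choose l) * \<Delta> (?g l)) * s^l) = 0" by blast
    then have "\<forall>l\<le>a j + k. real (a j + k choose l) * \<Delta> (?g l) = 0" unfolding polyfun_eq_0 .
    from this[rule_format, of "a j"] have "\<Delta> (?g (a j)) = 0" by simp
    moreover have "?g (a j) = (\<lambda>y. (\<Prod>i\<in>insert j S. (y $ i) ^ a i) * (x \<bullet> y)^k)"
      using insert.hyps by (simp add: mult_ac)
    ultimately show ?case by simp
  qed
  have "(\<Sum>x\<in>C. p x) / real (card C) = integral\<^sup>L sphere_measure p" if p: "p \<in> polynomials_upto d" for p
  proof -
    obtain c where p: "p = (\<lambda>x. \<Sum>a | (\<Sum>i\<in>UNIV. a i) \<le> d. c a * (\<Prod>i\<in>UNIV. (x $ i) ^ a i))"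
      using p by (rule polynomials_uptoE)
    have "\<Delta> p = (\<Sum>a | (\<Sum>i\<in>UNIV. a i) \<le> d. c a * \<Delta> (\<lambda>x. \<Prod>i\<in>UNIV. (x $ i) ^ a i))"
      unfolding p by (rule \<Delta>_sum[OF finite_multi_indices]) (intro continuous_intros)
    also have "\<dots> = 0"
    proof (intro sum.neutral ballI)
      fix a :: "'n \<Rightarrow> nat" assume "a \<in> {a. (\<Sum>i\<in>UNIV. a i) \<le> d}"
      then show "c a * \<Delta> (\<lambda>x. \<Prod>i\<in>UNIV. (x $ i) ^ a i) = 0"
        using zero[of UNIV a 0 0] by simp
    qed
    finally show ?thesis by (simp add: \<Delta>_def)
  qed
  then show ?thesis
    unfolding spherical_design_def spherical_code_def using fin ne unit by auto
qed

text \<open>Fix one point x of C. In the sum of f(x . y) over y the term y = x is f(1) and the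
  others are nonnegative, while the design property evaluates the sum as |C| times the spherical
  mean of f.\<close>

lemma avoiding_design_bound:
  fixes C :: "(real^'n::{finite,wellorder}) set" and f :: "real poly"
  assumes C: "spherical_design d C" "avoiding T C"
    and f: "degree f \<le> d" "\<And>t. t \<in> {-1..1} - T \<Longrightarrow> poly f t \<ge> 0"
  shows "poly f 1 \<le> real (card C) * (\<Sum>k\<le>d. coeff f k * sphere_moment CARD('n) k)"
proof -
  have fin: "finite C" "C \<noteq> {}" and unit: "\<And>x. x \<in> C \<Longrightarrow> norm x = 1"
    using C(1) unfolding spherical_design_def spherical_code_def by auto
  have pf: "poly f t = (\<Sum>k\<le>d. coeff f k * t^k)" for t
    using f(1) by (simp add: poly_altdef) (rule sum.mono_neutral_left, auto simp: coeff_eq_0)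
  obtain x where x: "x \<in> C" using fin(2) by blast
  have xx: "x \<bullet> x = 1" using unit[OF x] by (simp add: norm_eq_1)
  have "poly f (x \<bullet> x) \<le> (\<Sum>y\<in>C. poly f (x \<bullet> y))"
  proof (rule member_le_sum[OF x _ fin(1)])
    fix y assume y: "y \<in> C - {x}"
    have "\<bar>x \<bullet> y\<bar> \<le> 1" using Cauchy_Schwarz_ineq2[of x y] unit x y by simp
    moreover have "x \<bullet> y \<in> inner_products C" unfolding inner_products_def using x y by blast
    then have "x \<bullet> y \<notin> T" using C(2) unfolding avoiding_def by blast
    ultimately show "0 \<le> poly f (x \<bullet> y)" by (intro f(2)) auto
  qed
  also have "\<dots> = (\<Sum>k\<le>d. coeff f k * (\<Sum>y\<in>C. (x \<bullet> y)^k))"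
    unfolding pf by (subst sum.swap) (simp add: sum_distrib_left)
  also have "\<dots> = (\<Sum>k\<le>d. coeff f k * (real (card C) * sphere_moment CARD('n) k))"
    using design_moment[OF C(1), of _ x] unit[OF x] by (intro sum.cong) auto
  also have "\<dots> = real (card C) * (\<Sum>k\<le>d. coeff f k * sphere_moment CARD('n) k)"
    by (simp add: sum_distrib_left mult_ac)
  finally show ?thesis unfolding xx .
qed

section \<open>The code with 2025 points\<close>

text \<open>The interpolant p has the same total at every unit vector orthogonal to x, and at a
  known deep hole v the totals of p and h agree. If w saw some point off the nodes, the total of h
  at w would strictly exceed this common value.\<close>

lemma C_half_potential_minimum:
  assumes x: "x \<in> leech_code" and h: "absolutely_monotone_potential h"
    and nonpoly: "\<not> (\<exists>p :: real poly. degree p \<le> 7 \<and> (\<forall>t\<in>{-1<..<1}. h t = ereal (poly p t)))"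
    and w: "is_minimum_of_potential h x w"
  shows "deep_hole x w"
proof -
  obtain p :: "real poly" where p: "degree p \<le> 7"
    and ge: "\<And>t. t \<in> {-1..1} \<Longrightarrow> ereal (poly p t) \<le> h t"
    and gr: "\<And>t. t \<in> {-1..1} \<Longrightarrow> t \<notin> nodes \<Longrightarrow> ereal (poly p t) < h t"
    and eq: "\<And>t. t \<in> nodes \<Longrightarrow> h t = ereal (poly p t)"
    by (rule potential_interpolant[OF h nonpoly]; blast)
  obtain v where v: "deep_hole x v" using deep_hole_exists[OF x] by blast
  have w1: "norm w = 1" "w \<bullet> x = 0" and wmin: "\<And>u. norm u = 1 \<Longrightarrow> u \<bullet> x = 0 \<Longrightarrow>
      \<not> (\<Sum>y\<in>C_half x. h (u \<bullet> y)) < (\<Sum>y\<in>C_half x. h (w \<bullet> y))"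
    using w unfolding is_minimum_of_potential_def is_arg_min_def by blast+
  have v1: "norm v = 1" "v \<bullet> x = 0" and vn: "\<And>c. c \<in> C_half x \<Longrightarrow> v \<bullet> c \<in> nodes"
    using v unfolding deep_hole_def nodes_def by blast+
  note C = C_half_moments[OF x]
  have avg: "(\<Sum>y\<in>C_half x. poly p (u \<bullet> y)) = (\<Sum>k\<le>degree p. coeff p k * (4600 * sphere_moment 23 k))"
    if u: "norm u = 1" "u \<bullet> x = 0" for u
  proof -
    have "(\<Sum>y\<in>C_half x. poly p (u \<bullet> y)) = (\<Sum>k\<le>degree p. coeff p k * (\<Sum>y\<in>C_half x. (u \<bullet> y)^k))"
      unfolding poly_altdef by (subst sum.swap) (simp add: sum_distrib_left)
    also have "\<dots> = (\<Sum>k\<le>degree p. coeff p k * (4600 * sphere_moment 23 k))"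
      using count_moments_sum1[OF C(3,1), of u] u p C(2) by (intro sum.cong) auto
    finally show ?thesis .
  qed
  have range: "w \<bullet> c \<in> {-1..1}" if "c \<in> C_half x" for c
  proof -
    have "norm c = 1" using C_half_inner(3)[OF x that that] by (simp add: norm_eq_1)
    then show ?thesis using Cauchy_Schwarz_ineq2[of w c] w1(1) by auto
  qed
  have "w \<bullet> c \<in> nodes" if c: "c \<in> C_half x" for c
  proof (rule ccontr)
    assume nc: "w \<bullet> c \<notin> nodes"
    let ?rest = "C_half x - {c}"
    have "(\<Sum>y\<in>C_half x. h (v \<bullet> y)) = (\<Sum>y\<in>C_half x. ereal (poly p (v \<bullet> y)))"
      using vn eq by (intro sum.cong) auto
    also have "\<dots> = ereal (\<Sum>y\<in>C_half x. poly p (w \<bullet> y))"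
      using avg[OF v1] avg[OF w1] by simp
    also have "\<dots> = ereal (poly p (w \<bullet> c)) + ereal (\<Sum>y\<in>?rest. poly p (w \<bullet> y))"
      using sum.remove[OF C(1) c, of "\<lambda>y. poly p (w \<bullet> y)"] by simp
    \<comment> \<open>The strict comparison comes first, while the other summands are still finite
      values of p; a strict inequality does not survive adding infinity to both sides.\<close>
    also have "\<dots> < h (w \<bullet> c) + ereal (\<Sum>y\<in>?rest. poly p (w \<bullet> y))"
      using gr[OF range[OF c] nc] by (cases "h (w \<bullet> c)") auto
    also have "ereal (\<Sum>y\<in>?rest. poly p (w \<bullet> y)) = (\<Sum>y\<in>?rest. ereal (poly p (w \<bullet> y)))"
      by simp
    also have "h (w \<bullet> c) + \<dots> \<le> h (w \<bullet> c) + (\<Sum>y\<in>?rest. h (w \<bullet> y))"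
      using ge range by (intro add_left_mono sum_mono) auto
    also have "\<dots> = (\<Sum>y\<in>C_half x. h (w \<bullet> y))"
      using sum.remove[OF C(1) c, of "\<lambda>y. h (w \<bullet> y)"] by simp
    finally show False using wmin[OF v1] by blast
  qed
  then show ?thesis using w1 unfolding deep_hole_def nodes_def by blast
qed

text \<open>Here and in \<open>upper_poly\<close>, simple zeros sit at the ends of the forbidden
  interval, where alone the sign is negative, and the double zero sits at the remaining inner
  product of \<open>C2025\<close>. All inner products being zeros, equality holds in the
  bound.\<close>

definition lower_poly :: "real poly" where
  "lower_poly = [:4/11, 1:]^2 * ([:1/44, 1:] * [:-7/22, 1:])"

definition upper_poly :: "real poly" where
  "upper_poly = ([:4/11, 1:] * [:1/44, 1:]) * [:-7/22, 1:]^2"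

lemma test_poly_properties:
  "degree lower_poly = 4" "degree upper_poly = 4"
  "t \<in> {-1..1} - {-1/44<..<7/22} \<Longrightarrow> poly lower_poly t \<ge> 0"
  "t \<in> {-1..1} - {-4/11<..<-1/44} \<Longrightarrow> poly upper_poly t \<ge> 0"
  "(\<Sum>k\<le>4. coeff lower_poly k * sphere_moment 22 k) > 0"
  "(\<Sum>k\<le>4. coeff upper_poly k * sphere_moment 22 k) > 0"
  "poly lower_poly 1 = 2025 * (\<Sum>k\<le>4. coeff lower_poly k * sphere_moment 22 k)"
  "poly upper_poly 1 = 2025 * (\<Sum>k\<le>4. coeff upper_poly k * sphere_moment 22 k)"
proof -
  have l: "lower_poly = [:-7/22 * (1/44) * (16/121), (1/44 - 7/22) * (16/121) - 7/22 * (1/44) * (8/11),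
      16/121 + (1/44 - 7/22) * (8/11) - 7/22 * (1/44), 8/11 + 1/44 - 7/22, 1:]"
    by (simp add: lower_poly_def power2_eq_square)
  have u: "upper_poly = [:4/11 * (1/44) * (49/484), (4/11 + 1/44) * (49/484) - 4/11 * (1/44) * (7/11),
      49/484 - (4/11 + 1/44) * (7/11) + 4/11 * (1/44), 4/11 + 1/44 - 7/11, 1:]"
    by (simp add: upper_poly_def power2_eq_square)
  show "degree lower_poly = 4" "degree upper_poly = 4" unfolding l u by simp_all
  have s: "sphere_moment 22 0 = 1" "sphere_moment 22 1 = 0" "sphere_moment 22 2 = 1/22" "sphere_moment 22 3 = 0" "sphere_moment 22 4 = 1/176"
    by (simp_all add: eval_nat_numeral)
  have four: "(\<Sum>k\<le>4. f k) = f 0 + f 1 + f 2 + f 3 + f (4::nat)" for f :: "nat \<Rightarrow> real"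
    by (simp add: eval_nat_numeral)
  show "(\<Sum>k\<le>4. coeff lower_poly k * sphere_moment 22 k) > 0" "(\<Sum>k\<le>4. coeff upper_poly k * sphere_moment 22 k) > 0"
    "poly lower_poly 1 = 2025 * (\<Sum>k\<le>4. coeff lower_poly k * sphere_moment 22 k)"
    "poly upper_poly 1 = 2025 * (\<Sum>k\<le>4. coeff upper_poly k * sphere_moment 22 k)"
    unfolding four s unfolding l u by (simp_all add: numeral_eq_Suc)
  show "poly lower_poly t \<ge> 0" if "t \<in> {-1..1} - {-1/44<..<7/22}"
  proof -
    have "t + 1/44 \<le> 0 \<and> t - 7/22 \<le> 0 \<or> t + 1/44 \<ge> 0 \<and> t - 7/22 \<ge> 0" using that by auto
    then have "(t + 1/44) * (t - 7/22) \<ge> 0" by (simp only: zero_le_mult_iff) blast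
    moreover have "poly lower_poly t = (t + 4/11)^2 * ((t + 1/44) * (t - 7/22))"
      by (simp add: lower_poly_def field_simps power2_eq_square)
    ultimately show ?thesis by simp
  qed
  show "poly upper_poly t \<ge> 0" if "t \<in> {-1..1} - {-4/11<..<-1/44}"
  proof -
    have "t + 4/11 \<le> 0 \<and> t + 1/44 \<le> 0 \<or> t + 4/11 \<ge> 0 \<and> t + 1/44 \<ge> 0" using that by auto
    then have "(t + 4/11) * (t + 1/44) \<ge> 0" by (simp only: zero_le_mult_iff) blast
    moreover have "poly upper_poly t = ((t + 4/11) * (t + 1/44)) * (t - 7/22)^2"
      by (simp add: upper_poly_def field_simps power2_eq_square)
    ultimately show ?thesis by simp
  qed
qed

lemma CARD22: "CARD(22) = 22" by simp

lemma avoiding_design_card: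
  fixes C :: "(real^22) set"
  assumes C: "spherical_design 4 C" and T: "avoiding {-1/44<..<7/22} C \<or> avoiding {-4/11<..<-1/44} C"
  shows "2025 \<le> card C"
proof -
  note tp = test_poly_properties
  have bound: "2025 \<le> card C"
    if "avoiding T C" "degree f = 4" "\<And>t. t \<in> {-1..1} - T \<Longrightarrow> poly f t \<ge> 0"
      "0 < s" "poly f 1 = 2025 * s" "s = (\<Sum>k\<le>4. coeff f k * sphere_moment 22 k)" for T f s
  proof -
    have "2025 * s \<le> real (card C) * (\<Sum>k\<le>4. coeff f k * sphere_moment CARD(22) k)"
      unfolding that(5)[symmetric]
      by (rule avoiding_design_bound[OF C that(1)]) (simp_all add: that(2,3))
    also have "\<dots> = real (card C) * s" unfolding that(6) CARD22 ..
    finally show ?thesis using that(4) by (simp only: mult_le_cancel_right_pos)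
  qed
  from T show ?thesis
  proof
    assume "avoiding {-1/44<..<7/22} C"
    then show ?thesis by (rule bound[OF _ tp(1,3,5,7) refl])
  next
    assume "avoiding {-4/11<..<-1/44} C"
    then show ?thesis by (rule bound[OF _ tp(2,4,6,8) refl])
  qed
qed

lemma tight_avoiding_designI:
  fixes C :: "(real^22) set"
  assumes C: "spherical_design 4 C" "avoiding T C" "card C = 2025"
    and f: "degree f = 4" "\<And>t. t \<in> {-1..1} - T \<Longrightarrow> poly f t \<ge> 0"
      "(\<Sum>k\<le>4. coeff f k * sphere_moment 22 k) > 0"
      "poly f 1 = 2025 * (\<Sum>k\<le>4. coeff f k * sphere_moment 22 k)"
  shows "tight_avoiding_design 4 T C"
proof -
  interpret gegenbauer_weight 22 by standard simp
  obtain c where c: "gegenbauer_expansion 22 f c" "c 0 = (\<Sum>k\<le>4. coeff f k * sphere_moment 22 k)"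
    using gegenbauer_expansion_exists[of f] f(1) by auto
  have "c i = 0" if "i \<ge> 4 + 1" for i
    using c(1) f(1) that unfolding gegenbauer_expansion_def by simp
  then have "gegenbauer_expansion CARD(22) f c \<and> (\<forall>t\<in>{-1..1} - T. poly f t \<ge> 0) \<and> c 0 > 0 \<and>
      (\<forall>i\<ge>4 + 1. c i \<le> 0) \<and> real (card C) = poly f 1 / c 0"
    using c f C(3) by simp
  then show ?thesis unfolding tight_avoiding_design_def using C(1,2) by blast
qed

lemma dim_complement:
  fixes x w :: vec24
  assumes "norm x = 1" "norm w = 1" "w \<bullet> x = 0"
  shows "subspace {v. v \<bullet> x = 0 \<and> v \<bullet> w = 0}" "dim {v. v \<bullet> x = 0 \<and> v \<bullet> w = 0} = 22"
proof -
  show "subspace {v. v \<bullet> x = 0 \<and> v \<bullet> w = 0}" by (simp add: subspace_def inner_add_left)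
  have ne: "x \<noteq> w" "0 \<notin> {x, w}" using assms by (auto simp: norm_eq_1)
  have "pairwise orthogonal {x, w}"
    using assms(3) by (auto simp: pairwise_def orthogonal_def inner_commute)
  then have ind: "independent {x, w}" using ne(2) by (rule pairwise_orthogonal_independent)
  have "dim (span {x, w}) = 2"
    using dim_eq_card_independent[OF ind] ne(1) by simp
  moreover have "dim {y \<in> UNIV. \<forall>u\<in>span {x, w}. orthogonal u y} + dim (span {x, w}) = dim (UNIV :: vec24 set)"
    by (rule dim_subspace_orthogonal_to_vectors) simp_all
  moreover have "{y \<in> UNIV. \<forall>u\<in>span {x, w}. orthogonal u y} = {v. v \<bullet> x = 0 \<and> v \<bullet> w = 0}"
  proof -
    have "(\<forall>u\<in>span {x, w}. orthogonal u y) \<longleftrightarrow> (\<forall>u\<in>{x, w}. orthogonal u y)" for y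
      using orthogonal_to_span[of _ "{x, w}" y] span_base[of _ "{x, w}"] by (auto simp: orthogonal_commute)
    then show ?thesis by (auto simp: orthogonal_def inner_commute)
  qed
  ultimately show "dim {v. v \<bullet> x = 0 \<and> v \<bullet> w = 0} = 22"
    by (simp add: card_coordinates)
qed

text \<open>The three inner products avoid both intervals because these are open and their ends are
  consecutive inner products of the code. The moment identities on the complement of x and w carry
  over because the isometry is onto.\<close>

lemma C2025_image:
  assumes x: "x \<in> leech_code" and w: "deep_hole x w" and \<phi>: "isometry_on_complement x w \<phi>"
  shows "spherical_design 4 (\<phi> ` C2025 x w)" "card (\<phi> ` C2025 x w) = 2025"
    "avoiding {-1/44<..<7/22} (\<phi> ` C2025 x w)" "avoiding {-4/11<..<-1/44} (\<phi> ` C2025 x w)"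
proof -
  define V where "V = {v. v \<bullet> x = 0 \<and> v \<bullet> w = 0}"
  have xw: "norm x = 1" "norm w = 1" "w \<bullet> x = 0"
    using leech_code_norm[OF x] w by (auto simp: deep_hole_def norm_eq_1)
  have V: "subspace V" "dim V = 22" unfolding V_def using dim_complement[OF xw] by blast+
  have lin: "linear \<phi>" and nrm: "\<And>v. v \<in> V \<Longrightarrow> norm (\<phi> v) = norm v"
    using \<phi> unfolding isometry_on_complement_def V_def by auto
  have inner: "\<phi> u \<bullet> \<phi> v = u \<bullet> v" if "u \<in> V" "v \<in> V" for u v
    using isometry_inner[OF lin V(1) nrm that] .
  have inj: "inj_on \<phi> V"
  proof (rule inj_onI)
    fix u v assume uv: "u \<in> V" "v \<in> V" "\<phi> u = \<phi> v"
    have "u - v \<in> V" using V(1) uv(1,2) by (rule subspace_diff)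
    then have "norm (u - v) = norm (\<phi> (u - v))" using nrm by simp
    also have "\<dots> = 0" using uv(3) by (simp add: linear_diff[OF lin])
    finally show "u = v" by simp
  qed
  \<comment> \<open>An injective linear map from dimension 22 to \<open>real^22\<close>; hence every
    test vector u has the form \<phi> v with v in V, and a unit vector for the count of
    \<open>C2025\<close> exists.\<close>
  have img: "\<phi> ` V = UNIV"
  proof -
    have "dim (\<phi> ` V) = dim V"
      using inj V(1) by (intro dim_image_eq[OF lin]) (simp add: span_eq_iff[THEN iffD2])
    then have "span (\<phi> ` V) = UNIV" using V(2) dim_eq_full[of "\<phi> ` V"] by simp
    moreover have "subspace (\<phi> ` V)" using lin V(1) by (rule linear_subspace_image)
    ultimately show ?thesis by (simp add: span_eq_iff[THEN iffD2])
  qed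
  note P = C2025_properties[OF x w]
  have CV: "C2025 x w \<subseteq> V" using P(2) by (auto simp: V_def)
  have injC: "inj_on \<phi> (C2025 x w)" using inj CV by (rule inj_on_subset)
  obtain e :: "real^22" where "norm e = 1" using vector_choose_size[of 1] by auto
  moreover obtain v where "v \<in> V" "\<phi> v = e" using img by (metis UNIV_I imageE)
  ultimately have v: "v \<bullet> x = 0 \<and> v \<bullet> w = 0 \<and> norm v = 1" using nrm by (auto simp: V_def)
  then have cardC: "card (C2025 x w) = 2025" using P(4) by blast
  then show card: "card (\<phi> ` C2025 x w) = 2025" using injC by (simp add: card_image)
  have ip: "inner_products (\<phi> ` C2025 x w) \<subseteq> {-4/11, -1/44, 7/22}"
  proof
    fix r assume "r \<in> inner_products (\<phi> ` C2025 x w)"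
    then obtain c d where cd: "c \<in> C2025 x w" "d \<in> C2025 x w" "\<phi> c \<noteq> \<phi> d" "r = \<phi> c \<bullet> \<phi> d"
      unfolding inner_products_def by blast
    then have "c \<noteq> d" "r = c \<bullet> d" using inner[of c d] CV by auto
    then show "r \<in> {-4/11, -1/44, 7/22}" using P(3)[OF cd(1,2)] by simp
  qed
  have "{-4/11, -1/44, 7/22} \<inter> {-1/44<..<7/22::real} = {}" "{-4/11, -1/44, 7/22} \<inter> {-4/11<..<-1/44::real} = {}"
    by auto
  then show "avoiding {-1/44<..<7/22} (\<phi> ` C2025 x w)" "avoiding {-4/11<..<-1/44} (\<phi> ` C2025 x w)"
    using ip unfolding avoiding_def by blast+
  show "spherical_design 4 (\<phi> ` C2025 x w)"
  proof (rule moment_design)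
    show "finite (\<phi> ` C2025 x w)" using P(1) by simp
    show "\<phi> ` C2025 x w \<noteq> {}" using cardC by auto
    show "norm y = 1" if "y \<in> \<phi> ` C2025 x w" for y
      using that P(2) nrm CV by auto
    fix u :: "real^22" and k :: nat assume k: "k \<le> 4"
    have unit: "(\<Sum>y\<in>\<phi> ` C2025 x w. (u \<bullet> y)^k) = 2025 * sphere_moment 22 k" if u: "norm u = 1" for u :: "real^22"
    proof -
      obtain v where v: "v \<in> V" "u = \<phi> v" using img by (metis UNIV_I imageE)
      have "(\<Sum>y\<in>\<phi> ` C2025 x w. (u \<bullet> y)^k) = (\<Sum>y\<in>C2025 x w. (\<phi> v \<bullet> \<phi> y)^k)"
        unfolding v(2) by (rule sum.reindex[OF injC, unfolded o_def])
      also have "\<dots> = (\<Sum>y\<in>C2025 x w. (v \<bullet> y)^k)"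
      proof (rule sum.cong[OF refl])
        fix y assume "y \<in> C2025 x w"
        then have "y \<in> V" using CV by blast
        then show "(\<phi> v \<bullet> \<phi> y)^k = (v \<bullet> y)^k" using inner[OF v(1)] by simp
      qed
      also have "\<dots> = 2025 * sphere_moment 22 k"
        using P(5)[of v k] v nrm[OF v(1)] u k by (simp add: V_def)
      finally show ?thesis .
    qed
    show "(\<Sum>y\<in>\<phi> ` C2025 x w. (u \<bullet> y)^k) = real (card (\<phi> ` C2025 x w)) * (sphere_moment CARD(22) k * norm u ^ k)"
    proof (cases "u = 0")
      case True
      then show ?thesis using card by (cases k) simp_all
    next
      case False
      have "norm (sgn u) = 1" using False by (simp add: norm_sgn)
      have "u = norm u *\<^sub>R sgn u" using False by (simp add: sgn_div_norm)
      then have "(\<Sum>y\<in>\<phi> ` C2025 x w. (u \<bullet> y)^k) = (\<Sum>y\<in>\<phi> ` C2025 x w. norm u ^ k * (sgn u \<bullet> y)^k)"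
        by (metis inner_scaleR_left power_mult_distrib)
      then show ?thesis using unit[OF \<open>norm (sgn u) = 1\<close>] card
        by (simp add: sum_distrib_left[symmetric])
    qed
  qed
qed

lemma isometry_on_complement_exists:
  assumes x: "x \<in> leech_code" and w: "deep_hole x w"
  shows "\<exists>\<phi>. isometry_on_complement x w \<phi>"
proof -
  have xw: "norm x = 1" "norm w = 1" "w \<bullet> x = 0"
    using leech_code_norm[OF x] w by (auto simp: deep_hole_def norm_eq_1)
  have "dim {v. v \<bullet> x = 0 \<and> v \<bullet> w = 0} = dim (UNIV :: (real^22) set)"
    using dim_complement(2)[OF xw] by simp
  then show ?thesis
  proof (rule isometries_subspaces[OF dim_complement(1)[OF xw] subspace_UNIV])
    fix f :: "vec24 \<Rightarrow> real^22"
    assume "linear f" "\<And>v. v \<in> {v. v \<bullet> x = 0 \<and> v \<bullet> w = 0} \<Longrightarrow> norm (f v) = norm v"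
    then show ?thesis unfolding isometry_on_complement_def by auto
  qed
qed

text \<open>An infimum of naturals over an empty set would be 0, so attainment needs an actual
  member: the image of \<open>C2025\<close> for the explicit deep hole, constructed without
  reference to any potential.\<close>

lemma min_avoiding_design_2025:
  assumes T: "T = {-1/44<..<7/22} \<or> T = {-4/11<..<-1/44}"
  shows "min_avoiding_design TYPE(22) 4 T = 2025"
proof -
  let ?A = "{card C | C :: (real^22) set. spherical_design 4 C \<and> avoiding T C}"
  have "leech_code \<noteq> {}" using card_leech by auto
  then obtain x where x: "x \<in> leech_code" by blast
  obtain w where w: "deep_hole x w" using deep_hole_exists[OF x] by blast
  obtain \<phi> where \<phi>: "isometry_on_complement x w \<phi>" using isometry_on_complement_exists[OF x w] by blast
  have "spherical_design 4 (\<phi> ` C2025 x w) \<and> avoiding T (\<phi> ` C2025 x w)" "card (\<phi> ` C2025 x w) = 2025"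
    using C2025_image[OF x w \<phi>] T by auto
  then have mem: "2025 \<in> ?A" by (metis (mono_tags, lifting) mem_Collect_eq)
  have "2025 \<le> a" if "a \<in> ?A" for a
    using that avoiding_design_card T by auto
  then have "2025 \<le> Inf ?A" using mem by (intro cInf_greatest) auto
  moreover have "Inf ?A \<le> 2025" using mem by (intro cInf_lower) auto
  ultimately show ?thesis unfolding min_avoiding_design_def by linarith
qed

theorem theorem6p6:
  shows "min_avoiding_design TYPE(22) 4 {-1/44<..<7/22} = 2025 \<and>
    min_avoiding_design TYPE(22) 4 {-4/11<..<-1/44} = 2025 \<and>
    (\<forall>x h w \<phi>.
       x \<in> leech_code \<and>
       absolutely_monotone_potential h \<and>
       \<not> (\<exists>p :: real poly. degree p \<le> 7 \<and> (\<forall>t\<in>{-1<..<1}. h t = ereal (poly p t))) \<and>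
       is_minimum_of_potential h x w \<and>
       isometry_on_complement x w \<phi> \<longrightarrow>
         tight_avoiding_design 4 {-1/44<..<7/22} (\<phi> ` C2025 x w) \<and>
         tight_avoiding_design 4 {-4/11<..<-1/44} (\<phi> ` C2025 x w))"
proof (intro conjI allI impI)
  show "min_avoiding_design TYPE(22) 4 {-1/44<..<7/22} = 2025"
    "min_avoiding_design TYPE(22) 4 {-4/11<..<-1/44} = 2025"
    by (rule min_avoiding_design_2025, simp)+
  fix x h w \<phi>
  assume a: "x \<in> leech_code \<and> absolutely_monotone_potential h \<and>
       \<not> (\<exists>p :: real poly. degree p \<le> 7 \<and> (\<forall>t\<in>{-1<..<1}. h t = ereal (poly p t))) \<and>
       is_minimum_of_potential h x w \<and> isometry_on_complement x w \<phi>"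
  then have x: "x \<in> leech_code" and \<phi>: "isometry_on_complement x w \<phi>" by blast+
  have w: "deep_hole x w" using a C_half_potential_minimum by blast
  note I = C2025_image[OF x w \<phi>]
  note tp = test_poly_properties
  show "tight_avoiding_design 4 {-1/44<..<7/22} (\<phi> ` C2025 x w)"
    by (rule tight_avoiding_designI[OF I(1,3,2) tp(1,3,5,7)])
  show "tight_avoiding_design 4 {-4/11<..<-1/44} (\<phi> ` C2025 x w)"
    by (rule tight_avoiding_designI[OF I(1,4,2) tp(2,4,6,8)])
qed

end
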